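(* Let $\Bbbk$ be an algebraically closed field. (1) Let $A$ be a finite-dimensional basic $\Bbbk$-algebra with a filtration by two-sided ideals $A=I_0\supsetneq I_1\supsetneq\dots\supsetneq I_N=0$ such that $I_iI_j\subset I_{i+j}$ (with $I_m=0$ for $m\ge N$) and all $I_i/I_{i+1}$ are semisimple $A$-bimodules. Assume that $A=\bigoplus_{i\ge0}A_i$ is positively graded with $I_j=\bigoplus_{i\ge j}A_i$ for all $j$. Then multiplication in $\mathfrak{C}=\mathfrak{C}(A)$ induces an isomorphism of left $\tilde{\mathcal{B}}$- and right $\mathcal{B}$-modules $$\mathfrak{C}\cong\tilde{\mathcal{B}}\otimes_{\mathtt{S}_{\mathbb{Z}}}\mathcal{B}.$$ (2) Let $\tilde A$ be obtained from a finite-dimensional $\Bbbk$-algebra given by a quiver with relations by attaching to each vertex $k$ a new vertex $\tilde k$ and an arrow $k\to\tilde k$, let $N$ be the nilpotency degree of $\mathrm{Rad}\,\tilde A$, and assume that $\tilde A=\bigoplus_{i\ge0}\tilde A_i$ is positively graded with $\mathrm{Rad}^j\tilde A=\bigoplus_{i\ge j}\tilde A_i$ for all $j$. Then multiplication in $\mathfrak{D}=\mathfrak{D}(\tilde A)$ induces an isomorphism of left $\tilde{\mathcal{B}}$- and right $\overline{\mathcal{B}}$-modules $$\mathfrak{D}\cong\tilde{\mathcal{B}}\otimes_{\mathtt{S}_{\mathbb{Z}}}\overline{\mathcal{B}}.$$ (The algebras $\mathfrak{C},\mathfrak{D},\tilde{\mathcal{B}},\mathcal{B},\overline{\mathcal{B}},\mathtt{S}_{\mathbb{Z}}$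 are defined in the context; in part (2) $\tilde{\mathcal B}$ and $\mathtt{S}_{\mathbb Z}$ are formed from $\tilde A$.)
   Context: For a graded filtered algebra $E$ ($E=A$ with $I_j$ in part (1); $E=\tilde A$ with $I_j=\mathrm{Rad}^j\tilde A$ in part (2)), $\mathfrak{C}(E)=\bigoplus_{r,c\in\mathbb{Z}}\mathfrak{C}_{r,c}$ is the algebra of $\mathbb{Z}\times\mathbb{Z}$-matrices with finitely many nonzero entries, where the entry in row $r$, column $c$ lies in $\mathfrak{C}_{r,c}=I_{r-c}$ if $r>c$, $E/I_{N-(c-r)}$ if $0\le c-r<N$, and $0$ if $c-r\ge N$, with multiplication induced from $E$. Given an algebra with quiver on vertices $1,\dots,n$ and relations $R$, $\tilde A$ is obtained by adding, for each $k$, a vertex $\tilde k$ and an arrow $\alpha_k:k\to\tilde k$ ($\alpha_k\in e_{\tilde k}\tilde Ae_k$) with no new relations. $\mathfrak{D}(\tilde A)=\mathfrak{C}\oplus\mathfrak{C}^*$, where $\mathfrak{C}=\mathfrak{C}(\tilde A)$ and $\mathfrak{C}^*$ is the restricted dual bimodule (the direct sum of the duals of the matrix entries, $(\mathfrak{C}_{c,r})^*$ being in row $r$, column $c$), with product $(a,f)(b,g)=(ab,ag+fb)$. Subalgebras (matrices with the indicated entries in row $r$, column $c$, all others zero): - $\mathtt{S}_{\mathbb{Z}}$: $E_0$ for $r=c$ (here $E_0\cong E/I_1$ is a maximal semisimple subalgebra of $E$). - $\tilde{\mathcal{B}}$: $E_0$, viewed in $E/I_{N-(c-r)}$, for $0\le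 c-r\le N-1$. - $\mathcal{B}$: $A_{r-c}$ for $r\ge c$. - $\overline{\mathcal{B}}$: $\overline A_{r-c}$ for $r\ge c$, where $\overline A_m=\tilde A_m\oplus(\tilde A_{N-1-m})^*\subset I_m\oplus(\tilde A/I_{N-m})^*$ (functionals supported in degree $N-1-m$). *)

theory Defs
  imports
    "HOL-Algebra.Free_Abelian_Groups"
    "HOL-Computational_Algebra.Polynomial"
    "HOL-Library.Set_Algebras"
    "Graph_Theory.Arc_Walk"
begin

section \<open>Algebras, ideals, radical\<close>

text \<open>
  Unital, not necessarily commutative algebras over a field. The sort
  \<open>{ring,monoid_mult}\<close> is used instead of \<open>ring_1\<close> because the latter excludes the zero ring.
\<close>

locale k_algebra = vector_space scale
  for scale :: "'k::field \<Rightarrow> 'a::{ring,monoid_mult} \<Rightarrow> 'a" +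
  assumes scale_mult_left: "scale c (x * y) = scale c x * y"
    and scale_mult_right: "scale c (x * y) = x * scale c y"

definition finite_dimensional :: "('k::field \<Rightarrow> 'a::ab_group_add \<Rightarrow> 'a) \<Rightarrow> bool" where
  "finite_dimensional scale \<longleftrightarrow> (\<exists>B. finite B \<and> module.span scale B = UNIV)"

definition add_subgroup :: "'a::ab_group_add set \<Rightarrow> bool" where
  "add_subgroup U \<longleftrightarrow> 0 \<in> U \<and> (\<forall>x\<in>U. \<forall>y\<in>U. x - y \<in> U)"

definition left_ideal :: "'a::{ring,monoid_mult} set \<Rightarrow> bool" where
  "left_ideal L \<longleftrightarrow> add_subgroup L \<and> (\<forall>a. \<forall>x\<in>L. a * x \<in> L)"

definition two_sided_ideal :: "'a::{ring,monoid_mult} set \<Rightarrow> bool" where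
  "two_sided_ideal J \<longleftrightarrow> add_subgroup J \<and> (\<forall>a. \<forall>x\<in>J. a * x \<in> J \<and> x * a \<in> J)"

definition maximal_left_ideal :: "'a::{ring,monoid_mult} set \<Rightarrow> bool" where
  "maximal_left_ideal L \<longleftrightarrow> left_ideal L \<and> L \<noteq> UNIV \<and>
     (\<forall>L'. left_ideal L' \<and> L \<subseteq> L' \<longrightarrow> L' = L \<or> L' = UNIV)"

definition jacobson_radical :: "'a::{ring,monoid_mult} set" where
  "jacobson_radical = \<Inter> {L. maximal_left_ideal L}"

definition ideal_prod :: "'a::{ring,monoid_mult} set \<Rightarrow> 'a set \<Rightarrow> 'a set" where
  "ideal_prod I J = {\<Sum>i<n. x i * y i | (n::nat) x y. \<forall>i<n. x i \<in> I \<and> y i \<in> J}"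

primrec rad_pow :: "nat \<Rightarrow> 'a::{ring,monoid_mult} set" where
  "rad_pow 0 = UNIV"
| "rad_pow (Suc j) = ideal_prod (rad_pow j) jacobson_radical"

definition rad_nilpotency_degree :: "'a::{ring,monoid_mult} itself \<Rightarrow> nat \<Rightarrow> bool" where
  "rad_nilpotency_degree _ N \<longleftrightarrow>
     (rad_pow N :: 'a set) = {0} \<and> (\<forall>m<N. (rad_pow m :: 'a set) \<noteq> {0})"


section \<open>Basic algebras\<close>

definition primitive_idempotent :: "'a::{ring,monoid_mult} \<Rightarrow> bool" where
  "primitive_idempotent e \<longleftrightarrow> e * e = e \<and> e \<noteq> 0 \<and>
     (\<forall>f g. f * f = f \<and> g * g = g \<and> f * g = 0 \<and> g * f = 0 \<and> e = f + g \<longrightarrow> f = 0 \<or> g = 0)"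

text \<open>Isomorphism of the right modules \<open>eA\<close> and \<open>fA\<close>.\<close>

definition right_projectives_iso :: "'a::{ring,monoid_mult} \<Rightarrow> 'a \<Rightarrow> bool" where
  "right_projectives_iso e f \<longleftrightarrow>
     (\<exists>h. bij_betw h (range ((*) e)) (range ((*) f)) \<and>
        (\<forall>x\<in>range ((*) e). \<forall>y\<in>range ((*) e). h (x + y) = h x + h y) \<and>
        (\<forall>x\<in>range ((*) e). \<forall>a. h (x * a) = h x * a))"

definition basic_algebra :: "'a::{ring,monoid_mult} itself \<Rightarrow> bool" where
  "basic_algebra _ \<longleftrightarrow>
     (\<exists>X :: 'a set. finite X \<and> (\<forall>e\<in>X. primitive_idempotent e) \<and>
        (\<forall>e\<in>X. \<forall>f\<in>X. e \<noteq> f \<longrightarrow> e * f = 0) \<and> (\<Sum>e\<in>X. e) = 1 \<and>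
        (\<forall>e\<in>X. \<forall>f\<in>X. e \<noteq> f \<longrightarrow> \<not> right_projectives_iso e f))"


section \<open>Filtrations and gradings\<close>

text \<open>
  A bimodule over the algebra \<open>'a\<close> is given by its additive group \<open>M\<close> (a group in the sense of
  HOL-Algebra), the left action \<open>l\<close> and the right action \<open>r\<close>.
\<close>

definition sub_bimodule ::
  "'m monoid \<Rightarrow> ('a \<Rightarrow> 'm \<Rightarrow> 'm) \<Rightarrow> ('m \<Rightarrow> 'a \<Rightarrow> 'm) \<Rightarrow> 'm set \<Rightarrow> bool" where
  "sub_bimodule M l r U \<longleftrightarrow> subgroup U M \<and> (\<forall>a. \<forall>u\<in>U. l a u \<in> U \<and> r u a \<in> U)"

definition simple_sub_bimodule ::
  "'m monoid \<Rightarrow> ('a \<Rightarrow> 'm \<Rightarrow> 'm) \<Rightarrow> ('m \<Rightarrow> 'a \<Rightarrow> 'm) \<Rightarrow> 'm set \<Rightarrow> bool" where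
  "simple_sub_bimodule M l r U \<longleftrightarrow> sub_bimodule M l r U \<and> U \<noteq> {\<one>\<^bsub>M\<^esub>} \<and>
     (\<forall>V. sub_bimodule M l r V \<and> V \<subseteq> U \<longrightarrow> V = {\<one>\<^bsub>M\<^esub>} \<or> V = U)"

definition semisimple_bimodule ::
  "'m monoid \<Rightarrow> ('a \<Rightarrow> 'm \<Rightarrow> 'm) \<Rightarrow> ('m \<Rightarrow> 'a \<Rightarrow> 'm) \<Rightarrow> bool" where
  "semisimple_bimodule M l r \<longleftrightarrow> generate M (\<Union> {U. simple_sub_bimodule M l r U}) = carrier M"

text \<open>
  The quotient \<open>J/K\<close> of ideals \<open>K \<subseteq> J\<close>; its elements are the cosets \<open>x +o K\<close>, and
  addition of cosets is elementwise addition of sets.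
\<close>

definition quotient_group :: "'a::ab_group_add set \<Rightarrow> 'a set \<Rightarrow> 'a set monoid" where
  "quotient_group J K = \<lparr>carrier = (\<lambda>x. x +o K) ` J, monoid.mult = (+), one = K\<rparr>"

definition ideal_filtration :: "(nat \<Rightarrow> 'a::{ring,monoid_mult} set) \<Rightarrow> nat \<Rightarrow> bool" where
  "ideal_filtration I N \<longleftrightarrow>
     (\<forall>j. two_sided_ideal (I j)) \<and> I 0 = UNIV \<and> (\<forall>j<N. I (Suc j) \<subset> I j) \<and>
     (\<forall>m\<ge>N. I m = {0}) \<and> (\<forall>i j. \<forall>x\<in>I i. \<forall>y\<in>I j. x * y \<in> I (i + j))"

definition semisimple_layers :: "(nat \<Rightarrow> 'a::{ring,monoid_mult} set) \<Rightarrow> nat \<Rightarrow> bool" where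
  "semisimple_layers I N \<longleftrightarrow>
     (\<forall>i<N. semisimple_bimodule (quotient_group (I i) (I (Suc i)))
        (\<lambda>a X. {a} * X + I (Suc i)) (\<lambda>X a. X * {a} + I (Suc i)))"

definition decomposes :: "(nat \<Rightarrow> 'a::comm_monoid_add set) \<Rightarrow> 'a \<Rightarrow> (nat \<Rightarrow> 'a) \<Rightarrow> bool" where
  "decomposes G x f \<longleftrightarrow>
     (\<forall>i. f i \<in> G i) \<and> finite {i. f i \<noteq> 0} \<and> x = (\<Sum>i | f i \<noteq> 0. f i)"

definition positive_grading ::
  "('k::field \<Rightarrow> 'a::{ring,monoid_mult} \<Rightarrow> 'a) \<Rightarrow> (nat \<Rightarrow> 'a set) \<Rightarrow> bool" where
  "positive_grading scale G \<longleftrightarrow>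
     (\<forall>i. module.subspace scale (G i)) \<and> (\<forall>x. \<exists>!f. decomposes G x f) \<and>
     (\<forall>i j. \<forall>x\<in>G i. \<forall>y\<in>G j. x * y \<in> G (i + j))"

definition degree_ge :: "(nat \<Rightarrow> 'a::comm_monoid_add set) \<Rightarrow> nat \<Rightarrow> 'a set" where
  "degree_ge G j = {x. \<exists>f. decomposes G x f \<and> (\<forall>i<j. f i = 0)}"


section \<open>The matrix algebra \<open>\<CC>\<close>\<close>

text \<open>
  The entry in row \<open>r\<close>, column \<open>c\<close> is an element of the quotient
  \<open>entry_num I r c / entry_den I N r c\<close>, represented as a coset. For \<open>r > c\<close> the denominator is
  \<open>0\<close>, so that an element \<open>x\<close> of \<open>I\<^sub>r\<^sub>-\<^sub>c\<close> appears as \<open>{x}\<close>; for \<open>c - r \<ge> N\<close> the quotient is zero.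
\<close>

type_synonym 'a cmat = "int \<Rightarrow> int \<Rightarrow> 'a set"

definition entry_num :: "(nat \<Rightarrow> 'a set) \<Rightarrow> int \<Rightarrow> int \<Rightarrow> 'a set" where
  "entry_num I r c = (if r > c then I (nat (r - c)) else UNIV)"

definition entry_den :: "(nat \<Rightarrow> 'a::zero set) \<Rightarrow> nat \<Rightarrow> 'a cmat" where
  "entry_den I N r c =
     (if r > c then {0}
      else if c - r < int N then I (nat (int N - (c - r)))
      else UNIV)"

definition entry :: "(nat \<Rightarrow> 'a::ab_group_add set) \<Rightarrow> nat \<Rightarrow> int \<Rightarrow> int \<Rightarrow> 'a set set" where
  "entry I N r c = (\<lambda>x. x +o entry_den I N r c) ` entry_num I r c"

definition CC :: "(nat \<Rightarrow> 'a::ab_group_add set) \<Rightarrow> nat \<Rightarrow> 'a cmat monoid" where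
  "CC I N = \<lparr>carrier = {M. (\<forall>r c. M r c \<in> entry I N r c) \<and>
                            finite {(r, c). M r c \<noteq> entry_den I N r c}},
              monoid.mult = (\<lambda>M P r c. M r c + P r c),
              one = entry_den I N\<rparr>"

text \<open>
  The additive group of \<open>\<CC>\<close> is \<open>CC I N\<close>; its ring multiplication is \<open>CC_mult I N\<close>. Products and
  sums of sets are elementwise; adding the denominator turns the result into a coset.
\<close>

definition CC_mult :: "(nat \<Rightarrow> 'a::{ring,monoid_mult} set) \<Rightarrow> nat \<Rightarrow> 'a cmat \<Rightarrow> 'a cmat \<Rightarrow> 'a cmat" where
  "CC_mult I N M P r c =
     (\<Sum>s | M r s \<noteq> entry_den I N r s \<and> P s c \<noteq> entry_den I N s c. M r s * P s c)
     + entry_den I N r c"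

text \<open>The maximal semisimple subalgebra is the degree-zero component \<open>G 0\<close> of the grading \<open>G\<close>.\<close>

definition S_alg :: "(nat \<Rightarrow> 'a::ab_group_add set) \<Rightarrow> nat \<Rightarrow> (nat \<Rightarrow> 'a set) \<Rightarrow> 'a cmat set" where
  "S_alg I N G = {M \<in> carrier (CC I N). \<forall>r c. M r c \<in>
     (if r = c then (\<lambda>x. x +o entry_den I N r c) ` G 0 else {entry_den I N r c})}"

definition B_tilde :: "(nat \<Rightarrow> 'a::ab_group_add set) \<Rightarrow> nat \<Rightarrow> (nat \<Rightarrow> 'a set) \<Rightarrow> 'a cmat set" where
  "B_tilde I N G = {M \<in> carrier (CC I N). \<forall>r c. M r c \<in>
     (if 0 \<le> c - r \<and> c - r \<le> int N - 1 then (\<lambda>x. x +o entry_den I N r c) ` G 0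
      else {entry_den I N r c})}"

definition B_alg :: "(nat \<Rightarrow> 'a::ab_group_add set) \<Rightarrow> nat \<Rightarrow> (nat \<Rightarrow> 'a set) \<Rightarrow> 'a cmat set" where
  "B_alg I N G = {M \<in> carrier (CC I N). \<forall>r c. M r c \<in>
     (if r \<ge> c then (\<lambda>x. x +o entry_den I N r c) ` G (nat (r - c))
      else {entry_den I N r c})}"


section \<open>The trivial extension \<open>\<DD> = \<CC> \<oplus> \<CC>\<^sup>*\<close>\<close>

text \<open>
  Linear functionals on the entry space in row \<open>r\<close>, column \<open>c\<close>, extended by \<open>0\<close> to sets that are
  not elements of that space.
\<close>

definition entry_dual ::
  "('k::field \<Rightarrow> 'a::ab_group_add \<Rightarrow> 'a) \<Rightarrow> (nat \<Rightarrow> 'a set) \<Rightarrow> nat \<Rightarrow> int \<Rightarrow> int \<Rightarrow> ('a set \<Rightarrow> 'k) set" where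
  "entry_dual scale I N r c = {g.
     (\<forall>X. X \<notin> entry I N r c \<longrightarrow> g X = 0) \<and>
     (\<forall>X\<in>entry I N r c. \<forall>Y\<in>entry I N r c. g (X + Y) = g X + g Y) \<and>
     (\<forall>X\<in>entry I N r c. \<forall>a. g (scale a ` X + entry_den I N r c) = a * g X)}"

type_synonym ('a, 'k) dual_mat = "int \<Rightarrow> int \<Rightarrow> 'a set \<Rightarrow> 'k"

definition CC_dual ::
  "('k::field \<Rightarrow> 'a::ab_group_add \<Rightarrow> 'a) \<Rightarrow> (nat \<Rightarrow> 'a set) \<Rightarrow> nat \<Rightarrow> ('a, 'k) dual_mat monoid" where
  "CC_dual scale I N =
     \<lparr>carrier = {f. (\<forall>r c. f r c \<in> entry_dual scale I N c r) \<and>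
                     finite {(r, c). f r c \<noteq> (\<lambda>_. 0)}},
      monoid.mult = (\<lambda>f g r c X. f r c X + g r c X),
      one = (\<lambda>r c X. 0)\<rparr>"

text \<open>
  The bimodule structure dual to the regular one, \<open>(af)(x) = f(xa)\<close> and \<open>(fb)(x) = f(bx)\<close>.
  For \<open>x\<close> in row \<open>c\<close>, column \<open>r\<close>, the matrix \<open>xa\<close> has the entries \<open>x a\<^sub>r\<^sub>s\<close> in row \<open>c\<close>, column \<open>s\<close>,
  on which \<open>f\<close> is given by \<open>f\<^sub>s\<^sub>c\<close>; the matrix \<open>bx\<close> has the entries \<open>b\<^sub>s\<^sub>c x\<close> in row \<open>s\<close>,
  column \<open>r\<close>, on which \<open>f\<close> is given by \<open>f\<^sub>r\<^sub>s\<close>.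
\<close>

definition dual_lact ::
  "(nat \<Rightarrow> 'a::{ring,monoid_mult} set) \<Rightarrow> nat \<Rightarrow> 'a cmat \<Rightarrow> ('a, 'k::field) dual_mat \<Rightarrow> ('a, 'k) dual_mat" where
  "dual_lact I N a f r c X =
     (if X \<in> entry I N c r
      then \<Sum>s | a r s \<noteq> entry_den I N r s \<and> f s c \<noteq> (\<lambda>_. 0). f s c (X * a r s + entry_den I N c s)
      else 0)"

definition dual_ract ::
  "(nat \<Rightarrow> 'a::{ring,monoid_mult} set) \<Rightarrow> nat \<Rightarrow> ('a, 'k::field) dual_mat \<Rightarrow> 'a cmat \<Rightarrow> ('a, 'k) dual_mat" where
  "dual_ract I N f b r c X =
     (if X \<in> entry I N c r
      then \<Sum>s | f r s \<noteq> (\<lambda>_. 0) \<and> b s c \<noteq> entry_den I N s c. f r s (b s c * X + entry_den I N s r)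
      else 0)"

definition DD ::
  "('k::field \<Rightarrow> 'a::ab_group_add \<Rightarrow> 'a) \<Rightarrow> (nat \<Rightarrow> 'a set) \<Rightarrow> nat \<Rightarrow> ('a cmat \<times> ('a, 'k) dual_mat) monoid" where
  "DD scale I N = CC I N \<times>\<times> CC_dual scale I N"

definition DD_mult ::
  "(nat \<Rightarrow> 'a::{ring,monoid_mult} set) \<Rightarrow> nat \<Rightarrow>
   'a cmat \<times> ('a, 'k::field) dual_mat \<Rightarrow> 'a cmat \<times> ('a, 'k) dual_mat \<Rightarrow> 'a cmat \<times> ('a, 'k) dual_mat" where
  "DD_mult I N = (\<lambda>(a, f) (b, g).
     (CC_mult I N a b, \<lambda>r c X. dual_lact I N a g r c X + dual_ract I N f b r c X))"

definition in_DD :: "'a cmat \<Rightarrow> 'a cmat \<times> ('a, 'k::zero) dual_mat" where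
  "in_DD M = (M, \<lambda>r c X. 0)"

text \<open>
  In row \<open>r\<close>, column \<open>c\<close> with \<open>m = r - c \<ge> 0\<close>: a homogeneous element of degree \<open>m\<close> together with
  a functional vanishing on all homogeneous elements of degree other than \<open>N - 1 - m\<close> (in
  particular the zero functional if this number is negative).
\<close>

definition B_bar ::
  "('k::field \<Rightarrow> 'a::ab_group_add \<Rightarrow> 'a) \<Rightarrow> (nat \<Rightarrow> 'a set) \<Rightarrow> nat \<Rightarrow> (nat \<Rightarrow> 'a set) \<Rightarrow>
   ('a cmat \<times> ('a, 'k) dual_mat) set" where
  "B_bar scale I N G = {(M, f) \<in> carrier (DD scale I N). \<forall>r c.
     (if r \<ge> c
      then M r c \<in> (\<lambda>x. x +o entry_den I N r c) ` G (nat (r - c)) \<and>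
           (\<forall>i. int i \<noteq> int N - 1 - (r - c) \<longrightarrow> (\<forall>x\<in>G i. f r c (x +o entry_den I N c r) = 0))
      else M r c = entry_den I N r c \<and> f r c = (\<lambda>_. 0))}"


section \<open>Tensor products\<close>

text \<open>
  The tensor product over a ring with elements \<open>S\<close>, of a right module with elements \<open>X\<close>, addition
  \<open>addX\<close> and action \<open>ract\<close>, and a left module with elements \<open>Y\<close>, addition \<open>addY\<close> and action
  \<open>lact\<close>: the free abelian group on \<open>X \<times> Y\<close> modulo the usual relations.
\<close>

definition tensor_rels ::
  "'x set \<Rightarrow> ('x \<Rightarrow> 'x \<Rightarrow> 'x) \<Rightarrow> ('x \<Rightarrow> 's \<Rightarrow> 'x) \<Rightarrow> 's set \<Rightarrow>
   'y set \<Rightarrow> ('y \<Rightarrow> 'y \<Rightarrow> 'y) \<Rightarrow> ('s \<Rightarrow> 'y \<Rightarrow> 'y) \<Rightarrow> ('x \<times> 'y \<Rightarrow>\<^sub>0 int) set" where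
  "tensor_rels X addX ract S Y addY lact =
     {frag_of (addX x x', y) - frag_of (x, y) - frag_of (x', y) | x x' y. x \<in> X \<and> x' \<in> X \<and> y \<in> Y} \<union>
     {frag_of (x, addY y y') - frag_of (x, y) - frag_of (x, y') | x y y'. x \<in> X \<and> y \<in> Y \<and> y' \<in> Y} \<union>
     {frag_of (ract x s, y) - frag_of (x, lact s y) | x s y. x \<in> X \<and> s \<in> S \<and> y \<in> Y}"

definition tensor_kernel where
  "tensor_kernel X addX ract S Y addY lact =
     generate (free_Abelian_group (X \<times> Y)) (tensor_rels X addX ract S Y addY lact)"

definition tensor_product where
  "tensor_product X addX ract S Y addY lact =
     free_Abelian_group (X \<times> Y) Mod tensor_kernel X addX ract S Y addY lact"

text \<open>
  \<open>X\<close>, \<open>S\<close> and \<open>Y\<close> are subalgebras, with \<open>S\<close> contained in the other two, of a (not necessarily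
  unital) ring with additive group \<open>R\<close> and multiplication \<open>mul\<close>. The multiplication of the ring
  induces an isomorphism from \<open>X \<otimes>\<^sub>S Y\<close> to the ring, as left \<open>X\<close>- and right \<open>Y\<close>-modules.
  The actions of \<open>X\<close> and \<open>Y\<close> on a coset in the tensor product are obtained by letting them act on
  the first, respectively second, components of its representatives.
\<close>

definition mult_induces_iso :: "'m monoid \<Rightarrow> ('m \<Rightarrow> 'm \<Rightarrow> 'm) \<Rightarrow> 'm set \<Rightarrow> 'm set \<Rightarrow> 'm set \<Rightarrow> bool" where
  "mult_induces_iso R mul X S Y \<longleftrightarrow>
     (let F = free_Abelian_group (X \<times> Y);
          K = tensor_kernel X (monoid.mult R) mul S Y (monoid.mult R) mul;
          T = tensor_product X (monoid.mult R) mul S Y (monoid.mult R) mul;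
          lact = (\<lambda>b t. \<Union>z\<in>t. K #>\<^bsub>F\<^esub> frag_extend (\<lambda>(x, y). frag_of (mul b x, y)) z);
          ract = (\<lambda>t b. \<Union>z\<in>t. K #>\<^bsub>F\<^esub> frag_extend (\<lambda>(x, y). frag_of (x, mul y b)) z)
      in \<exists>\<phi>\<in>iso T R.
           (\<forall>x\<in>X. \<forall>y\<in>Y. \<phi> (K #>\<^bsub>F\<^esub> frag_of (x, y)) = mul x y) \<and>
           (\<forall>b\<in>X. \<forall>t\<in>carrier T. \<phi> (lact b t) = mul b (\<phi> t)) \<and>
           (\<forall>b\<in>Y. \<forall>t\<in>carrier T. \<phi> (ract t b) = mul (\<phi> t) b))"


section \<open>Quivers with relations\<close>

text \<open>
  A quiver is a finite directed multigraph. A path is a triple of its source, its arrows in the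
  order in which they are traversed, and its target.
\<close>

type_synonym ('v, 'e) path = "'v \<times> 'e list \<times> 'v"

definition paths :: "('v, 'e) pre_digraph \<Rightarrow> ('v, 'e) path set" where
  "paths Q = {(u, p, v). pre_digraph.awalk Q u p v}"

definition path_alg :: "('v, 'e) pre_digraph \<Rightarrow> (('v, 'e) path \<Rightarrow>\<^sub>0 'k::zero) set" where
  "path_alg Q = {f. Poly_Mapping.keys f \<subseteq> paths Q}"

definition path_alg_one :: "('v, 'e) pre_digraph \<Rightarrow> (('v, 'e) path \<Rightarrow>\<^sub>0 'k::field)" where
  "path_alg_one Q = (\<Sum>v\<in>verts Q. Poly_Mapping.single (v, [], v) 1)"

text \<open>In a product of paths the right factor is traversed first, so an arrow from \<open>k\<close> to \<open>l\<close> lies in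
  \<open>e\<^sub>l A e\<^sub>k\<close>.\<close>

definition path_alg_mult ::
  "(('v, 'e) path \<Rightarrow>\<^sub>0 'k::field) \<Rightarrow> (('v, 'e) path \<Rightarrow>\<^sub>0 'k) \<Rightarrow> (('v, 'e) path \<Rightarrow>\<^sub>0 'k)" where
  "path_alg_mult f g =
     (\<Sum>(v', p, w)\<in>Poly_Mapping.keys f. \<Sum>(u, q, v)\<in>Poly_Mapping.keys g.
        if v = v'
        then Poly_Mapping.single (u, q @ p, w)
               (Poly_Mapping.lookup f (v', p, w) * Poly_Mapping.lookup g (u, q, v))
        else 0)"

text \<open>A relation is a linear combination of parallel paths of length at least two.\<close>

definition relations :: "('v, 'e) pre_digraph \<Rightarrow> (('v, 'e) path \<Rightarrow>\<^sub>0 'k::zero) set" where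
  "relations Q = {f \<in> path_alg Q.
     \<exists>u v. \<forall>(u', p, v')\<in>Poly_Mapping.keys f. u' = u \<and> v' = v \<and> length p \<ge> 2}"

definition path_ideal ::
  "('v, 'e) pre_digraph \<Rightarrow> (('v, 'e) path \<Rightarrow>\<^sub>0 'k::field) set \<Rightarrow> bool" where
  "path_ideal Q J \<longleftrightarrow> J \<subseteq> path_alg Q \<and> 0 \<in> J \<and> (\<forall>f\<in>J. \<forall>g\<in>J. f + g \<in> J) \<and>
     (\<forall>f\<in>J. \<forall>g\<in>path_alg Q. path_alg_mult g f \<in> J \<and> path_alg_mult f g \<in> J)"

definition path_ideal_generated ::
  "('v, 'e) pre_digraph \<Rightarrow> (('v, 'e) path \<Rightarrow>\<^sub>0 'k::field) set \<Rightarrow> (('v, 'e) path \<Rightarrow>\<^sub>0 'k) set" where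
  "path_ideal_generated Q R = \<Inter> {J. path_ideal Q J \<and> R \<subseteq> J}"

text \<open>
  The algebra \<open>'a\<close> is given by the quiver \<open>Q\<close> with relations \<open>R\<close>, that is, it is isomorphic to the
  path algebra modulo the ideal generated by \<open>R\<close>: there is a surjective algebra homomorphism from
  the path algebra with this ideal as its kernel.
\<close>

definition given_by_quiver ::
  "('k::field \<Rightarrow> 'a::{ring,monoid_mult} \<Rightarrow> 'a) \<Rightarrow> ('v, 'e) pre_digraph \<Rightarrow>
   (('v, 'e) path \<Rightarrow>\<^sub>0 'k) set \<Rightarrow> bool" where
  "given_by_quiver scale Q R \<longleftrightarrow> k_algebra scale \<and>
     (\<exists>\<pi>. \<pi> ` path_alg Q = UNIV \<and> \<pi> (path_alg_one Q) = 1 \<and>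
        (\<forall>f\<in>path_alg Q. \<forall>g\<in>path_alg Q. \<pi> (f + g) = \<pi> f + \<pi> g) \<and>
        (\<forall>a. \<forall>f\<in>path_alg Q. \<pi> (Poly_Mapping.map ((*) a) f) = scale a (\<pi> f)) \<and>
        (\<forall>f\<in>path_alg Q. \<forall>g\<in>path_alg Q. \<pi> (path_alg_mult f g) = \<pi> f * \<pi> g) \<and>
        {f \<in> path_alg Q. \<pi> f = 0} = path_ideal_generated Q R)"

text \<open>Attaching to each vertex \<open>k\<close> a new vertex \<open>Inr k\<close> and a new arrow \<open>Inr k\<close> from \<open>k\<close> to it.\<close>

definition attach_quiver :: "('v, 'e) pre_digraph \<Rightarrow> ('v + 'v, 'e + 'v) pre_digraph" where
  "attach_quiver Q =
     \<lparr>verts = Inl ` verts Q \<union> Inr ` verts Q,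
      arcs = Inl ` arcs Q \<union> Inr ` verts Q,
      tail = (\<lambda>a. case a of Inl e \<Rightarrow> Inl (tail Q e) | Inr k \<Rightarrow> Inl k),
      head = (\<lambda>a. case a of Inl e \<Rightarrow> Inl (head Q e) | Inr k \<Rightarrow> Inr k)\<rparr>"

definition attach_element ::
  "(('v, 'e) path \<Rightarrow>\<^sub>0 'k::field) \<Rightarrow> (('v + 'v, 'e + 'v) path \<Rightarrow>\<^sub>0 'k)" where
  "attach_element f =
     (\<Sum>(u, p, v)\<in>Poly_Mapping.keys f.
        Poly_Mapping.single (Inl u, map Inl p, Inl v) (Poly_Mapping.lookup f (u, p, v)))"

end

theory Submission imports Defs
begin

text \<open>
  Write \<open>E\<close> for the graded algebra. Modulo the denominators, the entry of \<open>\<CC>\<close> in row \<open>r\<close>,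
  column \<open>c\<close> is the sum of the components of \<open>E\<close> whose degree \<open>i\<close> satisfies
  \<open>0 \<le> i\<close>, \<open>r - c \<le> i < N + (r - c)\<close> and \<open>i < N\<close>. Put \<open>s = c + i\<close>: these conditions say that
  \<open>c \<le> s\<close> and \<open>r \<le> s < r + N\<close> (and the components of degree at least \<open>N\<close> vanish). So the
  component of degree \<open>i\<close> is reached by exactly one product, namely \<open>E\<^sub>0\<close> in position \<open>(r, s)\<close>, which
  belongs to the left factor, times \<open>E\<^sub>i\<close> in position \<open>(s, c)\<close>, which belongs to the right factor,
  and every product of positions is accounted for in this way. The index set of pairs \<open>(r, s)\<close> with
  \<open>r \<le> s < r + N\<close> is called \<open>strip\<close> below.

  The left factor is the direct sum, as a right module over the semisimple subalgebra, of the
  submodules generated by the matrix units at the positions in the strip, and the matrix unit at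
  \<open>(r, s)\<close> only sees row \<open>s\<close> of the right factor. Hence the tensor product is the direct sum of the
  rows \<open>s\<close> of the right factor, one copy for each \<open>(r, s)\<close> in the strip, and multiplication sends the
  copy with index \<open>(r, s)\<close> isomorphically to those elements of row \<open>r\<close> of \<open>\<CC>\<close> whose entry in each
  column \<open>c\<close> has degree \<open>s - c\<close>. The locale \<open>tensor_factorization\<close> turns this
  argument into a criterion; \<open>rows_independent\<close> and \<open>rows_span\<close> verify it for \<open>\<CC>\<close>.

  For \<open>\<CC>\<^sup>*\<close> the count is the same. The functionals in row \<open>r\<close>, column \<open>c\<close> live on the entry of \<open>\<CC>\<close>
  in row \<open>c\<close>, column \<open>r\<close>, and a functional on its component of degree \<open>i\<close> is
  the product of the matrix unit at \<open>(r, s)\<close>, where \<open>i = N - 1 - (s - c)\<close>, and of a functional of the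
  same degree on the entry in row \<open>c\<close>, column \<open>s\<close>. The matrix unit acts on functionals by
  restriction along the map from entry \<open>(c, r)\<close> to entry \<open>(c, s)\<close> that is the identity on
  representatives. This is \<open>dual_rows_independent\<close> and \<open>dual_rows_span\<close>. Both parts of the theorem
  are instances for the filtration by degree, the second one with the powers of the radical.
\<close>

section \<open>A criterion for factorizing a ring as a tensor product\<close>

lemma (in comm_group) hom_finprod:
  assumes h: "h \<in> hom G H" and H: "comm_group H" and "finite A" "f \<in> A \<rightarrow> carrier G"
  shows "h (finprod G f A) = finprod H (\<lambda>x. h (f x)) A"
proof -
  interpret H: comm_group H by (rule H)
  interpret h: group_hom G H h
    using h by (simp add: group_hom_def group_hom_axioms_def is_group H.is_group)
  show ?thesis
    using assms(3,4)
    by (induction A rule: finite_induct) (auto simp: Pi_iff)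
qed

text \<open>
  An abelian group \<open>R\<close> with a biadditive multiplication, and subgroups \<open>X\<close> and \<open>Y\<close> that are closed
  under it and share the scalars \<open>S\<close>. The elements \<open>u j\<close> generate \<open>X\<close> as a right \<open>S\<close>-module; each of
  them may be annihilated by part of \<open>S\<close>, as a matrix unit is. What remains of the second factor next to \<open>u j\<close> is the subgroup \<open>Z j\<close> of
  \<open>Y\<close>. The tensor product is then the sum of the \<open>u j \<otimes> Z j\<close>, and the last two assumptions say that
  \<open>R\<close> is the direct sum of the products \<open>u j * Z j\<close> and that \<open>u j\<close> acts injectively on \<open>Z j\<close>.
\<close>

locale tensor_factorization = comm_group R for R :: "'m monoid" (structure) +
  fixes mul :: "'m \<Rightarrow> 'm \<Rightarrow> 'm" and X S Y :: "'m set"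
    and J :: "'j set" and u :: "'j \<Rightarrow> 'm" and Z :: "'j \<Rightarrow> 'm set"
  assumes mul_closed: "\<lbrakk>a \<in> carrier R; b \<in> carrier R\<rbrakk> \<Longrightarrow> mul a b \<in> carrier R"
    and mul_add_right: "\<lbrakk>a \<in> carrier R; b \<in> carrier R; c \<in> carrier R\<rbrakk> \<Longrightarrow> mul a (b \<otimes> c) = mul a b \<otimes> mul a c"
    and mul_add_left: "\<lbrakk>a \<in> carrier R; b \<in> carrier R; c \<in> carrier R\<rbrakk> \<Longrightarrow> mul (a \<otimes> b) c = mul a c \<otimes> mul b c"
    and mul_assoc: "\<lbrakk>x \<in> X; b \<in> carrier R; c \<in> carrier R\<rbrakk> \<Longrightarrow> mul (mul x b) c = mul x (mul b c)"
    and X: "subgroup X R" "\<lbrakk>x \<in> X; x' \<in> X\<rbrakk> \<Longrightarrow> mul x x' \<in> X"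
    and Y: "subgroup Y R" "\<lbrakk>y \<in> Y; y' \<in> Y\<rbrakk> \<Longrightarrow> mul y y' \<in> Y"
    and S: "S \<subseteq> X" "S \<subseteq> Y"
    and u: "j \<in> J \<Longrightarrow> u j \<in> X"
    and Z: "j \<in> J \<Longrightarrow> subgroup (Z j) R" "j \<in> J \<Longrightarrow> Z j \<subseteq> Y"
    and X_span: "x \<in> X \<Longrightarrow> \<exists>P \<sigma>. finite P \<and> P \<subseteq> J \<and> (\<forall>j\<in>P. \<sigma> j \<in> S \<and> (\<forall>y\<in>Y. mul (\<sigma> j) y \<in> Z j)) \<and>
                   x = finprod R (\<lambda>j. mul (u j) (\<sigma> j)) P"
    and R_span: "z \<in> carrier R \<Longrightarrow> \<exists>P y. finite P \<and> P \<subseteq> J \<and> (\<forall>j\<in>P. y j \<in> Z j) \<and>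
                   z = finprod R (\<lambda>j. mul (u j) (y j)) P"
    and independent: "\<And>y j. \<lbrakk>finite P; P \<subseteq> J; \<forall>j\<in>P. y j \<in> Z j; finprod R (\<lambda>j. mul (u j) (y j)) P = \<one>; j \<in> P\<rbrakk> \<Longrightarrow> y j = \<one>"
begin

abbreviation "F \<equiv> free_Abelian_group (X \<times> Y)"
abbreviation "rels \<equiv> tensor_rels X (\<otimes>) mul S Y (\<otimes>) mul"
abbreviation "K \<equiv> tensor_kernel X (\<otimes>) mul S Y (\<otimes>) mul"

lemmas free_induct = free_Abelian_group_induct[where S = "X \<times> Y", consumes 1, case_names zero diff frag_of]

lemma X_carrier: "x \<in> X \<Longrightarrow> x \<in> carrier R" and Y_carrier: "y \<in> Y \<Longrightarrow> y \<in> carrier R"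
  using X(1) Y(1) by (auto dest: subgroup.mem_carrier)

lemma Z_Y: "\<lbrakk>j \<in> J; y \<in> Z j\<rbrakk> \<Longrightarrow> y \<in> Y"
  using Z(2) by blast

lemma tensor_rels_cases:
  assumes "r \<in> rels"
  obtains (left) x x' y where "x \<in> X" "x' \<in> X" "y \<in> Y" "r = frag_of (x \<otimes> x', y) - frag_of (x, y) - frag_of (x', y)"
  | (right) x y y' where "x \<in> X" "y \<in> Y" "y' \<in> Y" "r = frag_of (x, y \<otimes> y') - frag_of (x, y) - frag_of (x, y')"
  | (middle) x s y where "x \<in> X" "s \<in> S" "y \<in> Y" "r = frag_of (mul x s, y) - frag_of (x, mul s y)"
  using assms unfolding tensor_rels_def by fast

lemma rels_carrier: "rels \<subseteq> carrier F"
proof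
  fix r assume "r \<in> rels"
  then have "Poly_Mapping.keys r \<subseteq> X \<times> Y"
  proof (cases rule: tensor_rels_cases)
    case left
    then show ?thesis
      using subgroup.m_closed[OF X(1)]
      by (auto dest!: subsetD[OF keys_diff])
  next
    case right
    then show ?thesis
      using subgroup.m_closed[OF Y(1)]
      by (auto dest!: subsetD[OF keys_diff])
  next
    case middle
    then show ?thesis
      using X(2) Y(2) S by (auto dest!: subsetD[OF keys_diff])
  qed
  then show "r \<in> carrier F" by simp
qed

lemma K_subgroup: "subgroup K F"
  unfolding tensor_kernel_def by (rule group.generate_is_subgroup[OF _ rels_carrier]) simp

lemma K_keys: "z \<in> K \<Longrightarrow> Poly_Mapping.keys z \<subseteq> X \<times> Y"
  using subgroup.mem_carrier[OF K_subgroup] by simp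

lemma K_zero: "0 \<in> K"
  using subgroup.one_closed[OF K_subgroup] by simp

lemma K_add: "\<lbrakk>a \<in> K; b \<in> K\<rbrakk> \<Longrightarrow> a + b \<in> K"
  using subgroup.m_closed[OF K_subgroup] by simp

lemma K_uminus: "a \<in> K \<Longrightarrow> - a \<in> K"
  using subgroup.m_inv_closed[OF K_subgroup] K_keys by fastforce

lemma K_diff: "\<lbrakk>a \<in> K; b \<in> K\<rbrakk> \<Longrightarrow> a - b \<in> K"
  using K_add[of a "- b"] K_uminus by simp

lemma K_sum: "(\<And>i. i \<in> A \<Longrightarrow> f i \<in> K) \<Longrightarrow> sum f A \<in> K"
  by (induction A rule: infinite_finite_induct) (auto simp: K_zero K_add)

lemma rels_K: "r \<in> rels \<Longrightarrow> r \<in> K"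
  unfolding tensor_kernel_def by (rule generate.incl)

lemma K_left: "\<lbrakk>x \<in> X; x' \<in> X; y \<in> Y\<rbrakk> \<Longrightarrow> frag_of (x \<otimes> x', y) - frag_of (x, y) - frag_of (x', y) \<in> K"
  and K_right: "\<lbrakk>x \<in> X; y \<in> Y; y' \<in> Y\<rbrakk> \<Longrightarrow> frag_of (x, y \<otimes> y') - frag_of (x, y) - frag_of (x, y') \<in> K"
  and K_middle: "\<lbrakk>x \<in> X; s \<in> S; y \<in> Y\<rbrakk> \<Longrightarrow> frag_of (mul x s, y) - frag_of (x, mul s y) \<in> K"
  by (rule rels_K; unfold tensor_rels_def; blast)+

lemma K_one_left: "y \<in> Y \<Longrightarrow> frag_of (\<one>, y) \<in> K"
  using K_left[of \<one> \<one> y] subgroup.one_closed[OF X(1)] K_uminus by fastforce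

lemma K_one_right: "x \<in> X \<Longrightarrow> frag_of (x, \<one>) \<in> K"
  using K_right[of x \<one> \<one>] subgroup.one_closed[OF Y(1)] K_uminus by fastforce

lemma subgroup_finprod:
  assumes "subgroup H R" "finite A" "\<And>i. i \<in> A \<Longrightarrow> f i \<in> H"
  shows "finprod R f A \<in> H"
proof -
  interpret H: subgroup H R by fact
  show ?thesis
    using assms(2,3)
    by (induction A rule: finite_induct) (auto simp: Pi_iff)
qed

lemma K_finprod_left:
  assumes "finite P" "\<And>j. j \<in> P \<Longrightarrow> x j \<in> X" "y \<in> Y"
  shows "frag_of (finprod R x P, y) - (\<Sum>j\<in>P. frag_of (x j, y)) \<in> K"
  using assms(1,2)
proof (induction P rule: finite_induct)
  case empty
  then show ?case using K_one_left assms(3) by simp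
next
  case (insert j P)
  have "finprod R x P \<in> X"
    using insert by (intro subgroup_finprod X(1)) auto
  then have "frag_of (x j \<otimes> finprod R x P, y) - frag_of (x j, y) - frag_of (finprod R x P, y) \<in> K"
    using insert assms(3) by (intro K_left) auto
  from K_add[OF this insert.IH] insert show ?case
    by (simp add: Pi_iff X_carrier algebra_simps)
qed

text \<open>
  Congruence modulo \<open>K\<close> to a normal form \<open>\<Sum> u j \<otimes> y j\<close> with \<open>y j\<close> in \<open>Z j\<close>. Every element of the free
  group has one, and the independence assumption shows that the normal form of an element that is
  mapped to zero has \<open>y = 0\<close>; this is how the kernel of the multiplication map is found to be \<open>K\<close>.
\<close>

definition reducible :: "('m \<times> 'm \<Rightarrow>\<^sub>0 int) \<Rightarrow> bool" where
  "reducible z \<longleftrightarrow> (\<exists>P y. finite P \<and> P \<subseteq> J \<and> (\<forall>j\<in>P. y j \<in> Z j) \<and> z - (\<Sum>j\<in>P. frag_of (u j, y j)) \<in> K)"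

text \<open>
  Expand \<open>x = \<Sum> u j * \<sigma> j\<close> and move each \<open>\<sigma> j\<close> through the tensor sign.
\<close>

lemma reducible_frag_of:
  assumes "x \<in> X" "y \<in> Y"
  shows "reducible (frag_of (x, y))"
proof -
  obtain P \<sigma> where P: "finite P" "P \<subseteq> J"
    and \<sigma>: "\<And>j. j \<in> P \<Longrightarrow> \<sigma> j \<in> S" "\<And>j y. j \<in> P \<Longrightarrow> y \<in> Y \<Longrightarrow> mul (\<sigma> j) y \<in> Z j"
    and x: "x = finprod R (\<lambda>j. mul (u j) (\<sigma> j)) P"
    using X_span[OF assms(1)] by blast
  have "mul (u j) (\<sigma> j) \<in> X" if "j \<in> P" for j
    using that P \<sigma>(1)[OF that] u S by (intro X(2)) auto
  then have "frag_of (x, y) - (\<Sum>j\<in>P. frag_of (mul (u j) (\<sigma> j), y)) \<in> K"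
    unfolding x using P assms(2) by (intro K_finprod_left) auto
  moreover have "(\<Sum>j\<in>P. frag_of (mul (u j) (\<sigma> j), y) - frag_of (u j, mul (\<sigma> j) y)) \<in> K"
    using P \<sigma>(1) u assms(2) by (intro K_sum K_middle) auto
  ultimately have "frag_of (x, y) - (\<Sum>j\<in>P. frag_of (u j, mul (\<sigma> j) y)) \<in> K"
    using K_add by (fastforce simp: sum_subtractf)
  then show ?thesis
    unfolding reducible_def using P \<sigma>(2) assms(2)
    by (intro exI[of _ P] exI[of _ "\<lambda>j. mul (\<sigma> j) y"]) auto
qed

text \<open>
  Two normal forms can be subtracted once they have the same index set. Adding indices is harmless
  because \<open>u j \<otimes> 0\<close> lies in \<open>K\<close>.
\<close>

lemma reducible_extend:
  assumes "finite P" "P \<subseteq> P'" "P' \<subseteq> J" "finite P'" "\<forall>j\<in>P. y j \<in> Z j" "z - (\<Sum>j\<in>P. frag_of (u j, y j)) \<in> K"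
  obtains y' where "\<forall>j\<in>P'. y' j \<in> Z j" "z - (\<Sum>j\<in>P'. frag_of (u j, y' j)) \<in> K"
proof
  let ?y = "\<lambda>j. if j \<in> P then y j else \<one>"
  show "\<forall>j\<in>P'. ?y j \<in> Z j"
    using assms Z(1) subgroup.one_closed by fastforce
  have "(\<Sum>j\<in>P' - P. frag_of (u j, \<one>)) \<in> K"
    using assms u by (intro K_sum K_one_right) auto
  moreover have "(\<Sum>j\<in>P'. frag_of (u j, ?y j)) = (\<Sum>j\<in>P. frag_of (u j, y j)) + (\<Sum>j\<in>P' - P. frag_of (u j, \<one>))"
    by (subst sum.subset_diff[OF assms(2,4)], subst add.commute)
       (auto intro!: arg_cong2[of _ _ _ _ "(+)"] sum.cong)
  ultimately show "z - (\<Sum>j\<in>P'. frag_of (u j, ?y j)) \<in> K"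
    using K_diff[OF assms(6)] by (simp add: diff_diff_add)
qed

lemma reducible_diff:
  assumes "reducible a" "reducible b"
  shows "reducible (a - b)"
proof -
  obtain P0 y0 where 0: "finite P0" "P0 \<subseteq> J" "\<forall>j\<in>P0. y0 j \<in> Z j" "a - (\<Sum>j\<in>P0. frag_of (u j, y0 j)) \<in> K"
    using assms(1) unfolding reducible_def by blast
  obtain P1 y1 where 1: "finite P1" "P1 \<subseteq> J" "\<forall>j\<in>P1. y1 j \<in> Z j" "b - (\<Sum>j\<in>P1. frag_of (u j, y1 j)) \<in> K"
    using assms(2) unfolding reducible_def by blast
  define P where "P = P0 \<union> P1"
  have P: "finite P" "P \<subseteq> J" "P0 \<subseteq> P" "P1 \<subseteq> P" using 0 1 by (auto simp: P_def)
  obtain y where y: "\<forall>j\<in>P. y j \<in> Z j" "a - (\<Sum>j\<in>P. frag_of (u j, y j)) \<in> K"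
    using reducible_extend[of P0 P y0 a] 0 P by auto
  obtain y' where y': "\<forall>j\<in>P. y' j \<in> Z j" "b - (\<Sum>j\<in>P. frag_of (u j, y' j)) \<in> K"
    using reducible_extend[of P1 P y1 b] 1 P by auto
  have mem: "y j \<otimes> inv y' j \<in> Z j" if "j \<in> P" for j
    using that y(1) y'(1) P(2) Z(1) by (auto intro!: subgroup.m_closed subgroup.m_inv_closed)
  have "(\<Sum>j\<in>P. frag_of (u j, y j) - frag_of (u j, y j \<otimes> inv y' j) - frag_of (u j, y' j)) \<in> K"
  proof (rule K_sum)
    fix j assume j: "j \<in> P"
    then have Yj: "y j \<in> Y" "y' j \<in> Y" "y j \<otimes> inv y' j \<in> Y"
      using y(1) y'(1) mem P(2) Z_Y by (meson subsetD)+
    then have "frag_of (u j, (y j \<otimes> inv y' j) \<otimes> y' j) - frag_of (u j, y j \<otimes> inv y' j) - frag_of (u j, y' j) \<in> K"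
      using j P(2) by (intro K_right u) auto
    then show "frag_of (u j, y j) - frag_of (u j, y j \<otimes> inv y' j) - frag_of (u j, y' j) \<in> K"
      using Yj by (simp add: Y_carrier m_assoc)
  qed
  from K_add[OF K_diff[OF y(2) y'(2)] this]
  have "a - b - (\<Sum>j\<in>P. frag_of (u j, y j \<otimes> inv y' j)) \<in> K"
    by (simp add: sum_subtractf sum.distrib algebra_simps)
  then show ?thesis
    unfolding reducible_def using P mem
    by (intro exI[of _ P] exI[of _ "\<lambda>j. y j \<otimes> inv y' j"]) auto
qed

lemma reducible: "Poly_Mapping.keys z \<subseteq> X \<times> Y \<Longrightarrow> reducible z"
proof (induction z rule: free_induct)
  case zero
  show ?case
    unfolding reducible_def by (intro exI[of _ "{}"]) (auto simp: K_zero)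
qed (auto intro: reducible_diff reducible_frag_of)

text \<open>
  The left action of \<open>X\<close> and the right action of \<open>Y\<close> on the tensor product are both of the form
  \<open>g \<otimes> h\<close>, with one of the two maps the identity. Such a map of the free group preserves the
  relations, so that it does not depend on the representative of a coset.
\<close>

lemma frag_extend_keys:
  assumes "\<And>x y. x \<in> X \<Longrightarrow> y \<in> Y \<Longrightarrow> g x \<in> X \<and> h y \<in> Y" "Poly_Mapping.keys z \<subseteq> X \<times> Y"
  shows "Poly_Mapping.keys (frag_extend (\<lambda>(x, y). frag_of (g x, h y)) z) \<subseteq> X \<times> Y"
  using assms(2)
proof (induction z rule: free_induct)
  case (diff x y)
  then show ?case by (auto simp: frag_extend_diff dest!: subsetD[OF keys_diff])
qed (use assms(1) in auto)

lemma frag_extend_K: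
  assumes g: "\<And>x. x \<in> X \<Longrightarrow> g x \<in> X" "\<And>x x'. \<lbrakk>x \<in> X; x' \<in> X\<rbrakk> \<Longrightarrow> g (x \<otimes> x') = g x \<otimes> g x'"
    and h: "\<And>y. y \<in> Y \<Longrightarrow> h y \<in> Y" "\<And>y y'. \<lbrakk>y \<in> Y; y' \<in> Y\<rbrakk> \<Longrightarrow> h (y \<otimes> y') = h y \<otimes> h y'"
    and S': "\<And>x s. \<lbrakk>x \<in> X; s \<in> S\<rbrakk> \<Longrightarrow> g (mul x s) = mul (g x) s"
       "\<And>s y. \<lbrakk>s \<in> S; y \<in> Y\<rbrakk> \<Longrightarrow> h (mul s y) = mul s (h y)"
    and "z \<in> K"
  shows "frag_extend (\<lambda>(x, y). frag_of (g x, h y)) z \<in> K"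
  using assms(7) unfolding tensor_kernel_def
proof (induction z rule: generate.induct)
  case one
  then show ?case using K_zero by (simp add: tensor_kernel_def)
next
  case (incl r)
  then have "frag_extend (\<lambda>(x, y). frag_of (g x, h y)) r \<in> K"
    by (cases rule: tensor_rels_cases)
       (auto simp: frag_extend_diff g h S' intro!: K_left K_right K_middle)
  then show ?case by (simp add: tensor_kernel_def)
next
  case (inv r)
  then have "frag_extend (\<lambda>(x, y). frag_of (g x, h y)) r \<in> K"
    by (cases rule: tensor_rels_cases)
       (auto simp: frag_extend_diff g h S' intro!: K_left K_right K_middle)
  moreover have "inv\<^bsub>F\<^esub> r = - r"
    using inv rels_carrier by (intro inv_free_Abelian_group) (metis carrier_free_Abelian_group_iff subsetD)
  ultimately show ?case
    using K_uminus by (simp add: tensor_kernel_def frag_extend_minus)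
next
  case (eng a b)
  then show ?case using K_add by (simp add: frag_extend_add tensor_kernel_def)
qed

theorem factorization: "mult_induces_iso R mul X S Y"
proof -
  interpret F: comm_group F by (rule abelian_free_Abelian_group)
  have "case_prod mul ` (X \<times> Y) \<subseteq> carrier R"
    using mul_closed X_carrier Y_carrier by auto
  then obtain \<Phi> where \<Phi>: "\<Phi> \<in> hom F R" and \<Phi>_frag0: "\<And>p. p \<in> X \<times> Y \<Longrightarrow> \<Phi> (frag_of p) = case_prod mul p"
    using free_Abelian_group_universal by blast
  have \<Phi>_frag: "\<Phi> (frag_of (x, y)) = mul x y" if "x \<in> X" "y \<in> Y" for x y
    using \<Phi>_frag0[of "(x, y)"] that by simp
  interpret \<Phi>: group_hom F R \<Phi>
    using \<Phi> by (simp add: group_hom_def group_hom_axioms_def is_group)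
  have \<Phi>_add: "\<Phi> (a + b) = \<Phi> a \<otimes> \<Phi> b"
    if "Poly_Mapping.keys a \<subseteq> X \<times> Y" "Poly_Mapping.keys b \<subseteq> X \<times> Y" for a b
    using \<Phi>.hom_mult[of a b] that by simp
  have \<Phi>_uminus: "\<Phi> (- a) = inv \<Phi> a" if "Poly_Mapping.keys a \<subseteq> X \<times> Y" for a
    using \<Phi>.hom_inv[of a] that by simp
  have \<Phi>_closed: "\<Phi> a \<in> carrier R" if "Poly_Mapping.keys a \<subseteq> X \<times> Y" for a
    using \<Phi>.hom_closed[of a] that by simp
  have \<Phi>_diff: "\<Phi> (a - b) = \<Phi> a \<otimes> inv \<Phi> b"
    if "Poly_Mapping.keys a \<subseteq> X \<times> Y" "Poly_Mapping.keys b \<subseteq> X \<times> Y" for a b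
    using \<Phi>_add[of a "- b"] \<Phi>_uminus[of b] that by simp
  have keys_diff': "Poly_Mapping.keys (a - b) \<subseteq> X \<times> Y"
    if "Poly_Mapping.keys a \<subseteq> X \<times> Y" "Poly_Mapping.keys b \<subseteq> X \<times> Y" for a b :: "'m \<times> 'm \<Rightarrow>\<^sub>0 int"
    using that keys_diff[of a b] by auto
  have sum_keys: "Poly_Mapping.keys (\<Sum>j\<in>P. frag_of (u j, y j)) \<subseteq> X \<times> Y"
    if "P \<subseteq> J" "\<forall>j\<in>P. y j \<in> Z j" for P y
    using sum_closed_free_Abelian_group[of P "\<lambda>j. frag_of (u j, y j)" "X \<times> Y"] that u Z(2) by fastforce
  have \<Phi>_sum: "\<Phi> (\<Sum>j\<in>P. frag_of (u j, y j)) = finprod R (\<lambda>j. mul (u j) (y j)) P"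
    if "finite P" "P \<subseteq> J" "\<forall>j\<in>P. y j \<in> Z j" for P y
    using that
  proof (induction P rule: finite_induct)
    case empty
    then show ?case using \<Phi>.hom_one by simp
  next
    case (insert j P)
    then have "\<Phi> (frag_of (u j, y j) + (\<Sum>j\<in>P. frag_of (u j, y j))) =
        \<Phi> (frag_of (u j, y j)) \<otimes> \<Phi> (\<Sum>j\<in>P. frag_of (u j, y j))"
      using sum_keys[of P y] u Z_Y by (intro \<Phi>_add) auto
    moreover have "u i \<in> X \<and> y i \<in> Y" if "i \<in> insert j P" for i
      using insert.prems that u Z_Y by blast
    ultimately show ?case
      using insert by (simp add: \<Phi>_frag Pi_iff mul_closed X_carrier Y_carrier)
  qed

  have cancel: "a \<otimes> b \<otimes> inv a \<otimes> inv b = \<one>" if "a \<in> carrier R" "b \<in> carrier R" for a b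
    using that by (simp add: m_comm[of a b] m_assoc)
  have rels0: "rels \<subseteq> kernel F R \<Phi>"
  proof
    fix r assume r: "r \<in> rels"
    then have "\<Phi> r = \<one>"
    proof (cases rule: tensor_rels_cases)
      case (left x x' y)
      then have "x \<otimes> x' \<in> X" by (meson X(1) subgroup.m_closed)
      with left show ?thesis
        by (simp add: \<Phi>_diff \<Phi>_frag keys_diff' mul_add_left X_carrier Y_carrier mul_closed cancel)
    next
      case (right x y y')
      then have "y \<otimes> y' \<in> Y" by (meson Y(1) subgroup.m_closed)
      with right show ?thesis
        by (simp add: \<Phi>_diff \<Phi>_frag keys_diff' mul_add_right X_carrier Y_carrier mul_closed cancel)
    next
      case (middle x s y)
      then have "s \<in> X" "s \<in> Y" using S by auto
      with middle have "mul x s \<in> X" "mul s y \<in> Y" using X(2) Y(2) by auto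
      with middle \<open>s \<in> X\<close> show ?thesis
        using mul_closed by (simp add: \<Phi>_diff \<Phi>_frag mul_assoc X_carrier Y_carrier)
    qed
    then show "r \<in> kernel F R \<Phi>"
      using subsetD[OF rels_carrier r] by (simp add: kernel_def)
  qed
  have K: "K = kernel F R \<Phi>"
  proof
    show "K \<subseteq> kernel F R \<Phi>"
      unfolding tensor_kernel_def
      by (rule F.generate_subgroup_incl[OF rels0 \<Phi>.subgroup_kernel])
    show "kernel F R \<Phi> \<subseteq> K"
    proof
      fix z assume "z \<in> kernel F R \<Phi>"
      then have z: "Poly_Mapping.keys z \<subseteq> X \<times> Y" "\<Phi> z = \<one>" by (auto simp: kernel_def)
      obtain P y where P: "finite P" "P \<subseteq> J" "\<forall>j\<in>P. y j \<in> Z j" "z - (\<Sum>j\<in>P. frag_of (u j, y j)) \<in> K"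
        using reducible[OF z(1)] unfolding reducible_def by blast
      let ?s = "\<Sum>j\<in>P. frag_of (u j, y j)"
      have "\<Phi> (z - ?s) = \<one>"
        using P(4) \<open>K \<subseteq> kernel F R \<Phi>\<close> by (auto simp: kernel_def)
      then have "\<Phi> ?s = \<one>"
        using z sum_keys[OF P(2,3)] \<Phi>_closed by (simp add: \<Phi>_diff)
      then have "y j = \<one>" if "j \<in> P" for j
        using independent[OF P(1,2,3)] \<Phi>_sum[OF P(1,2,3)] that by simp
      then have "?s \<in> K"
        using P u by (intro K_sum) (auto intro!: K_one_right)
      from K_add[OF P(4) this] show "z \<in> K"
        by simp
    qed
  qed
  have surj: "\<Phi> ` carrier F = carrier R"
  proof
    show "carrier R \<subseteq> \<Phi> ` carrier F"
    proof
      fix z assume "z \<in> carrier R"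
      then obtain P y where P: "finite P" "P \<subseteq> J" "\<forall>j\<in>P. y j \<in> Z j"
        and z: "z = finprod R (\<lambda>j. mul (u j) (y j)) P"
        using R_span[OF \<open>z \<in> carrier R\<close>] by blast
      have "\<Phi> (\<Sum>j\<in>P. frag_of (u j, y j)) \<in> \<Phi> ` carrier F"
        by (rule imageI) (simp only: carrier_free_Abelian_group_iff sum_keys[OF P(2,3)])
      then show "z \<in> \<Phi> ` carrier F"
        by (simp only: z \<Phi>_sum[OF P])
    qed
  qed (use \<Phi>.hom_closed in auto)

  define \<phi> where "\<phi> t = the_elem (\<Phi> ` t)" for t
  have iso: "\<phi> \<in> iso (F Mod K) R"
    unfolding K \<phi>_def by (rule \<Phi>.FactGroup_iso_set[OF surj])
  have \<phi>_coset: "\<phi> (K #>\<^bsub>F\<^esub> z) = \<Phi> z" if "Poly_Mapping.keys z \<subseteq> X \<times> Y" for z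
  proof -
    have "\<Phi> (k + z) = \<Phi> z" if "k \<in> K" for k
    proof -
      have "\<Phi> k = \<one>" using that unfolding K kernel_def by simp
      then show ?thesis using \<open>Poly_Mapping.keys z \<subseteq> X \<times> Y\<close> K_keys[OF that] by (simp add: \<Phi>_add \<Phi>_closed)
    qed
    moreover have "K #>\<^bsub>F\<^esub> z = (\<lambda>k. k + z) ` K" by (auto simp: r_coset_def)
    ultimately have "\<Phi> ` (K #>\<^bsub>F\<^esub> z) = {\<Phi> z}"
      using K_zero by (simp add: image_image) blast
    then show ?thesis by (simp add: \<phi>_def)
  qed
  have act: "\<phi> (\<Union>z\<in>t. K #>\<^bsub>F\<^esub> E z) = a (\<phi> t)"
    if t: "t \<in> carrier (F Mod K)"
      and E: "E = frag_extend (\<lambda>(x, y). frag_of (g x, h y))"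
      and g: "\<And>x. x \<in> X \<Longrightarrow> g x \<in> X" "\<And>x x'. \<lbrakk>x \<in> X; x' \<in> X\<rbrakk> \<Longrightarrow> g (x \<otimes> x') = g x \<otimes> g x'"
      and h: "\<And>y. y \<in> Y \<Longrightarrow> h y \<in> Y" "\<And>y y'. \<lbrakk>y \<in> Y; y' \<in> Y\<rbrakk> \<Longrightarrow> h (y \<otimes> y') = h y \<otimes> h y'"
      and S': "\<And>x s. \<lbrakk>x \<in> X; s \<in> S\<rbrakk> \<Longrightarrow> g (mul x s) = mul (g x) s"
        "\<And>s y. \<lbrakk>s \<in> S; y \<in> Y\<rbrakk> \<Longrightarrow> h (mul s y) = mul s (h y)"
      and a: "a \<in> hom R R" "\<And>x y. \<lbrakk>x \<in> X; y \<in> Y\<rbrakk> \<Longrightarrow> mul (g x) (h y) = a (mul x y)"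
    for t E g h a
  proof -
    interpret a: group_hom R R a
      using a(1) by (simp add: group_hom_def group_hom_axioms_def is_group)
    have keys: "Poly_Mapping.keys (E z) \<subseteq> X \<times> Y" if "Poly_Mapping.keys z \<subseteq> X \<times> Y" for z
      unfolding E by (rule frag_extend_keys) (use g h that in auto)
    have \<Phi>E: "\<Phi> (E z) = a (\<Phi> z)" if "Poly_Mapping.keys z \<subseteq> X \<times> Y" for z
      using that
    proof (induction z rule: free_induct)
      case zero
      then show ?case using \<Phi>.hom_one by (simp add: E)
    next
      case (diff x y)
      then show ?case
        using keys[of x] keys[of y] unfolding E
        by (simp add: frag_extend_diff \<Phi>_diff \<Phi>_closed)
    next
      case (frag_of p)
      then show ?case using a(2) g h by (auto simp: E \<Phi>_frag)
    qed
    obtain z where z: "Poly_Mapping.keys z \<subseteq> X \<times> Y" and tz: "t = K #>\<^bsub>F\<^esub> z"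
      using t by (auto simp: FactGroup_def RCOSETS_def)
    have "K #>\<^bsub>F\<^esub> E z' = K #>\<^bsub>F\<^esub> E z" if z': "z' \<in> t" for z'
    proof -
      obtain k where k: "k \<in> K" "z' = k + z" using z' by (auto simp: tz r_coset_def)
      have "E k \<in> K" unfolding E by (rule frag_extend_K) (use g h S' k in auto)
      then have "E z' \<in> K #>\<^bsub>F\<^esub> E z" using k by (auto simp: r_coset_def E frag_extend_add)
      then show ?thesis
        using F.repr_independence[of "E z'" K "E z"] keys[OF z] K_subgroup by simp
    qed
    moreover have "z \<in> t"
      unfolding tz using z K_subgroup by (intro F.rcos_self) simp_all
    ultimately have "(\<Union>z\<in>t. K #>\<^bsub>F\<^esub> E z) = K #>\<^bsub>F\<^esub> E z" by blast
    then show ?thesis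
      by (simp only: \<phi>_coset[OF keys[OF z]] \<phi>_coset[OF z] tz \<Phi>E[OF z])
  qed
  have left: "\<phi> (\<Union>z\<in>t. K #>\<^bsub>F\<^esub> frag_extend (\<lambda>(x, y). frag_of (mul b x, y)) z) = mul b (\<phi> t)"
    if b: "b \<in> X" and t: "t \<in> carrier (F Mod K)" for b t
  proof (rule act[where g = "mul b" and h = "\<lambda>y. y" and a = "mul b", OF t refl])
    show "mul b \<in> hom R R"
      using b by (auto intro!: homI simp: mul_closed mul_add_right X_carrier)
    show "mul b (mul x s) = mul (mul b x) s" if "x \<in> X" "s \<in> S" for x s
      using that S b by (intro mul_assoc[symmetric] X_carrier) auto
    show "mul (mul b x) y = mul b (mul x y)" if "x \<in> X" "y \<in> Y" for x y
      using that b by (intro mul_assoc X_carrier Y_carrier) auto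
  qed (simp_all add: b X(2) mul_add_right X_carrier)
  have right: "\<phi> (\<Union>z\<in>t. K #>\<^bsub>F\<^esub> frag_extend (\<lambda>(x, y). frag_of (x, mul y b)) z) = mul (\<phi> t) b"
    if b: "b \<in> Y" and t: "t \<in> carrier (F Mod K)" for b t
  proof (rule act[where g = "\<lambda>x. x" and h = "\<lambda>y. mul y b" and a = "\<lambda>z. mul z b", OF t refl])
    show "(\<lambda>z. mul z b) \<in> hom R R"
      using b by (auto intro!: homI simp: mul_closed mul_add_left Y_carrier)
    show "mul (mul s y) b = mul s (mul y b)" if "s \<in> S" "y \<in> Y" for s y
      using that S b by (intro mul_assoc Y_carrier) auto
    show "mul x (mul y b) = mul (mul x y) b" if "x \<in> X" "y \<in> Y" for x y
      using that b by (intro mul_assoc[symmetric] X_carrier Y_carrier) auto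
  qed (simp_all add: b Y(2) mul_add_left Y_carrier)
  have frag: "\<phi> (K #>\<^bsub>F\<^esub> frag_of (x, y)) = mul x y" if "x \<in> X" "y \<in> Y" for x y
    using that by (simp add: \<phi>_coset \<Phi>_frag)
  show ?thesis
    unfolding mult_induces_iso_def Let_def tensor_product_def
  proof (rule bexI[OF _ iso], intro conjI ballI)
  qed (erule (1) frag, erule (1) left, erule (1) right)
qed

end

section \<open>Cosets of additive subgroups\<close>

lemma add_subgroupD:
  assumes "add_subgroup H"
  shows "0 \<in> H" "\<lbrakk>x \<in> H; y \<in> H\<rbrakk> \<Longrightarrow> x + y \<in> H" "x \<in> H \<Longrightarrow> - x \<in> H" "\<lbrakk>x \<in> H; y \<in> H\<rbrakk> \<Longrightarrow> x - y \<in> H"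
proof -
  have diff: "x - y \<in> H" if "x \<in> H" "y \<in> H" for x y
    using assms that by (simp add: add_subgroup_def)
  show "0 \<in> H" using assms by (simp add: add_subgroup_def)
  then show "- x \<in> H" if "x \<in> H" for x using diff[of 0 x] that by simp
  then show "x + y \<in> H" if "x \<in> H" "y \<in> H" using diff[of x "- y"] that by simp
qed (use assms in \<open>simp add: add_subgroup_def\<close>)

lemma add_subgroup_sum: "add_subgroup H \<Longrightarrow> (\<And>i. i \<in> A \<Longrightarrow> f i \<in> H) \<Longrightarrow> sum f A \<in> H"
  by (induction A rule: infinite_finite_induct) (auto dest: add_subgroupD)

lemma add_subgroup_zero: "add_subgroup {0}"
  by (simp add: add_subgroup_def)

lemma coset_add:
  assumes "add_subgroup D"
  shows "(x +o D) + (y +o D) = (x + y) +o D"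
proof -
  have "D + D = D"
    using add_subgroupD[OF assms] by (force simp: set_plus_def)
  then show ?thesis by (simp add: set_plus_rearrange)
qed

lemma coset_eq_iff:
  assumes "add_subgroup D"
  shows "x +o D = y +o D \<longleftrightarrow> x - y \<in> D"
proof
  assume "x +o D = y +o D"
  moreover have "x \<in> x +o D" using add_subgroupD(1)[OF assms] by (force simp: elt_set_plus_def)
  ultimately show "x - y \<in> D" by (simp add: set_plus_imp_minus)
next
  assume D: "x - y \<in> D"
  have "x + d = y + ((x - y) + d) \<and> y + d = x + (d - (x - y))" for d by simp
  then show "x +o D = y +o D"
    using add_subgroupD(2,4)[OF assms] D unfolding elt_set_plus_def by blast
qed

lemma coset_eq_self_iff:
  assumes "add_subgroup D"
  shows "x +o D = D \<longleftrightarrow> x \<in> D"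
  using coset_eq_iff[OF assms, of x 0] by simp

text \<open>
  Meant for products \<open>A s\<close> of two cosets, which become a coset of \<open>D\<close> only after \<open>D\<close> has been added;
  adding \<open>D\<close> once, after the summation, has the same effect.
\<close>

lemma sum_coset:
  assumes "\<And>s. s \<in> U \<Longrightarrow> A s + D = f s +o D"
  shows "(\<Sum>s\<in>U. A s) + D = (\<Sum>s\<in>U. f s) +o (D :: 'b::ab_group_add set)"
  using assms
proof (induction U rule: infinite_finite_induct)
  case (insert s U)
  then have "(\<Sum>s\<in>insert s U. A s) + D = (sum f U) +o (A s + D)"
    by (simp add: add.assoc set_plus_rearrange4)
  with insert show ?case by (simp add: set_plus_rearrange2 add.commute)
qed (simp_all)

section \<open>Graded algebras\<close>

locale graded_filtration = k_algebra scale
  for scale :: "'k::field \<Rightarrow> 'a::{ring,monoid_mult} \<Rightarrow> 'a" +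
  fixes G I :: "nat \<Rightarrow> 'a set" and N :: nat
  assumes grading: "positive_grading scale G"
    and I: "I j = degree_ge G j"
    and I_N: "I N = {0}"
begin

definition component :: "nat \<Rightarrow> 'a \<Rightarrow> 'a" where
  "component i x = (THE f. decomposes G x f) i"

lemma G_subspace: "subspace (G i)" and G_mult: "\<lbrakk>x \<in> G i; y \<in> G j\<rbrakk> \<Longrightarrow> x * y \<in> G (i + j)"
  using grading unfolding positive_grading_def by blast+

lemma G_closed: "add_subgroup (G i)"
  unfolding add_subgroup_def using G_subspace[of i] by (auto intro: subspace_0 subspace_diff)

lemma component_decomposes: "decomposes G x (\<lambda>i. component i x)"
  unfolding component_def using grading theI'[of "decomposes G x"] unfolding positive_grading_def by auto

lemma component_eqI:
  assumes "decomposes G x f"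
  shows "component i x = f i"
proof -
  have "\<exists>!f. decomposes G x f" using grading unfolding positive_grading_def by blast
  then have "(\<lambda>i. component i x) = f" using component_decomposes assms by blast
  then show ?thesis by (simp add: fun_eq_iff)
qed

lemma component_G: "component i x \<in> G i"
  using component_decomposes[of x] by (simp add: decomposes_def)

lemma finite_component: "finite {i. component i x \<noteq> 0}"
  using component_decomposes[of x] by (simp add: decomposes_def)

lemma component_homogeneous: "x \<in> G i \<Longrightarrow> component j x = (if j = i then x else 0)"
  by (rule component_eqI) (auto simp: decomposes_def add_subgroupD(1)[OF G_closed] Collect_conv_if)

lemma decomposesI:
  assumes "\<And>i. f i \<in> G i" "finite T" "\<And>i. i \<notin> T \<Longrightarrow> f i = 0" "x = sum f T"
  shows "decomposes G x f"
  unfolding decomposes_def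
proof (intro conjI allI)
  show fin: "finite {i. f i \<noteq> 0}" by (rule finite_subset[OF _ assms(2)]) (use assms(3) in auto)
  show "x = (\<Sum>i | f i \<noteq> 0. f i)"
    unfolding assms(4) by (rule sum.mono_neutral_right) (use assms(2,3) in auto)
qed (rule assms(1))

lemma sum_component:
  assumes "finite T" "\<And>i. component i x \<noteq> 0 \<Longrightarrow> i \<in> T"
  shows "(\<Sum>i\<in>T. component i x) = x"
proof -
  have "(\<Sum>i\<in>T. component i x) = (\<Sum>i | component i x \<noteq> 0. component i x)"
    by (rule sum.mono_neutral_right) (use assms in auto)
  then show ?thesis using component_decomposes[of x] by (simp add: decomposes_def)
qed

lemma component_add: "component i (x + y) = component i x + component i y"
proof (rule component_eqI, rule decomposesI)
  let ?T = "{i. component i x \<noteq> 0} \<union> {i. component i y \<noteq> 0}"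
  show "finite ?T" by (simp add: finite_component)
  have "(\<Sum>i\<in>?T. component i x) = x" "(\<Sum>i\<in>?T. component i y) = y"
    by (rule sum_component; auto simp: finite_component)+
  then show "x + y = (\<Sum>i\<in>?T. component i x + component i y)" by (simp add: sum.distrib)
qed (auto intro: add_subgroupD(2)[OF G_closed] component_G)

lemma component_scale: "component i (scale a x) = scale a (component i x)"
proof (rule component_eqI, rule decomposesI)
  show "scale a x = (\<Sum>i | component i x \<noteq> 0. scale a (component i x))"
    by (simp add: sum_component finite_component flip: scale_sum_right)
qed (auto intro: subspace_scale[OF G_subspace] component_G finite_component)

lemma component_zero [simp]: "component i 0 = 0"
  using component_add[of i 0 0] by simp

lemma component_uminus: "component i (- x) = - component i x"
  using component_add[of i x "- x"] by (simp add: eq_neg_iff_add_eq_0 add.commute)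

lemma component_diff: "component i (x - y) = component i x - component i y"
  using component_add[of i x "- y"] by (simp add: component_uminus)

lemma component_sum: "component i (sum f A) = (\<Sum>a\<in>A. component i (f a))"
  by (induction A rule: infinite_finite_induct) (simp_all add: component_add)

lemma I_iff: "x \<in> I j \<longleftrightarrow> (\<forall>i<j. component i x = 0)"
proof
  assume "x \<in> I j"
  then obtain f where "decomposes G x f" "\<forall>i<j. f i = 0" unfolding I degree_ge_def by blast
  then show "\<forall>i<j. component i x = 0" by (simp add: component_eqI)
next
  assume "\<forall>i<j. component i x = 0"
  then show "x \<in> I j" unfolding I degree_ge_def using component_decomposes by blast
qed

lemma I_closed: "add_subgroup (I j)"
  by (simp add: add_subgroup_def I_iff component_diff)

lemma component_ge_N: "i \<ge> N \<Longrightarrow> component i x = 0"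
proof -
  assume "i \<ge> N"
  then have "component i x \<in> I N" by (simp add: I_iff component_homogeneous[OF component_G])
  then show ?thesis by (simp add: I_N)
qed

lemma sum_component_N: "(\<Sum>i<N. component i x) = x"
  by (rule sum_component) (use component_ge_N not_le in auto)

lemma I_0: "I 0 = UNIV" and I_ge_N: "m \<ge> N \<Longrightarrow> I m = {0}"
proof -
  show "I 0 = UNIV" by (auto simp: I_iff)
  assume "m \<ge> N"
  then have "I m \<subseteq> I N" by (auto simp: I_iff)
  then show "I m = {0}" using I_N add_subgroupD(1)[OF I_closed] by blast
qed

lemma G_I: "j \<le> i \<Longrightarrow> x \<in> G i \<Longrightarrow> x \<in> I j"
  by (auto simp: I_iff component_homogeneous)

lemma I_mult:
  assumes "x \<in> I i" "y \<in> I j"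
  shows "x * y \<in> I (i + j)"
proof -
  have "component a x * component b y \<in> I (i + j)" for a b
  proof (cases "i \<le> a \<and> j \<le> b")
    case True
    then show ?thesis using G_mult[OF component_G component_G] by (intro G_I[of _ "a + b"]) auto
  next
    case False
    then show ?thesis
      using assms add_subgroupD(1)[OF I_closed] by (auto simp: I_iff not_le)
  qed
  then have "(\<Sum>a<N. \<Sum>b<N. component a x * component b y) \<in> I (i + j)"
    by (intro add_subgroup_sum I_closed)
  then show ?thesis
    by (simp add: sum_component_N flip: sum_product)
qed

text \<open>
  If \<open>e\<close> is the component of \<open>1\<close> of degree \<open>0\<close>, comparing the components of degree \<open>j\<close> in \<open>x = 1 * x\<close>
  gives \<open>x = e * x\<close> for all homogeneous \<open>x\<close>. By linearity this holds for \<open>x = 1\<close>.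
\<close>

lemma one_G: "1 \<in> G 0"
proof -
  have *: "component 0 1 * x = x" if "x \<in> G j" for x j
  proof -
    have "x = component j ((\<Sum>i<N. component i 1) * x)"
      using that by (simp add: sum_component_N component_homogeneous)
    also have "\<dots> = (\<Sum>i<N. component j (component i 1 * x))"
      by (simp add: sum_distrib_right component_sum)
    also have "\<dots> = (\<Sum>i<N. if i = 0 then component 0 1 * x else 0)"
      using that by (intro sum.cong refl) (simp add: component_homogeneous[OF G_mult[OF component_G that]])
    also have "\<dots> = component 0 1 * x"
      using component_ge_N[of 0 1] by (cases "N = 0") (auto simp: sum.delta)
    finally show ?thesis by simp
  qed
  have "component 0 1 * (\<Sum>i<N. component i 1) = (\<Sum>i<N. component i 1)"
    unfolding sum_distrib_left by (intro sum.cong refl *[OF component_G])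
  then have "component 0 1 = 1" by (simp add: sum_component_N)
  then show ?thesis using component_G[of 0 1] by simp
qed

section \<open>Matrices of representatives\<close>

abbreviation "num \<equiv> entry_num I"
abbreviation "den \<equiv> entry_den I N"

text \<open>
  With \<open>I (nat k)\<close>, which is the whole algebra for \<open>k \<le> 0\<close>, the case distinctions in the definition of
  the entries disappear: numerators and denominators are the steps \<open>r - c\<close> and \<open>N + r - c\<close> of
  the filtration by degree. This makes the numerators a ring of matrices with the denominators as an
  ideal, and \<open>\<CC>\<close> is the quotient.
\<close>

lemma num_eq: "num r c = I (nat (r - c))"
  by (simp add: entry_num_def I_0)

lemma den_eq: "den r c = I (nat (int N + r - c))"
  by (auto simp: entry_den_def I_0 I_ge_N diff_diff_eq2)

lemma num_iff: "x \<in> num r c \<longleftrightarrow> (\<forall>i. int i < r - c \<longrightarrow> component i x = 0)"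
  by (simp add: num_eq I_iff zless_nat_eq_int_zless)

lemma den_iff: "x \<in> den r c \<longleftrightarrow> (\<forall>i. int i < int N + r - c \<longrightarrow> component i x = 0)"
  by (simp add: den_eq I_iff zless_nat_eq_int_zless)

lemma num_closed: "add_subgroup (num r c)" and den_closed: "add_subgroup (den r c)"
  by (simp_all add: num_eq den_eq I_closed)

lemma den_num: "x \<in> den r c \<Longrightarrow> x \<in> num r c"
  by (simp add: num_iff den_iff)

lemma I_nat_mult:
  assumes "x \<in> I (nat k)" "y \<in> I (nat l)" "m = k + l"
  shows "x * y \<in> I (nat m)"
proof -
  have "nat m \<le> nat k + nat l" using assms(3) by simp
  then show ?thesis using I_mult[OF assms(1,2)] by (auto simp: I_iff)
qed

lemma num_mult: "\<lbrakk>x \<in> num r s; y \<in> num s c\<rbrakk> \<Longrightarrow> x * y \<in> num r c"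
  using I_nat_mult[of x "r - s" y "s - c" "r - c"] by (simp add: num_eq)

lemma den_num_mult: "\<lbrakk>x \<in> den r s; y \<in> num s c\<rbrakk> \<Longrightarrow> x * y \<in> den r c"
  using I_nat_mult[of x "int N + r - s" y "s - c" "int N + r - c"] by (simp add: num_eq den_eq)

lemma num_den_mult: "\<lbrakk>x \<in> num r s; y \<in> den s c\<rbrakk> \<Longrightarrow> x * y \<in> den r c"
  using I_nat_mult[of x "r - s" y "int N + s - c" "int N + r - c"] by (simp add: num_eq den_eq)

lemma coset_mult:
  assumes x: "x \<in> num r s" and y: "y \<in> num s c"
  shows "(x +o den r s) * (y +o den s c) + den r c = (x * y) +o den r c"
proof
  show "(x +o den r s) * (y +o den s c) + den r c \<subseteq> (x * y) +o den r c"
  proof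
    fix z assume "z \<in> (x +o den r s) * (y +o den s c) + den r c"
    then obtain d d' d'' where d: "d \<in> den r s" "d' \<in> den s c" "d'' \<in> den r c"
      and z: "z = (x + d) * (y + d') + d''"
      unfolding set_plus_def set_times_def elt_set_plus_def by blast
    have "x * d' \<in> den r c" "d * (y + d') \<in> den r c"
      using x y d by (auto intro: num_den_mult den_num_mult add_subgroupD(2)[OF num_closed] den_num)
    then have "x * d' + d * (y + d') + d'' \<in> den r c"
      using d by (auto intro: add_subgroupD(2)[OF den_closed])
    moreover have "z = x * y + (x * d' + d * (y + d') + d'')"
      by (simp add: z algebra_simps)
    ultimately show "z \<in> (x * y) +o den r c" by (auto simp: elt_set_plus_def)
  qed
  have "x \<in> x +o den r s" "y \<in> y +o den s c"
    using add_subgroupD(1)[OF den_closed] by (force simp: elt_set_plus_def)+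
  then show "(x * y) +o den r c \<subseteq> (x +o den r s) * (y +o den s c) + den r c"
    by (intro set_plus_mono3) blast
qed

text \<open>
  Calculations in \<open>\<CC>\<close> are carried out with matrices of representatives that are themselves finitely
  supported; \<open>mats H\<close> collects those with entries in prescribed sets.
\<close>

definition coset_mat :: "(int \<Rightarrow> int \<Rightarrow> 'a) \<Rightarrow> 'a cmat" where
  "coset_mat m r c = m r c +o den r c"

definition mats :: "(int \<Rightarrow> int \<Rightarrow> 'a set) \<Rightarrow> (int \<Rightarrow> int \<Rightarrow> 'a) set" where
  "mats H = {m. (\<forall>r c. m r c \<in> H r c) \<and> finite {(r, c). m r c \<noteq> 0}}"

lemma mats_mem: "m \<in> mats H \<Longrightarrow> m r c \<in> H r c"
  by (simp add: mats_def)

lemma mats_mono: "m \<in> mats H \<Longrightarrow> (\<And>r c. H r c \<subseteq> H' r c) \<Longrightarrow> m \<in> mats H'"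
  unfolding mats_def by blast

lemma mats_support:
  assumes "m \<in> mats H"
  obtains T where "finite T" "\<And>r c. m r c \<noteq> 0 \<Longrightarrow> r \<in> T \<and> c \<in> T"
proof
  let ?P = "{(r, c). m r c \<noteq> 0}"
  show "finite (fst ` ?P \<union> snd ` ?P)" using assms by (simp add: mats_def)
qed force

lemma matsI:
  assumes "\<And>r c. m r c \<in> H r c" "finite T" "\<And>r c. m r c \<noteq> 0 \<Longrightarrow> r \<in> T \<and> c \<in> T"
  shows "m \<in> mats H"
proof -
  have "{(r, c). m r c \<noteq> 0} \<subseteq> T \<times> T" using assms(3) by auto
  then show ?thesis using assms(1,2) by (auto simp: mats_def intro: finite_subset)
qed

lemma coset_mat_eq_iff: "coset_mat m = coset_mat p \<longleftrightarrow> (\<forall>r c. m r c - p r c \<in> den r c)"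
  by (simp add: coset_mat_def fun_eq_iff coset_eq_iff[OF den_closed])

lemma coset_mat_eq_den_iff: "coset_mat m r c = den r c \<longleftrightarrow> m r c \<in> den r c"
  by (simp add: coset_mat_def coset_eq_self_iff[OF den_closed])

text \<open>
  A matrix of cosets has a finitely supported matrix of representatives, because the zero coset can
  be represented by \<open>0\<close>. The same holds under restrictions on the representatives, which covers \<open>\<CC>\<close>
  and each of its subalgebras.
\<close>

lemma coset_mat_mats:
  assumes H: "\<And>r c. 0 \<in> H r c" "\<And>r c. H r c \<subseteq> num r c"
  shows "{M \<in> carrier (CC I N). \<forall>r c. M r c \<in> (\<lambda>x. x +o den r c) ` H r c} = coset_mat ` mats H" (is "?L = _")
proof
  show "?L \<subseteq> coset_mat ` mats H"
  proof
    fix M assume M: "M \<in> ?L"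
    define m where "m r c = (if M r c = den r c then 0 else SOME x. x \<in> H r c \<and> M r c = x +o den r c)" for r c
    have m: "m r c \<in> H r c \<and> M r c = m r c +o den r c" for r c
    proof (cases "M r c = den r c")
      case False
      moreover have "\<exists>x. x \<in> H r c \<and> M r c = x +o den r c" using M by blast
      ultimately show ?thesis unfolding m_def using someI_ex by (smt (verit))
    qed (simp add: m_def H(1))
    have "{(r, c). m r c \<noteq> 0} \<subseteq> {(r, c). M r c \<noteq> den r c}" by (auto simp: m_def)
    then have "m \<in> mats H" using M m finite_subset by (auto simp: mats_def CC_def)
    moreover have "M = coset_mat m" using m by (auto simp: coset_mat_def fun_eq_iff)
    ultimately show "M \<in> coset_mat ` mats H" by blast
  qed
  show "coset_mat ` mats H \<subseteq> ?L"
  proof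
    fix M assume "M \<in> coset_mat ` mats H"
    then obtain m where m: "m \<in> mats H" "M = coset_mat m" by blast
    have "{(r, c). M r c \<noteq> den r c} \<subseteq> {(r, c). m r c \<noteq> 0}"
      using add_subgroupD(1)[OF den_closed] by (auto simp: m coset_mat_eq_den_iff)
    then show "M \<in> ?L"
      using m H(2) finite_subset by (fastforce simp: mats_def CC_def entry_def coset_mat_def)
  qed
qed

lemma carrier_CC: "carrier (CC I N) = coset_mat ` mats num"
proof -
  have "coset_mat ` mats num = {M \<in> carrier (CC I N). \<forall>r c. M r c \<in> (\<lambda>x. x +o den r c) ` num r c}"
    by (rule coset_mat_mats[symmetric]) (simp_all add: add_subgroupD(1)[OF num_closed])
  then show ?thesis by (auto simp: CC_def entry_def)
qed

lemma coset_mat_add: "coset_mat m \<otimes>\<^bsub>CC I N\<^esub> coset_mat p = coset_mat (\<lambda>r c. m r c + p r c)"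
  by (simp add: CC_def coset_mat_def fun_eq_iff coset_add[OF den_closed])

lemma coset_mat_zero: "coset_mat (\<lambda>r c. 0) = \<one>\<^bsub>CC I N\<^esub>"
  by (simp add: CC_def coset_mat_def fun_eq_iff)

lemma mats_zero: "(\<And>r c. add_subgroup (H r c)) \<Longrightarrow> (\<lambda>r c. 0) \<in> mats H"
  by (simp add: mats_def add_subgroupD)

lemma mats_add:
  assumes "\<And>r c. add_subgroup (H r c)" "m \<in> mats H" "p \<in> mats H"
  shows "(\<lambda>r c. m r c + p r c) \<in> mats H"
proof -
  obtain T where "finite T" "\<And>r c. m r c \<noteq> 0 \<Longrightarrow> r \<in> T \<and> c \<in> T" using mats_support[OF assms(2)] by blast
  moreover obtain T' where "finite T'" "\<And>r c. p r c \<noteq> 0 \<Longrightarrow> r \<in> T' \<and> c \<in> T'" using mats_support[OF assms(3)] by blast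
  ultimately show ?thesis
    using assms by (intro matsI[where T = "T \<union> T'"]) (auto intro: add_subgroupD mats_mem, (metis add_0)+)
qed

lemma mats_uminus: "(\<And>r c. add_subgroup (H r c)) \<Longrightarrow> m \<in> mats H \<Longrightarrow> (\<lambda>r c. - m r c) \<in> mats H"
  by (simp add: mats_def add_subgroupD)

lemma CC_comm_group: "comm_group (CC I N)"
proof (rule comm_groupI)
  show "x \<otimes>\<^bsub>CC I N\<^esub> y \<in> carrier (CC I N)" if "x \<in> carrier (CC I N)" "y \<in> carrier (CC I N)" for x y
    using that mats_add[OF num_closed] by (auto simp: carrier_CC coset_mat_add)
  show "\<one>\<^bsub>CC I N\<^esub> \<in> carrier (CC I N)"
    using mats_zero[OF num_closed] by (auto simp: carrier_CC simp flip: coset_mat_zero)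
  show "\<exists>y\<in>carrier (CC I N). y \<otimes>\<^bsub>CC I N\<^esub> x = \<one>\<^bsub>CC I N\<^esub>" if x: "x \<in> carrier (CC I N)" for x
  proof -
    obtain m where "m \<in> mats num" "x = coset_mat m" using x by (auto simp: carrier_CC)
    then show ?thesis
      using mats_uminus[OF num_closed]
      by (intro bexI[of _ "coset_mat (\<lambda>r c. - m r c)"]) (auto simp: coset_mat_add carrier_CC simp flip: coset_mat_zero)
  qed
  show "\<one>\<^bsub>CC I N\<^esub> \<otimes>\<^bsub>CC I N\<^esub> x = x" if "x \<in> carrier (CC I N)" for x
    using that by (auto simp: carrier_CC coset_mat_add simp flip: coset_mat_zero)
qed (simp_all add: CC_def ac_simps)

lemma coset_mat_uminus: "m \<in> mats num \<Longrightarrow> inv\<^bsub>CC I N\<^esub> (coset_mat m) = coset_mat (\<lambda>r c. - m r c)"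
proof -
  interpret CC: comm_group "CC I N" by (rule CC_comm_group)
  assume "m \<in> mats num"
  then show ?thesis
    using mats_uminus[OF num_closed]
    by (intro CC.inv_equality) (auto simp: coset_mat_add carrier_CC simp flip: coset_mat_zero)
qed

lemma subgroup_coset_mat_mats:
  assumes "\<And>r c. add_subgroup (H r c)" "\<And>r c. H r c \<subseteq> num r c"
  shows "subgroup (coset_mat ` mats H) (CC I N)"
proof -
  interpret CC: comm_group "CC I N" by (rule CC_comm_group)
  have num: "m \<in> mats num" if "m \<in> mats H" for m by (rule mats_mono[OF that]) (rule assms(2))
  show ?thesis
  proof (rule CC.subgroupI)
    show "coset_mat ` mats H \<subseteq> carrier (CC I N)" using num by (auto simp: carrier_CC)
    show "coset_mat ` mats H \<noteq> {}" using mats_zero[of H] assms(1) by blast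
  qed (auto simp: coset_mat_add coset_mat_uminus num intro!: imageI mats_add mats_uminus assms(1))
qed

lemma finprod_coset_mat:
  assumes "finite P" "\<And>j. j \<in> P \<Longrightarrow> m j \<in> mats num"
  shows "finprod (CC I N) (\<lambda>j. coset_mat (m j)) P = coset_mat (\<lambda>r c. \<Sum>j\<in>P. m j r c)"
proof -
  interpret CC: comm_group "CC I N" by (rule CC_comm_group)
  show ?thesis
    using assms
    by (induction P rule: finite_induct) (simp_all add: coset_mat_zero coset_mat_add carrier_CC Pi_iff)
qed

text \<open>
  The index set of the sum is restricted to make it finite.
\<close>

definition mat_mult :: "(int \<Rightarrow> int \<Rightarrow> 'a) \<Rightarrow> (int \<Rightarrow> int \<Rightarrow> 'a) \<Rightarrow> int \<Rightarrow> int \<Rightarrow> 'a" where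
  "mat_mult a b r c = (\<Sum>s | a r s \<noteq> 0 \<and> b s c \<noteq> 0. a r s * b s c)"

lemma mat_mult_eq:
  assumes "finite T" "\<And>s. a r s \<noteq> 0 \<Longrightarrow> b s c \<noteq> 0 \<Longrightarrow> s \<in> T"
  shows "mat_mult a b r c = (\<Sum>s\<in>T. a r s * b s c)"
  unfolding mat_mult_def by (rule sum.mono_neutral_left) (use assms in auto)

lemma mat_mult_mats:
  assumes "a \<in> mats H" "b \<in> mats H'"
    and "\<And>r s c x y. \<lbrakk>x \<in> H r s; y \<in> H' s c\<rbrakk> \<Longrightarrow> x * y \<in> H'' r c" "\<And>r c. add_subgroup (H'' r c)"
  shows "mat_mult a b \<in> mats H''"
proof -
  obtain T where T: "finite T" "\<And>r c. a r c \<noteq> 0 \<Longrightarrow> r \<in> T \<and> c \<in> T" using mats_support[OF assms(1)] by blast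
  obtain T' where T': "finite T'" "\<And>r c. b r c \<noteq> 0 \<Longrightarrow> r \<in> T' \<and> c \<in> T'" using mats_support[OF assms(2)] by blast
  show ?thesis
  proof (rule matsI[where T = "T \<union> T'"])
    show "mat_mult a b r c \<in> H'' r c" for r c
      unfolding mat_mult_def
      by (intro add_subgroup_sum assms(4)) (rule assms(3)[OF mats_mem[OF assms(1)] mats_mem[OF assms(2)]])
    show "r \<in> T \<union> T' \<and> c \<in> T \<union> T'" if "mat_mult a b r c \<noteq> 0" for r c
    proof -
      have "\<exists>s. a r s \<noteq> 0 \<and> b s c \<noteq> 0"
      proof (rule ccontr)
        assume "\<not> ?thesis"
        then have "{s. a r s \<noteq> 0 \<and> b s c \<noteq> 0} = {}" by blast
        then show False using that unfolding mat_mult_def by (simp del: Collect_empty_eq)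
      qed
      then show ?thesis using T(2) T'(2) by blast
    qed
  qed (use T T' in auto)
qed

lemma mat_mult_num: "\<lbrakk>a \<in> mats num; b \<in> mats num\<rbrakk> \<Longrightarrow> mat_mult a b \<in> mats num"
  by (erule (1) mat_mult_mats) (auto intro: num_mult num_closed)

lemma mat_mult_assoc:
  assumes "a \<in> mats H" "b \<in> mats H'" "c \<in> mats H''"
  shows "mat_mult (mat_mult a b) c = mat_mult a (mat_mult b c)"
proof -
  obtain T where T: "finite T" "\<And>r c. a r c \<noteq> 0 \<Longrightarrow> r \<in> T \<and> c \<in> T" using mats_support[OF assms(1)] by blast
  obtain T' where T': "finite T'" "\<And>r s. c r s \<noteq> 0 \<Longrightarrow> r \<in> T' \<and> s \<in> T'" using mats_support[OF assms(3)] by blast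
  have "mat_mult (mat_mult a b) c r s = (\<Sum>k\<in>T'. (\<Sum>l\<in>T. a r l * b l k) * c k s)" for r s
    by (subst mat_mult_eq[of T']) (use T T' in \<open>auto intro!: sum.cong simp: mat_mult_eq[of T a]\<close>)
  moreover have "mat_mult a (mat_mult b c) r s = (\<Sum>l\<in>T. a r l * (\<Sum>k\<in>T'. b l k * c k s))" for r s
    by (subst mat_mult_eq[of T]) (use T T' in \<open>auto intro!: sum.cong simp: mat_mult_eq[of T' b]\<close>)
  ultimately show ?thesis
    by (intro ext) (simp add: sum_distrib_left sum_distrib_right mult.assoc, rule sum.swap)
qed

lemma mat_mult_add_right:
  assumes "a \<in> mats H"
  shows "mat_mult a (\<lambda>r c. b r c + b' r c) = (\<lambda>r c. mat_mult a b r c + mat_mult a b' r c)"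
proof -
  obtain T where T: "finite T" "\<And>r c. a r c \<noteq> 0 \<Longrightarrow> r \<in> T \<and> c \<in> T" using mats_support[OF assms] by blast
  then show ?thesis
    by (intro ext) (simp add: mat_mult_eq[of T a] distrib_left sum.distrib)
qed

lemma mat_mult_add_left:
  assumes "b \<in> mats H"
  shows "mat_mult (\<lambda>r c. a r c + a' r c) b = (\<lambda>r c. mat_mult a b r c + mat_mult a' b r c)"
proof -
  obtain T where T: "finite T" "\<And>r c. b r c \<noteq> 0 \<Longrightarrow> r \<in> T \<and> c \<in> T" using mats_support[OF assms] by blast
  then show ?thesis
    by (intro ext) (simp add: mat_mult_eq[of T _ _ b] distrib_right sum.distrib)
qed

text \<open>
  The product in \<open>\<CC>\<close> sums over the positions where the cosets are nonzero, the product of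
  representatives over those where the representatives are nonzero. The terms that make the
  difference have a factor in a denominator, so they lie in the denominator of the result.
\<close>

lemma CC_mult_coset_mat:
  assumes "a \<in> mats num" "b \<in> mats num"
  shows "CC_mult I N (coset_mat a) (coset_mat b) = coset_mat (mat_mult a b)"
proof (intro ext)
  fix r c
  obtain T where T: "finite T" "\<And>r c. a r c \<noteq> 0 \<Longrightarrow> r \<in> T \<and> c \<in> T" using mats_support[OF assms(1)] by blast
  let ?U = "{s. coset_mat a r s \<noteq> den r s \<and> coset_mat b s c \<noteq> den s c}"
  have "?U \<subseteq> T"
    by (auto simp: coset_mat_eq_den_iff) (metis T(2) add_subgroupD(1)[OF den_closed])
  have "CC_mult I N (coset_mat a) (coset_mat b) r c = (\<Sum>s\<in>?U. a r s * b s c) +o den r c"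
    unfolding CC_mult_def using assms
    by (intro sum_coset) (simp add: coset_mat_def coset_mult mats_mem)
  also have "\<dots> = (\<Sum>s\<in>T. a r s * b s c) +o den r c"
  proof (subst coset_eq_iff[OF den_closed])
    have "(\<Sum>s\<in>T - ?U. a r s * b s c) \<in> den r c"
      using assms
      by (intro add_subgroup_sum den_closed) (auto simp: coset_mat_eq_den_iff intro: den_num_mult num_den_mult mats_mem)
    then have "- (\<Sum>s\<in>T - ?U. a r s * b s c) \<in> den r c" by (rule add_subgroupD(3)[OF den_closed])
    then show "(\<Sum>s\<in>?U. a r s * b s c) - (\<Sum>s\<in>T. a r s * b s c) \<in> den r c"
      using sum.subset_diff[OF \<open>?U \<subseteq> T\<close> T(1), of "\<lambda>s. a r s * b s c"] by simp
  qed
  also have "\<dots> = coset_mat (mat_mult a b) r c"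
    using T by (simp add: coset_mat_def mat_mult_eq[of T])
  finally show "CC_mult I N (coset_mat a) (coset_mat b) r c = coset_mat (mat_mult a b) r c" .
qed

section \<open>The subalgebras and the matrix units\<close>

text \<open>
  The positions where the left factor lives. To the right of them the entries of \<open>\<CC>\<close> are zero by
  definition.
\<close>

definition strip :: "(int \<times> int) set" where
  "strip = {(r, s). r \<le> s \<and> s < r + int N}"

text \<open>
  Representatives for the left factor. There is no upper bound on \<open>c - r\<close>, which makes the shape
  closed under multiplication; beyond the strip all representatives stand for zero.
\<close>

definition T_shape :: "int \<Rightarrow> int \<Rightarrow> 'a set" where
  "T_shape r c = (if r \<le> c then G 0 else {0})"

definition B_shape :: "int \<Rightarrow> int \<Rightarrow> 'a set" where
  "B_shape r c = (if c \<le> r then G (nat (r - c)) else {0})"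

definition row_shape :: "int \<Rightarrow> int \<Rightarrow> int \<Rightarrow> 'a set" where
  "row_shape s r c = (if r = s then B_shape r c else {0})"

definition diag_shape :: "int \<Rightarrow> int \<Rightarrow> 'a set" where
  "diag_shape r c = (if r = c then G 0 else {0})"

lemma shape_closed:
  "add_subgroup (T_shape r c)" "add_subgroup (B_shape r c)" "add_subgroup (row_shape s r c)" "add_subgroup (diag_shape r c)"
  by (simp_all add: T_shape_def B_shape_def row_shape_def diag_shape_def G_closed add_subgroup_zero)

lemma shape_num:
  "T_shape r c \<subseteq> num r c" "B_shape r c \<subseteq> num r c" "row_shape s r c \<subseteq> num r c" "diag_shape r c \<subseteq> num r c"
  using add_subgroupD(1)[OF num_closed]
  by (auto simp: T_shape_def B_shape_def row_shape_def diag_shape_def num_eq I_0 intro: G_I add_subgroupD(1)[OF I_closed])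

lemmas shape_zero = shape_closed[THEN add_subgroupD(1)]

lemma shape_mats:
  "m \<in> mats T_shape \<Longrightarrow> m \<in> mats num" "m \<in> mats B_shape \<Longrightarrow> m \<in> mats num"
  "m \<in> mats (row_shape s) \<Longrightarrow> m \<in> mats num" "m \<in> mats (row_shape s) \<Longrightarrow> m \<in> mats B_shape"
  "m \<in> mats diag_shape \<Longrightarrow> m \<in> mats num" "m \<in> mats diag_shape \<Longrightarrow> m \<in> mats B_shape"
  "m \<in> mats diag_shape \<Longrightarrow> m \<in> mats T_shape"
proof -
  have "row_shape s r c \<subseteq> B_shape r c" "diag_shape r c \<subseteq> B_shape r c" "diag_shape r c \<subseteq> T_shape r c" for r c
    using shape_zero(2)[of r c] add_subgroupD(1)[OF G_closed, of 0]
    by (auto simp: row_shape_def diag_shape_def T_shape_def) (auto simp: B_shape_def)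
  note incl = shape_num this
  show "m \<in> mats T_shape \<Longrightarrow> m \<in> mats num" "m \<in> mats B_shape \<Longrightarrow> m \<in> mats num"
    "m \<in> mats (row_shape s) \<Longrightarrow> m \<in> mats num" "m \<in> mats (row_shape s) \<Longrightarrow> m \<in> mats B_shape"
    "m \<in> mats diag_shape \<Longrightarrow> m \<in> mats num" "m \<in> mats diag_shape \<Longrightarrow> m \<in> mats B_shape"
    "m \<in> mats diag_shape \<Longrightarrow> m \<in> mats T_shape"
    by (erule mats_mono; rule incl)+
qed

lemma if_image: "(if b then f ` A else {f x}) = f ` (if b then A else {x})"
  by simp

text \<open>
  Representatives supported in the strip are needed to expand an element of the left factor in the
  matrix units there; representatives of the shape \<open>T_shape\<close> are needed for products.
\<close>

lemma B_tilde_strip: "B_tilde I N G = coset_mat ` mats (\<lambda>r c. if (r, c) \<in> strip then G 0 else {0})"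
proof -
  have "B_tilde I N G = {M \<in> carrier (CC I N). \<forall>r c. M r c \<in> (\<lambda>x. x +o den r c) ` (if (r, c) \<in> strip then G 0 else {0})}"
    unfolding B_tilde_def if_image[symmetric] by (intro Collect_cong conj_cong all_cong1 refl) (auto simp: strip_def)
  also have "\<dots> = coset_mat ` mats (\<lambda>r c. if (r, c) \<in> strip then G 0 else {0})"
    by (rule coset_mat_mats) (auto simp: strip_def num_eq I_0 add_subgroupD(1)[OF G_closed] add_subgroupD(1)[OF I_closed])
  finally show ?thesis .
qed

lemma B_tilde_eq: "B_tilde I N G = coset_mat ` mats T_shape"
proof -
  have "B_tilde I N G = {M \<in> carrier (CC I N). \<forall>r c. M r c \<in> (\<lambda>x. x +o den r c) ` T_shape r c}"
    unfolding B_tilde_def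
  proof (intro Collect_cong conj_cong all_cong1 refl arg_cong2[where f = "(\<in>)"])
    fix r c
    show "(if 0 \<le> c - r \<and> c - r \<le> int N - 1 then (\<lambda>x. x +o den r c) ` G 0 else {den r c}) =
        (\<lambda>x. x +o den r c) ` T_shape r c"
    proof (cases "c - r \<ge> int N")
      \<comment> \<open>Right of the strip the denominator is everything, so there is only the zero coset.\<close>
      case True
      then have "x +o den r c = den r c" for x
        using coset_eq_self_iff[OF den_closed, of x r c] by (simp add: den_eq I_0)
      then show ?thesis
        using True add_subgroupD(1)[OF G_closed, of 0] by (auto simp: T_shape_def)
    qed (auto simp: T_shape_def)
  qed
  also have "\<dots> = coset_mat ` mats T_shape"
    by (rule coset_mat_mats) (simp_all add: shape_zero shape_num)
  finally show ?thesis .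
qed

lemma S_alg_eq: "S_alg I N G = coset_mat ` mats diag_shape"
proof -
  have "S_alg I N G = {M \<in> carrier (CC I N). \<forall>r c. M r c \<in> (\<lambda>x. x +o den r c) ` diag_shape r c}"
    unfolding S_alg_def diag_shape_def if_image[symmetric] by simp
  also have "\<dots> = coset_mat ` mats diag_shape"
    by (rule coset_mat_mats) (simp_all add: shape_zero shape_num)
  finally show ?thesis .
qed

lemma B_alg_eq: "B_alg I N G = coset_mat ` mats B_shape"
proof -
  have "B_alg I N G = {M \<in> carrier (CC I N). \<forall>r c. M r c \<in> (\<lambda>x. x +o den r c) ` B_shape r c}"
    unfolding B_alg_def B_shape_def if_image[symmetric] by simp
  also have "\<dots> = coset_mat ` mats B_shape"
    by (rule coset_mat_mats) (simp_all add: shape_zero shape_num)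
  finally show ?thesis .
qed

lemma T_shape_mult: "\<lbrakk>x \<in> T_shape r s; y \<in> T_shape s c\<rbrakk> \<Longrightarrow> x * y \<in> T_shape r c"
  using G_mult[of x 0 y 0] add_subgroupD(1)[OF G_closed, of 0] by (auto simp: T_shape_def split: if_splits)

lemma B_shape_mult: "\<lbrakk>x \<in> B_shape r s; y \<in> B_shape s c\<rbrakk> \<Longrightarrow> x * y \<in> B_shape r c"
  using G_mult[of x "nat (r - s)" y "nat (s - c)"] add_subgroupD(1)[OF G_closed]
  by (auto simp: B_shape_def nat_add_distrib[symmetric] split: if_splits)

lemma mat_mult_T_shape: "\<lbrakk>a \<in> mats T_shape; b \<in> mats T_shape\<rbrakk> \<Longrightarrow> mat_mult a b \<in> mats T_shape"
  by (erule (1) mat_mult_mats) (auto intro: T_shape_mult shape_closed)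

lemma mat_mult_B_shape: "\<lbrakk>a \<in> mats B_shape; b \<in> mats B_shape\<rbrakk> \<Longrightarrow> mat_mult a b \<in> mats B_shape"
  by (erule (1) mat_mult_mats) (auto intro: B_shape_mult shape_closed)

definition single_entry :: "int \<Rightarrow> int \<Rightarrow> 'a \<Rightarrow> int \<Rightarrow> int \<Rightarrow> 'a" where
  "single_entry r s a r' c = (if r' = r \<and> c = s then a else 0)"

lemma single_entry_mats: "a \<in> H r s \<Longrightarrow> (\<And>r c. 0 \<in> H r c) \<Longrightarrow> single_entry r s a \<in> mats H"
  by (rule matsI[where T = "{r, s}"]) (auto simp: single_entry_def split: if_splits)

lemma mat_mult_single_entry: "mat_mult (single_entry r s a) b r' c = (if r' = r then a * b s c else 0)"
  by (subst mat_mult_eq[of "{s}"]) (auto simp: single_entry_def split: if_splits)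

abbreviation "unit_at j \<equiv> single_entry (fst j) (snd j) 1"

lemma unit_at_T_shape: "j \<in> strip \<Longrightarrow> unit_at j \<in> mats T_shape"
  by (rule single_entry_mats) (auto simp: strip_def T_shape_def one_G add_subgroupD(1)[OF G_closed])

lemma single_entry_diag: "a \<in> G 0 \<Longrightarrow> single_entry s s a \<in> mats diag_shape"
  by (rule single_entry_mats) (auto simp: diag_shape_def add_subgroupD(1)[OF G_closed])

lemma mat_mult_single_entry_row:
  assumes "a \<in> G 0" "b \<in> mats B_shape"
  shows "mat_mult (single_entry s s a) b \<in> mats (row_shape s)"
proof -
  have "mat_mult (single_entry s s a) b \<in> mats B_shape"
    by (intro mat_mult_B_shape assms shape_mats(6)[OF single_entry_diag])
  then show ?thesis
    using mats_mem[of "mat_mult (single_entry s s a) b" B_shape s] by (auto simp: mats_def row_shape_def mat_mult_single_entry)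
qed

lemma sum_row:
  assumes "finite P"
  shows "(\<Sum>j\<in>P. if r = fst j then g j else 0) = (\<Sum>s | (r, s) \<in> P. g (r, s))"
proof -
  have "(\<Sum>j\<in>P. if r = fst j then g j else 0) = (\<Sum>j\<in>{j\<in>P. r = fst j}. g j)"
    using assms by (simp add: sum.inter_filter)
  also have "\<dots> = (\<Sum>s | (r, s) \<in> P. g (r, s))"
    by (rule sum.reindex_bij_witness[where i = "\<lambda>s. (r, s)" and j = snd]) auto
  finally show ?thesis .
qed

lemma finite_row: "finite P \<Longrightarrow> finite {s. (r, s) \<in> P}"
  by (rule finite_subset[of _ "snd ` P"]) force+

text \<open>
  Multiplication by the matrix unit at \<open>(r, s)\<close> moves row \<open>s\<close> to row \<open>r\<close>. So row \<open>r\<close> of a sum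
  of such products collects one row for each \<open>s\<close>.
\<close>

lemma unit_rows:
  assumes "finite P"
  shows "(\<Sum>j\<in>P. mat_mult (unit_at j) (\<eta> j) r c) = (\<Sum>s | (r, s) \<in> P. \<eta> (r, s) s c)"
  by (simp add: mat_mult_single_entry sum_row[OF assms])

lemma B_tilde_span:
  assumes "x \<in> B_tilde I N G"
  obtains P m where "finite P" "P \<subseteq> strip" "\<forall>r s. m r s \<in> G 0"
    "x = finprod (CC I N) (\<lambda>j. CC_mult I N (coset_mat (unit_at j)) (coset_mat (single_entry (snd j) (snd j) (m (fst j) (snd j))))) P"
proof -
  obtain m where m: "m \<in> mats (\<lambda>r c. if (r, c) \<in> strip then G 0 else {0})" and x: "x = coset_mat m"
    using assms unfolding B_tilde_strip by blast
  define P where "P = {(r, s). m r s \<noteq> 0}"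
  have P: "finite P" "P \<subseteq> strip" and mG: "m r s \<in> G 0" for r s
    using m add_subgroupD(1)[OF G_closed, of 0]
    by (auto simp: P_def mats_def split: if_splits) (metis singletonD)+
  have mats: "unit_at j \<in> mats num" "single_entry (snd j) (snd j) (m (fst j) (snd j)) \<in> mats num" if "j \<in> P" for j
    using that P(2) by (auto intro!: shape_mats(1)[OF unit_at_T_shape] shape_mats(5)[OF single_entry_diag] mG)
  have "finprod (CC I N) (\<lambda>j. CC_mult I N (coset_mat (unit_at j)) (coset_mat (single_entry (snd j) (snd j) (m (fst j) (snd j))))) P =
      finprod (CC I N) (\<lambda>j. coset_mat (mat_mult (unit_at j) (single_entry (snd j) (snd j) (m (fst j) (snd j))))) P"
    using CC_comm_group mats mat_mult_num
    by (intro comm_monoid.finprod_cong' comm_group.axioms) (auto simp: CC_mult_coset_mat carrier_CC)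
  also have "\<dots> = coset_mat (\<lambda>r c. \<Sum>j\<in>P. mat_mult (unit_at j) (single_entry (snd j) (snd j) (m (fst j) (snd j))) r c)"
    by (rule finprod_coset_mat) (auto intro: mats mat_mult_num P)
  also have "(\<lambda>r c. \<Sum>j\<in>P. mat_mult (unit_at j) (single_entry (snd j) (snd j) (m (fst j) (snd j))) r c) = m"
  proof (intro ext)
    fix r c
    have "(\<Sum>j\<in>P. mat_mult (unit_at j) (single_entry (snd j) (snd j) (m (fst j) (snd j))) r c) =
        (\<Sum>s | (r, s) \<in> P. if c = s then m r s else 0)"
      by (subst unit_rows[OF P(1)]) (simp add: single_entry_def)
    also have "\<dots> = m r c"
      using finite_row[OF P(1), of r] by (simp add: P_def sum.delta)
    finally show "(\<Sum>j\<in>P. mat_mult (unit_at j) (single_entry (snd j) (snd j) (m (fst j) (snd j))) r c) = m r c" .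
  qed
  finally show thesis using that[of P m] P mG x by simp
qed

text \<open>
  In column \<open>c\<close> of row \<open>r\<close> the summand that comes from \<open>(r, s)\<close> has degree \<open>s - c\<close>, so that the
  summands are separated by their degrees; and \<open>s - c < N + r - c\<close> by definition of the strip, so that
  none of them is lost in the denominator.
\<close>

lemma rows_independent:
  assumes P: "finite P" "P \<subseteq> strip" and \<eta>: "\<And>j. j \<in> P \<Longrightarrow> \<eta> j \<in> mats (row_shape (snd j))"
    and zero: "\<And>r c. (\<Sum>j\<in>P. mat_mult (unit_at j) (\<eta> j) r c) \<in> den r c" and j: "j \<in> P"
  shows "\<eta> j = (\<lambda>r c. 0)"
proof (intro ext)
  fix r' c
  obtain r s where rs: "j = (r, s)" by force
  have "\<eta> j s c = 0"
  proof (cases "c \<le> s")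
    case True
    \<comment> \<open>Project the vanishing sum in position \<open>(r, c)\<close> to degree \<open>s - c\<close>: only the term of \<open>s\<close> survives.\<close>
    have mem: "\<eta> (r, s') s' c \<in> B_shape s' c" if "(r, s') \<in> P" for s'
      using mats_mem[OF \<eta>[OF that], of s' c] by (simp add: row_shape_def)
    have "int (nat (s - c)) < int N + r - c"
      using True P(2) j rs by (auto simp: strip_def)
    then have "0 = component (nat (s - c)) (\<Sum>s' | (r, s') \<in> P. \<eta> (r, s') s' c)"
      using zero[of r c] unfolding unit_rows[OF P(1)] den_iff by simp
    also have "\<dots> = (\<Sum>s' | (r, s') \<in> P. if s' = s then \<eta> (r, s) s c else 0)"
      unfolding component_sum
    proof (intro sum.cong refl)
      fix s' assume "s' \<in> {s'. (r, s') \<in> P}"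
      then have "c \<le> s' \<Longrightarrow> \<eta> (r, s') s' c \<in> G (nat (s' - c))" "\<not> c \<le> s' \<Longrightarrow> \<eta> (r, s') s' c = 0"
        using mem[of s'] by (simp_all add: B_shape_def)
      then show "component (nat (s - c)) (\<eta> (r, s') s' c) = (if s' = s then \<eta> (r, s) s c else 0)"
        using True by (cases "c \<le> s'") (simp_all add: component_homogeneous[of _ "nat (s' - c)"] nat_eq_iff2)
    qed
    also have "\<dots> = \<eta> j s c"
      using finite_row[OF P(1), of r] j by (simp add: rs sum.delta')
    finally show ?thesis by simp
  next
    case False
    then show ?thesis
      using mats_mem[OF \<eta>[OF j], of s c] by (simp add: rs row_shape_def B_shape_def)
  qed
  then show "\<eta> j r' c = 0"
    using mats_mem[OF \<eta>[OF j], of r' c] by (cases "r' = s") (auto simp: rs row_shape_def)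
qed

text \<open>
  The summand with index \<open>j = (r, s)\<close> of the matrix \<open>m\<close>: row \<open>r\<close> of \<open>m\<close>, moved to row \<open>s\<close>, with the
  entry in column \<open>c\<close> replaced by its component of degree \<open>s - c\<close>.
\<close>

definition row_part :: "(int \<Rightarrow> int \<Rightarrow> 'a) \<Rightarrow> int \<times> int \<Rightarrow> int \<Rightarrow> int \<Rightarrow> 'a" where
  "row_part m j s c = (if s = snd j \<and> c \<le> s then component (nat (s - c)) (m (fst j) c) else 0)"

lemma row_part_mats:
  assumes "m \<in> mats num"
  shows "row_part m j \<in> mats (row_shape (snd j))"
proof -
  obtain T where T: "finite T" "\<And>r c. m r c \<noteq> 0 \<Longrightarrow> r \<in> T \<and> c \<in> T" using mats_support[OF assms] by blast
  show ?thesis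
  proof (rule matsI[where T = "insert (snd j) T"])
    show "row_part m j r c \<in> row_shape (snd j) r c" for r c
      using component_G by (auto simp: row_part_def row_shape_def B_shape_def intro: add_subgroupD(1)[OF G_closed])
    show "r \<in> insert (snd j) T \<and> c \<in> insert (snd j) T" if "row_part m j r c \<noteq> 0" for r c
      using that T(2)[of "fst j" c] by (cases "m (fst j) c = 0") (auto simp: row_part_def split: if_splits)
  qed (use T in simp)
qed

definition strip_rows :: "int set \<Rightarrow> (int \<times> int) set" where
  "strip_rows T = {j \<in> strip. fst j \<in> T}"

lemma strip_rows: "finite T \<Longrightarrow> finite (strip_rows T)" "strip_rows T \<subseteq> strip"
proof -
  assume "finite T"
  moreover have "strip_rows T \<subseteq> Sigma T (\<lambda>r. {r..r + int N})" by (auto simp: strip_rows_def strip_def)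
  ultimately show "finite (strip_rows T)" by (auto intro: finite_subset)
qed (auto simp: strip_rows_def)

lemma strip_rows_row: "{s. (r, s) \<in> strip_rows T} = (if r \<in> T then {r..<r + int N} else {})"
  by (auto simp: strip_rows_def strip_def)

text \<open>
  Summation over \<open>s\<close> with \<open>r \<le> s < r + N\<close> recovers the components of degree \<open>i = s - c\<close> with
  \<open>r - c \<le> i < N + r - c\<close>. The lower ones vanish because the entry is in the numerator, and the
  higher ones lie in the denominator.
\<close>

lemma rows_span:
  assumes m: "m \<in> mats num" and T: "finite T" "\<And>r c. m r c \<noteq> 0 \<Longrightarrow> r \<in> T"
  shows "m r c - (\<Sum>j\<in>strip_rows T. mat_mult (unit_at j) (row_part m j) r c) \<in> den r c"
proof (cases "r \<in> T")
  case True
  have "component i (\<Sum>s = r..<r + int N. row_part m (r, s) s c) = component i (m r c)" if i: "int i < int N + r - c" for i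
  proof -
    have "component i (\<Sum>s = r..<r + int N. row_part m (r, s) s c) = (\<Sum>s = r..<r + int N. if s = c + int i then component i (m r c) else 0)"
      unfolding component_sum
      by (intro sum.cong refl) (auto simp: row_part_def component_homogeneous[OF component_G])
    also have "\<dots> = (if r \<le> c + int i then component i (m r c) else 0)"
      using i by (simp add: sum.delta')
    also have "\<dots> = component i (m r c)"
      using mats_mem[OF m, of r c] by (auto simp: num_iff)
    finally show ?thesis .
  qed
  then show ?thesis
    using True by (simp add: unit_rows strip_rows(1) T(1) strip_rows_row den_iff component_diff)
next
  case False
  then have "m r c = 0" using T(2) by blast
  with False show ?thesis
    by (auto simp: unit_rows strip_rows(1) T(1) strip_rows_row add_subgroupD(1)[OF den_closed])
qed

lemma CC_mult_closed: "\<lbrakk>a \<in> carrier (CC I N); b \<in> carrier (CC I N)\<rbrakk> \<Longrightarrow> CC_mult I N a b \<in> carrier (CC I N)"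
  by (auto simp: carrier_CC CC_mult_coset_mat intro: mat_mult_num)

lemma CC_mult_add_right:
  "\<lbrakk>a \<in> carrier (CC I N); b \<in> carrier (CC I N); c \<in> carrier (CC I N)\<rbrakk> \<Longrightarrow>
    CC_mult I N a (b \<otimes>\<^bsub>CC I N\<^esub> c) = CC_mult I N a b \<otimes>\<^bsub>CC I N\<^esub> CC_mult I N a c"
  by (auto simp: carrier_CC CC_mult_coset_mat coset_mat_add mats_add num_closed mat_mult_add_right)

lemma CC_mult_add_left:
  "\<lbrakk>a \<in> carrier (CC I N); b \<in> carrier (CC I N); c \<in> carrier (CC I N)\<rbrakk> \<Longrightarrow>
    CC_mult I N (a \<otimes>\<^bsub>CC I N\<^esub> b) c = CC_mult I N a c \<otimes>\<^bsub>CC I N\<^esub> CC_mult I N b c"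
  by (auto simp: carrier_CC CC_mult_coset_mat coset_mat_add mats_add num_closed mat_mult_add_left)

lemma CC_mult_assoc:
  "\<lbrakk>a \<in> carrier (CC I N); b \<in> carrier (CC I N); c \<in> carrier (CC I N)\<rbrakk> \<Longrightarrow>
    CC_mult I N (CC_mult I N a b) c = CC_mult I N a (CC_mult I N b c)"
  by (auto simp: carrier_CC CC_mult_coset_mat mat_mult_num mat_mult_assoc)

section \<open>The factorization of the matrix algebra\<close>

theorem CC_factorization:
  "mult_induces_iso (CC I N) (CC_mult I N) (B_tilde I N G) (S_alg I N G) (B_alg I N G)"
proof -
  interpret CC: comm_group "CC I N" by (rule CC_comm_group)
  interpret tensor_factorization "CC I N" "CC_mult I N" "B_tilde I N G" "S_alg I N G" "B_alg I N G"
    strip "\<lambda>j. coset_mat (unit_at j)" "\<lambda>j. coset_mat ` mats (row_shape (snd j))"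
  proof (intro tensor_factorization.intro tensor_factorization_axioms.intro CC_comm_group)
    show "subgroup (B_tilde I N G) (CC I N)" "subgroup (B_alg I N G) (CC I N)"
      unfolding B_tilde_eq B_alg_eq by (rule subgroup_coset_mat_mats; simp add: shape_closed shape_num)+
    show "CC_mult I N x x' \<in> B_tilde I N G" if "x \<in> B_tilde I N G" "x' \<in> B_tilde I N G" for x x'
      using that by (auto simp: B_tilde_eq CC_mult_coset_mat shape_mats mat_mult_T_shape)
    show "CC_mult I N x x' \<in> B_alg I N G" if "x \<in> B_alg I N G" "x' \<in> B_alg I N G" for x x'
      using that by (auto simp: B_alg_eq CC_mult_coset_mat shape_mats mat_mult_B_shape)
    show "S_alg I N G \<subseteq> B_tilde I N G" "S_alg I N G \<subseteq> B_alg I N G"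
      by (auto simp: S_alg_eq B_tilde_eq B_alg_eq shape_mats)
    show "coset_mat (unit_at j) \<in> B_tilde I N G" if "j \<in> strip" for j
      using that unfolding B_tilde_eq by (intro imageI unit_at_T_shape)
    show "subgroup (coset_mat ` mats (row_shape (snd j))) (CC I N)" for j
      by (rule subgroup_coset_mat_mats; simp add: shape_closed shape_num)
    show "coset_mat ` mats (row_shape (snd j)) \<subseteq> B_alg I N G" for j
      by (auto simp: B_alg_eq shape_mats(4))
    show "CC_mult I N (CC_mult I N x b) c = CC_mult I N x (CC_mult I N b c)"
      if "x \<in> B_tilde I N G" "b \<in> carrier (CC I N)" "c \<in> carrier (CC I N)" for x b c
      using that by (intro CC_mult_assoc) (auto simp: B_tilde_def)
    show "\<exists>P \<sigma>. finite P \<and> P \<subseteq> strip \<and>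
        (\<forall>j\<in>P. \<sigma> j \<in> S_alg I N G \<and> (\<forall>y\<in>B_alg I N G. CC_mult I N (\<sigma> j) y \<in> coset_mat ` mats (row_shape (snd j)))) \<and>
        x = finprod (CC I N) (\<lambda>j. CC_mult I N (coset_mat (unit_at j)) (\<sigma> j)) P"
      if xT: "x \<in> B_tilde I N G" for x
    proof -
      obtain P m where P: "finite P" "P \<subseteq> strip" and m: "\<forall>r s. m r s \<in> G 0"
        and x: "x = finprod (CC I N) (\<lambda>j. CC_mult I N (coset_mat (unit_at j)) (coset_mat (single_entry (snd j) (snd j) (m (fst j) (snd j))))) P"
        using B_tilde_span[OF xT] by blast
      have "CC_mult I N (coset_mat (single_entry (snd j) (snd j) (m (fst j) (snd j)))) y \<in> coset_mat ` mats (row_shape (snd j))"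
        if "y \<in> B_alg I N G" for j y
        using that m by (auto simp: B_alg_eq CC_mult_coset_mat shape_mats single_entry_diag intro!: imageI mat_mult_single_entry_row)
      then show ?thesis
        using P m x by (intro exI[of _ P] exI[of _ "\<lambda>j. coset_mat (single_entry (snd j) (snd j) (m (fst j) (snd j)))"])
          (auto simp: S_alg_eq single_entry_diag)
    qed
    show "\<exists>P y. finite P \<and> P \<subseteq> strip \<and> (\<forall>j\<in>P. y j \<in> coset_mat ` mats (row_shape (snd j))) \<and>
        z = finprod (CC I N) (\<lambda>j. CC_mult I N (coset_mat (unit_at j)) (y j)) P"
      if zC: "z \<in> carrier (CC I N)" for z
    proof -
      obtain m where m: "m \<in> mats num" and z: "z = coset_mat m" using zC by (auto simp: carrier_CC)
      obtain T where T: "finite T" "\<And>r c. m r c \<noteq> 0 \<Longrightarrow> r \<in> T \<and> c \<in> T" using mats_support[OF m] by blast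
      have mats: "unit_at j \<in> mats num" "row_part m j \<in> mats num" if "j \<in> strip_rows T" for j
        using that strip_rows(2) m by (auto intro!: shape_mats(1)[OF unit_at_T_shape] shape_mats(3)[OF row_part_mats])
      have "finprod (CC I N) (\<lambda>j. CC_mult I N (coset_mat (unit_at j)) (coset_mat (row_part m j))) (strip_rows T) =
          finprod (CC I N) (\<lambda>j. coset_mat (mat_mult (unit_at j) (row_part m j))) (strip_rows T)"
        using mats mat_mult_num by (intro CC.finprod_cong') (auto simp: CC_mult_coset_mat carrier_CC)
      also have "\<dots> = coset_mat (\<lambda>r c. \<Sum>j\<in>strip_rows T. mat_mult (unit_at j) (row_part m j) r c)"
        by (rule finprod_coset_mat) (auto intro: mats mat_mult_num strip_rows T)
      also have "\<dots> = z"
        unfolding z eq_commute[of _ "coset_mat m"] coset_mat_eq_iff using rows_span[OF m T(1)] T(2) by blast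
      finally show ?thesis
        using strip_rows T(1) row_part_mats[OF m]
        by (intro exI[of _ "strip_rows T"] exI[of _ "\<lambda>j. coset_mat (row_part m j)"]) auto
    qed
    show "y j = \<one>\<^bsub>CC I N\<^esub>"
      if P: "finite P" "P \<subseteq> strip" and y: "\<forall>j\<in>P. y j \<in> coset_mat ` mats (row_shape (snd j))"
        and zero: "finprod (CC I N) (\<lambda>j. CC_mult I N (coset_mat (unit_at j)) (y j)) P = \<one>\<^bsub>CC I N\<^esub>" and j: "j \<in> P"
      for P y j
    proof -
      have "\<forall>j\<in>P. \<exists>m. m \<in> mats (row_shape (snd j)) \<and> y j = coset_mat m"
        using y by blast
      from bchoice[OF this] obtain \<eta> where \<eta>: "\<forall>j\<in>P. \<eta> j \<in> mats (row_shape (snd j)) \<and> y j = coset_mat (\<eta> j)"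
        by blast
      have mats: "unit_at j \<in> mats num" "\<eta> j \<in> mats num" if "j \<in> P" for j
        using that P(2) \<eta> by (auto intro!: shape_mats(1)[OF unit_at_T_shape] intro: shape_mats(3))
      have "finprod (CC I N) (\<lambda>j. CC_mult I N (coset_mat (unit_at j)) (y j)) P =
          finprod (CC I N) (\<lambda>j. coset_mat (mat_mult (unit_at j) (\<eta> j))) P"
        using mats mat_mult_num \<eta> by (intro CC.finprod_cong') (auto simp: CC_mult_coset_mat carrier_CC)
      also have "\<dots> = coset_mat (\<lambda>r c. \<Sum>j\<in>P. mat_mult (unit_at j) (\<eta> j) r c)"
        by (rule finprod_coset_mat) (auto intro: mats mat_mult_num P)
      finally have "coset_mat (\<lambda>r c. \<Sum>j\<in>P. mat_mult (unit_at j) (\<eta> j) r c) = coset_mat (\<lambda>r c. 0)"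
        using zero by (simp add: coset_mat_zero)
      then have "\<eta> j = (\<lambda>r c. 0)"
        using \<eta> P j by (intro rows_independent[of P \<eta>]) (auto simp: coset_mat_eq_iff)
      then show ?thesis using \<eta> j by (simp add: coset_mat_zero)
    qed
  qed (auto intro: CC_mult_closed CC_mult_add_left CC_mult_add_right)
  show ?thesis by (rule factorization)
qed

section \<open>The dual bimodule\<close>

abbreviation "dual \<equiv> CC_dual scale I N"

text \<open>
  The value of the functional in position \<open>(r, c)\<close> at the class of a representative. The functional
  lives on the transposed position.
\<close>

definition val :: "('a, 'k) dual_mat \<Rightarrow> int \<Rightarrow> int \<Rightarrow> 'a \<Rightarrow> 'k" where
  "val f r c x = f r c (x +o den c r)"

lemma entry_cases: "X \<in> entry I N r c \<Longrightarrow> \<exists>x\<in>num r c. X = x +o den r c"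
  unfolding entry_def by auto

lemma coset_entry: "x \<in> num r c \<Longrightarrow> x +o den r c \<in> entry I N r c"
  unfolding entry_def by auto

lemma dual_outside: "f \<in> carrier dual \<Longrightarrow> X \<notin> entry I N c r \<Longrightarrow> f r c X = 0"
  by (simp add: CC_dual_def entry_dual_def)

lemma dual_finite: "f \<in> carrier dual \<Longrightarrow> finite {(r, c). f r c \<noteq> (\<lambda>_. 0)}"
  by (simp add: CC_dual_def)

lemma scale_coset:
  assumes "x \<in> num r c"
  shows "scale a ` (x +o den r c) + den r c = scale a x +o den r c"
proof -
  have "scale a d \<in> den r c" if "d \<in> den r c" for d
    using that by (simp add: den_iff component_scale)
  then have "scale a ` (x +o den r c) \<subseteq> scale a x +o den r c"
    by (auto simp: elt_set_plus_def scale_right_distrib)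
  then have "scale a ` (x +o den r c) + den r c \<subseteq> (scale a x +o den r c) + (0 +o den r c)"
    by (intro set_plus_mono2) auto
  moreover have "x \<in> x +o den r c"
    using add_subgroupD(1)[OF den_closed] by (force simp: elt_set_plus_def)
  then have "scale a x +o den r c \<subseteq> scale a ` (x +o den r c) + den r c"
    by (intro set_plus_mono3) blast
  ultimately show ?thesis by (simp add: coset_add[OF den_closed] del: set_zero_plus)
qed

lemma num_scale: "x \<in> num r c \<Longrightarrow> scale a x \<in> num r c"
  by (simp add: num_iff component_scale)

lemma val_add:
  assumes "f \<in> carrier dual" "x \<in> num c r" "y \<in> num c r"
  shows "val f r c (x + y) = val f r c x + val f r c y"
proof -
  have "f r c ((x +o den c r) + (y +o den c r)) = f r c (x +o den c r) + f r c (y +o den c r)"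
    using assms coset_entry by (simp add: CC_dual_def entry_dual_def)
  then show ?thesis by (simp add: val_def coset_add[OF den_closed])
qed

lemma val_scale:
  assumes "f \<in> carrier dual" "x \<in> num c r"
  shows "val f r c (scale a x) = a * val f r c x"
proof -
  have "f r c (scale a ` (x +o den c r) + den c r) = a * f r c (x +o den c r)"
    using assms coset_entry by (simp add: CC_dual_def entry_dual_def)
  then show ?thesis using assms(2) by (simp add: val_def scale_coset)
qed

lemma val_zero: "f \<in> carrier dual \<Longrightarrow> val f r c 0 = 0"
  using val_add[of f 0 c r 0] add_subgroupD(1)[OF num_closed] by (metis add.right_neutral add_cancel_right_right)

lemma val_sum: "f \<in> carrier dual \<Longrightarrow> (\<And>i. i \<in> A \<Longrightarrow> x i \<in> num c r) \<Longrightarrow> val f r c (sum x A) = (\<Sum>i\<in>A. val f r c (x i))"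
  by (induction A rule: infinite_finite_induct)
     (simp_all add: val_zero val_add add_subgroup_sum[OF num_closed])

lemma val_den: "f \<in> carrier dual \<Longrightarrow> x \<in> den c r \<Longrightarrow> val f r c x = 0"
  using val_zero[of f r c] coset_eq_self_iff[OF den_closed, of x c r] by (simp add: val_def)

lemma val_null: "f r c = (\<lambda>_. 0) \<Longrightarrow> val f r c x = 0"
  by (simp add: val_def)

lemma dual_ext:
  assumes "\<And>r c X. X \<notin> entry I N c r \<Longrightarrow> f r c X = 0" "\<And>r c X. X \<notin> entry I N c r \<Longrightarrow> g r c X = 0"
    and "\<And>r c x. x \<in> num c r \<Longrightarrow> val f r c x = val g r c x"
  shows "f = g"
proof (intro ext)
  fix r c X
  show "f r c X = g r c X"
    using assms entry_cases[of X c r] by (cases "X \<in> entry I N c r") (auto simp: val_def)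
qed

lemma dualI:
  assumes "\<And>r c X. X \<notin> entry I N c r \<Longrightarrow> f r c X = 0"
    and "\<And>r c x y. \<lbrakk>x \<in> num c r; y \<in> num c r\<rbrakk> \<Longrightarrow> val f r c (x + y) = val f r c x + val f r c y"
    and "\<And>r c x a. x \<in> num c r \<Longrightarrow> val f r c (scale a x) = a * val f r c x"
    and "finite P" "\<And>r c. f r c \<noteq> (\<lambda>_. 0) \<Longrightarrow> (r, c) \<in> P"
  shows "f \<in> carrier dual"
proof -
  have "f r c \<in> entry_dual scale I N c r" for r c
    unfolding entry_dual_def
  proof (intro CollectI conjI allI ballI impI)
    show "f r c (X + Y) = f r c X + f r c Y" if "X \<in> entry I N c r" "Y \<in> entry I N c r" for X Y
      using entry_cases[OF that(1)] entry_cases[OF that(2)] assms(2)[of _ c r]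
      by (auto simp: val_def coset_add[OF den_closed])
    show "f r c (scale a ` X + den c r) = a * f r c X" if "X \<in> entry I N c r" for X a
      using entry_cases[OF that] assms(3)[of _ c r] by (auto simp: val_def scale_coset)
  qed (rule assms(1))
  moreover have "finite {(r, c). f r c \<noteq> (\<lambda>_. 0)}"
    by (rule finite_subset[OF _ assms(4)]) (use assms(5) in auto)
  ultimately show ?thesis by (simp add: CC_dual_def)
qed

lemma dual_mult: "(f \<otimes>\<^bsub>dual\<^esub> g) r c X = f r c X + g r c X"
  by (simp add: CC_dual_def)

lemma dual_one: "\<one>\<^bsub>dual\<^esub> = (\<lambda>r c X. 0)"
  by (simp add: CC_dual_def)

lemma val_mult: "val (f \<otimes>\<^bsub>dual\<^esub> g) r c x = val f r c x + val g r c x"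
  by (simp add: val_def dual_mult)

lemma dual_comm_group: "comm_group dual"
proof (rule comm_groupI)
  show "f \<otimes>\<^bsub>dual\<^esub> g \<in> carrier dual" if f: "f \<in> carrier dual" and g: "g \<in> carrier dual" for f g
  proof (rule dualI)
    show "finite ({(r, c). f r c \<noteq> (\<lambda>_. 0)} \<union> {(r, c). g r c \<noteq> (\<lambda>_. 0)})"
      using f g by (simp add: dual_finite)
  qed (use f g in \<open>auto simp: dual_mult val_mult val_add val_scale dual_outside algebra_simps fun_eq_iff\<close>)
  show "\<one>\<^bsub>dual\<^esub> \<in> carrier dual"
    by (rule dualI[where P = "{}"]) (auto simp: dual_one val_def)
  show "\<exists>g\<in>carrier dual. g \<otimes>\<^bsub>dual\<^esub> f = \<one>\<^bsub>dual\<^esub>" if f: "f \<in> carrier dual" for f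
  proof
    have val': "val (\<lambda>r c X. - f r c X) r c x = - val f r c x" for r c x by (simp add: val_def)
    show "(\<lambda>r c X. - f r c X) \<in> carrier dual"
    proof (rule dualI)
      show "finite {(r, c). f r c \<noteq> (\<lambda>_. 0)}" using f by (rule dual_finite)
    qed (use f in \<open>auto simp: val' val_add val_scale dual_outside fun_eq_iff\<close>)
  qed (simp add: dual_mult dual_one fun_eq_iff)
qed (simp_all add: CC_dual_def algebra_simps)

lemma finprod_dual:
  assumes "finite P" "\<And>j. j \<in> P \<Longrightarrow> g j \<in> carrier dual"
  shows "val (finprod dual g P) r c x = (\<Sum>j\<in>P. val (g j) r c x)"
proof -
  interpret D: comm_group dual by (rule dual_comm_group)
  show ?thesis
    using assms
    by (induction P rule: finite_induct) (simp_all add: val_mult Pi_iff, simp add: dual_one val_def)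
qed

text \<open>
  The sums that define the two actions, again in terms of representatives and over any sufficiently
  large index set.
\<close>

lemma val_lact:
  assumes a: "a \<in> mats num" and g: "g \<in> carrier dual" and x: "x \<in> num c r"
    and T: "finite T" "\<And>s. a r s \<noteq> 0 \<Longrightarrow> s \<in> T"
  shows "val (dual_lact I N (coset_mat a) g) r c x = (\<Sum>s\<in>T. val g s c (x * a r s))"
proof -
  let ?U = "{s. coset_mat a r s \<noteq> den r s \<and> g s c \<noteq> (\<lambda>_. 0)}"
  have "val (dual_lact I N (coset_mat a) g) r c x = (\<Sum>s\<in>?U. g s c ((x +o den c r) * coset_mat a r s + den c s))"
    using coset_entry[OF x] by (simp add: val_def dual_lact_def)
  also have "\<dots> = (\<Sum>s\<in>?U. val g s c (x * a r s))"
    using x a by (simp add: val_def coset_mat_def coset_mult mats_mem)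
  also have "\<dots> = (\<Sum>s\<in>T. val g s c (x * a r s))"
  proof (rule sum.mono_neutral_left)
    show "?U \<subseteq> T"
      by (auto simp: coset_mat_eq_den_iff) (metis T(2) add_subgroupD(1)[OF den_closed])
    show "\<forall>s\<in>T - ?U. val g s c (x * a r s) = 0"
      using x g by (auto simp: coset_mat_eq_den_iff val_null intro: val_den num_den_mult)
  qed (rule T)
  finally show ?thesis .
qed

lemma val_ract:
  assumes b: "b \<in> mats num" and f: "f \<in> carrier dual" and x: "x \<in> num c r"
    and T: "finite T" "\<And>s. b s c \<noteq> 0 \<Longrightarrow> s \<in> T"
  shows "val (dual_ract I N f (coset_mat b)) r c x = (\<Sum>s\<in>T. val f r s (b s c * x))"
proof -
  let ?U = "{s. f r s \<noteq> (\<lambda>_. 0) \<and> coset_mat b s c \<noteq> den s c}"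
  have "val (dual_ract I N f (coset_mat b)) r c x = (\<Sum>s\<in>?U. f r s (coset_mat b s c * (x +o den c r) + den s r))"
    using coset_entry[OF x] by (simp add: val_def dual_ract_def)
  also have "\<dots> = (\<Sum>s\<in>?U. val f r s (b s c * x))"
    using x b by (simp add: val_def coset_mat_def coset_mult mats_mem)
  also have "\<dots> = (\<Sum>s\<in>T. val f r s (b s c * x))"
  proof (rule sum.mono_neutral_left)
    show "?U \<subseteq> T"
      by (auto simp: coset_mat_eq_den_iff) (metis T(2) add_subgroupD(1)[OF den_closed])
    show "\<forall>s\<in>T - ?U. val f r s (b s c * x) = 0"
      using x f by (auto simp: coset_mat_eq_den_iff val_null intro: val_den den_num_mult)
  qed (rule T)
  finally show ?thesis .
qed

lemma lact_outside: "X \<notin> entry I N c r \<Longrightarrow> dual_lact I N a g r c X = 0"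
  and ract_outside: "X \<notin> entry I N c r \<Longrightarrow> dual_ract I N g a r c X = 0"
  by (simp_all add: dual_lact_def dual_ract_def)

lemma lact_closed:
  assumes a: "a \<in> mats num" and g: "g \<in> carrier dual"
  shows "dual_lact I N (coset_mat a) g \<in> carrier dual"
proof -
  obtain T where T: "finite T" "\<And>r c. a r c \<noteq> 0 \<Longrightarrow> r \<in> T \<and> c \<in> T" using mats_support[OF a] by blast
  note val = val_lact[OF a g _ T(1)]
  have mem: "x * a r s \<in> num c s" if "x \<in> num c r" for x r s c
    by (rule num_mult[OF that mats_mem[OF a]])
  show ?thesis
  proof (rule dualI)
    show "val (dual_lact I N (coset_mat a) g) r c (x + y) = val (dual_lact I N (coset_mat a) g) r c x + val (dual_lact I N (coset_mat a) g) r c y"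
      if "x \<in> num c r" "y \<in> num c r" for r c x y
      using that T g by (simp add: val add_subgroupD num_closed distrib_right val_add mem sum.distrib)
    show "val (dual_lact I N (coset_mat a) g) r c (scale k x) = k * val (dual_lact I N (coset_mat a) g) r c x"
      if "x \<in> num c r" for r c x k
      using that T g by (simp add: val num_scale val_scale mem sum_distrib_left flip: scale_mult_left)
    show "finite (T \<times> snd ` {(r, c). g r c \<noteq> (\<lambda>_. 0)})"
      using T dual_finite[OF g] by simp
    show "(r, c) \<in> T \<times> snd ` {(r, c). g r c \<noteq> (\<lambda>_. 0)}" if ne: "dual_lact I N (coset_mat a) g r c \<noteq> (\<lambda>_. 0)" for r c
    proof -
      obtain X where "dual_lact I N (coset_mat a) g r c X \<noteq> 0" using ne by (auto simp: fun_eq_iff)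
      then have "{s. coset_mat a r s \<noteq> den r s \<and> g s c \<noteq> (\<lambda>_. 0)} \<noteq> {}"
        by (auto simp: dual_lact_def simp del: Collect_empty_eq split: if_splits)
      then obtain s where "coset_mat a r s \<noteq> den r s" "g s c \<noteq> (\<lambda>_. 0)" by blast
      moreover from this(1) have "a r s \<noteq> 0" by (auto simp: coset_mat_eq_den_iff add_subgroupD(1)[OF den_closed])
      ultimately show ?thesis using T(2) by force
    qed
  qed (rule lact_outside)
qed

lemma ract_closed:
  assumes b: "b \<in> mats num" and f: "f \<in> carrier dual"
  shows "dual_ract I N f (coset_mat b) \<in> carrier dual"
proof -
  obtain T where T: "finite T" "\<And>r c. b r c \<noteq> 0 \<Longrightarrow> r \<in> T \<and> c \<in> T" using mats_support[OF b] by blast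
  note val = val_ract[OF b f _ T(1)]
  have mem: "b s c * x \<in> num s r" if "x \<in> num c r" for x r s c
    by (rule num_mult[OF mats_mem[OF b] that])
  show ?thesis
  proof (rule dualI)
    show "val (dual_ract I N f (coset_mat b)) r c (x + y) = val (dual_ract I N f (coset_mat b)) r c x + val (dual_ract I N f (coset_mat b)) r c y"
      if "x \<in> num c r" "y \<in> num c r" for r c x y
      using that T f by (simp add: val add_subgroupD num_closed distrib_left val_add mem sum.distrib)
    show "val (dual_ract I N f (coset_mat b)) r c (scale k x) = k * val (dual_ract I N f (coset_mat b)) r c x"
      if "x \<in> num c r" for r c x k
      using that T f by (simp add: val num_scale val_scale mem sum_distrib_left flip: scale_mult_right)
    show "finite (fst ` {(r, c). f r c \<noteq> (\<lambda>_. 0)} \<times> T)"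
      using T dual_finite[OF f] by simp
    show "(r, c) \<in> fst ` {(r, c). f r c \<noteq> (\<lambda>_. 0)} \<times> T" if ne: "dual_ract I N f (coset_mat b) r c \<noteq> (\<lambda>_. 0)" for r c
    proof -
      obtain X where "dual_ract I N f (coset_mat b) r c X \<noteq> 0" using ne by (auto simp: fun_eq_iff)
      then have "{s. f r s \<noteq> (\<lambda>_. 0) \<and> coset_mat b s c \<noteq> den s c} \<noteq> {}"
        by (auto simp: dual_ract_def simp del: Collect_empty_eq split: if_splits)
      then obtain s where "f r s \<noteq> (\<lambda>_. 0)" "coset_mat b s c \<noteq> den s c" by blast
      moreover from this(2) have "b s c \<noteq> 0" by (auto simp: coset_mat_eq_den_iff add_subgroupD(1)[OF den_closed])
      ultimately show ?thesis using T(2) by force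
    qed
  qed (rule ract_outside)
qed

lemma lact_add_right:
  assumes a: "a \<in> mats num" and "g \<in> carrier dual" "h \<in> carrier dual"
  shows "dual_lact I N (coset_mat a) (g \<otimes>\<^bsub>dual\<^esub> h) = dual_lact I N (coset_mat a) g \<otimes>\<^bsub>dual\<^esub> dual_lact I N (coset_mat a) h"
proof -
  interpret D: comm_group dual by (rule dual_comm_group)
  obtain T where T: "finite T" "\<And>r c. a r c \<noteq> 0 \<Longrightarrow> r \<in> T \<and> c \<in> T" using mats_support[OF a] by blast
  show ?thesis
    by (rule dual_ext)
       (use assms T in \<open>simp_all add: lact_outside dual_mult val_mult val_lact[OF a _ _ T(1)] sum.distrib\<close>)
qed

lemma lact_add_left:
  assumes "a \<in> mats num" "b \<in> mats num" "g \<in> carrier dual"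
  shows "dual_lact I N (coset_mat a \<otimes>\<^bsub>CC I N\<^esub> coset_mat b) g = dual_lact I N (coset_mat a) g \<otimes>\<^bsub>dual\<^esub> dual_lact I N (coset_mat b) g"
proof -
  obtain T where T: "finite T" "\<And>r c. a r c \<noteq> 0 \<Longrightarrow> r \<in> T \<and> c \<in> T" using mats_support[OF assms(1)] by blast
  obtain T' where T': "finite T'" "\<And>r c. b r c \<noteq> 0 \<Longrightarrow> r \<in> T' \<and> c \<in> T'" using mats_support[OF assms(2)] by blast
  have fin: "finite (T \<union> T')" using T T' by simp
  have ab: "(\<lambda>r c. a r c + b r c) \<in> mats num" by (rule mats_add[OF num_closed assms(1,2)])
  show ?thesis
    unfolding coset_mat_add
  proof (rule dual_ext)
    fix r c x assume x: "x \<in> num c r"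
    have "x * a r s \<in> num c s" "x * b r s \<in> num c s" for s
      using x assms by (auto intro: num_mult mats_mem)
    then have "val g s c (x * (a r s + b r s)) = val g s c (x * a r s) + val g s c (x * b r s)" for s
      using assms(3) by (simp add: distrib_left val_add)
    then show "val (dual_lact I N (coset_mat (\<lambda>r c. a r c + b r c)) g) r c x =
        val (dual_lact I N (coset_mat a) g \<otimes>\<^bsub>dual\<^esub> dual_lact I N (coset_mat b) g) r c x"
      using x T(2) T'(2) assms(3)
      by (subst val_lact[OF ab _ _ fin], (auto)[2], metis UnI1 UnI2 add_0)
         (simp add: val_mult val_lact[OF assms(1) _ _ fin] val_lact[OF assms(2) _ _ fin] sum.distrib)
  qed (simp_all add: lact_outside dual_mult)
qed

lemma ract_add_left:
  assumes b: "b \<in> mats num" and "g \<in> carrier dual" "h \<in> carrier dual"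
  shows "dual_ract I N (g \<otimes>\<^bsub>dual\<^esub> h) (coset_mat b) = dual_ract I N g (coset_mat b) \<otimes>\<^bsub>dual\<^esub> dual_ract I N h (coset_mat b)"
proof -
  interpret D: comm_group dual by (rule dual_comm_group)
  obtain T where T: "finite T" "\<And>r c. b r c \<noteq> 0 \<Longrightarrow> r \<in> T \<and> c \<in> T" using mats_support[OF b] by blast
  show ?thesis
    by (rule dual_ext)
       (use assms T in \<open>simp_all add: ract_outside dual_mult val_mult val_ract[OF b _ _ T(1)] sum.distrib\<close>)
qed

lemma ract_add_right:
  assumes "a \<in> mats num" "b \<in> mats num" "g \<in> carrier dual"
  shows "dual_ract I N g (coset_mat a \<otimes>\<^bsub>CC I N\<^esub> coset_mat b) = dual_ract I N g (coset_mat a) \<otimes>\<^bsub>dual\<^esub> dual_ract I N g (coset_mat b)"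
proof -
  obtain T where T: "finite T" "\<And>r c. a r c \<noteq> 0 \<Longrightarrow> r \<in> T \<and> c \<in> T" using mats_support[OF assms(1)] by blast
  obtain T' where T': "finite T'" "\<And>r c. b r c \<noteq> 0 \<Longrightarrow> r \<in> T' \<and> c \<in> T'" using mats_support[OF assms(2)] by blast
  have fin: "finite (T \<union> T')" using T T' by simp
  have ab: "(\<lambda>r c. a r c + b r c) \<in> mats num" by (rule mats_add[OF num_closed assms(1,2)])
  show ?thesis
    unfolding coset_mat_add
  proof (rule dual_ext)
    fix r c x assume x: "x \<in> num c r"
    have "a s c * x \<in> num s r" "b s c * x \<in> num s r" for s
      using x assms by (auto intro: num_mult mats_mem)
    then have "val g r s ((a s c + b s c) * x) = val g r s (a s c * x) + val g r s (b s c * x)" for s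
      using assms(3) by (simp add: distrib_right val_add)
    then show "val (dual_ract I N g (coset_mat (\<lambda>r c. a r c + b r c))) r c x =
        val (dual_ract I N g (coset_mat a) \<otimes>\<^bsub>dual\<^esub> dual_ract I N g (coset_mat b)) r c x"
      using x T(2) T'(2) assms(3)
      by (subst val_ract[OF ab _ _ fin], (auto)[2], metis UnI1 UnI2 add_0)
         (simp add: val_mult val_ract[OF assms(1) _ _ fin] val_ract[OF assms(2) _ _ fin] sum.distrib)
  qed (simp_all add: ract_outside dual_mult)
qed

lemma lact_assoc:
  assumes a: "a \<in> mats num" and b: "b \<in> mats num" and h: "h \<in> carrier dual"
  shows "dual_lact I N (coset_mat (mat_mult a b)) h = dual_lact I N (coset_mat a) (dual_lact I N (coset_mat b) h)"
proof (rule dual_ext)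
  fix r c x assume x: "x \<in> num c r"
  obtain T where T: "finite T" "\<And>r c. a r c \<noteq> 0 \<Longrightarrow> r \<in> T \<and> c \<in> T" using mats_support[OF a] by blast
  obtain T' where T': "finite T'" "\<And>r c. b r c \<noteq> 0 \<Longrightarrow> r \<in> T' \<and> c \<in> T'" using mats_support[OF b] by blast
  have ab: "mat_mult a b r s = (\<Sum>t\<in>T. a r t * b t s)" for r s
    using T by (intro mat_mult_eq) auto
  have ab_supp: "s \<in> T'" if "mat_mult a b r s \<noteq> 0" for r s
  proof (rule ccontr)
    assume "s \<notin> T'"
    then have "b t s = 0" for t using T'(2) by blast
    then show False using that by (simp add: ab)
  qed
  have mem: "x * a r t \<in> num c t" "x * a r t * b t s \<in> num c s" for t s
    using x a b by (auto intro!: num_mult mats_mem[OF a] mats_mem[OF b])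
  have "val (dual_lact I N (coset_mat (mat_mult a b)) h) r c x = (\<Sum>s\<in>T'. val h s c (\<Sum>t\<in>T. x * a r t * b t s))"
    using ab_supp
    by (subst val_lact[OF mat_mult_num[OF a b] h x T'(1)]) (auto simp: ab sum_distrib_left mult.assoc)
  also have "\<dots> = (\<Sum>s\<in>T'. \<Sum>t\<in>T. val h s c (x * a r t * b t s))"
    using h mem by (simp add: val_sum)
  also have "\<dots> = (\<Sum>t\<in>T. \<Sum>s\<in>T'. val h s c (x * a r t * b t s))"
    by (rule sum.swap)
  also have "\<dots> = (\<Sum>t\<in>T. val (dual_lact I N (coset_mat b) h) t c (x * a r t))"
    using T' mem by (intro sum.cong refl val_lact[OF b h, symmetric]) auto
  also have "\<dots> = val (dual_lact I N (coset_mat a) (dual_lact I N (coset_mat b) h)) r c x"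
    using T by (intro val_lact[OF a lact_closed[OF b h] x, symmetric]) auto
  finally show "val (dual_lact I N (coset_mat (mat_mult a b)) h) r c x = val (dual_lact I N (coset_mat a) (dual_lact I N (coset_mat b) h)) r c x" .
qed (simp_all add: lact_outside)

lemma lact_ract_assoc:
  assumes a: "a \<in> mats num" and b: "b \<in> mats num" and g: "g \<in> carrier dual"
  shows "dual_ract I N (dual_lact I N (coset_mat a) g) (coset_mat b) = dual_lact I N (coset_mat a) (dual_ract I N g (coset_mat b))"
proof (rule dual_ext)
  fix r c x assume x: "x \<in> num c r"
  obtain T where T: "finite T" "\<And>r c. a r c \<noteq> 0 \<Longrightarrow> r \<in> T \<and> c \<in> T" using mats_support[OF a] by blast
  obtain T' where T': "finite T'" "\<And>r c. b r c \<noteq> 0 \<Longrightarrow> r \<in> T' \<and> c \<in> T'" using mats_support[OF b] by blast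
  have mem: "b s c * x \<in> num s r" "x * a r t \<in> num c t" for s t
    using x by (auto intro!: num_mult mats_mem[OF a] mats_mem[OF b])
  have "val (dual_ract I N (dual_lact I N (coset_mat a) g) (coset_mat b)) r c x =
      (\<Sum>s\<in>T'. val (dual_lact I N (coset_mat a) g) r s (b s c * x))"
    using T' by (intro val_ract[OF b lact_closed[OF a g] x]) auto
  also have "\<dots> = (\<Sum>s\<in>T'. \<Sum>t\<in>T. val g t s (b s c * x * a r t))"
    using T mem by (intro sum.cong refl val_lact[OF a g]) auto
  also have "\<dots> = (\<Sum>t\<in>T. \<Sum>s\<in>T'. val g t s (b s c * (x * a r t)))"
    by (subst sum.swap) (simp add: mult.assoc)
  also have "\<dots> = (\<Sum>t\<in>T. val (dual_ract I N g (coset_mat b)) t c (x * a r t))"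
    using T' mem by (intro sum.cong refl val_ract[OF b g, symmetric]) auto
  also have "\<dots> = val (dual_lact I N (coset_mat a) (dual_ract I N g (coset_mat b))) r c x"
    using T by (intro val_lact[OF a ract_closed[OF b g] x, symmetric]) auto
  finally show "val (dual_ract I N (dual_lact I N (coset_mat a) g) (coset_mat b)) r c x =
      val (dual_lact I N (coset_mat a) (dual_ract I N g (coset_mat b))) r c x" .
qed (simp_all add: lact_outside ract_outside)

section \<open>The trivial extension\<close>

lemma component_num: "x \<in> num r c \<Longrightarrow> component i x \<in> num r c"
  by (auto simp: num_iff component_homogeneous[OF component_G])

lemma num_mono: "r \<le> s \<Longrightarrow> x \<in> num c r \<Longrightarrow> x \<in> num c s"
  by (simp add: num_iff)

lemma val_component:
  assumes "f \<in> carrier dual" "x \<in> num c r"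
  shows "val f r c x = (\<Sum>i<N. val f r c (component i x))"
  by (subst val_sum[symmetric]) (simp_all add: assms component_num sum_component_N)

lemma row_zeroI:
  assumes "f \<in> carrier dual" "\<And>x. x \<in> num c r \<Longrightarrow> val f r c x = 0"
  shows "f r c = (\<lambda>_. 0)"
proof
  fix X
  show "f r c X = 0"
    using assms entry_cases[of X c r]
    by (cases "X \<in> entry I N c r") (auto simp: val_def dual_outside)
qed

text \<open>
  The dual part of the right factor. In position \<open>(r, c)\<close> with \<open>c \<le> r\<close>, only the values in degree
  \<open>N - 1 - (r - c)\<close> are unrestricted; for \<open>r < c\<close> the condition forces the functional to vanish, since
  the entry is the sum of its homogeneous components.
\<close>

definition B_dual :: "('a, 'k) dual_mat set" where
  "B_dual = {f \<in> carrier dual. \<forall>r c i. \<forall>x \<in> G i \<inter> num c r.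
     \<not> (c \<le> r \<and> int i = int N - 1 - (r - c)) \<longrightarrow> val f r c x = 0}"

lemma B_dualD:
  assumes "f \<in> B_dual"
  shows "f \<in> carrier dual"
    "\<lbrakk>x \<in> G i; x \<in> num c r; \<not> (c \<le> r \<and> int i = int N - 1 - (r - c))\<rbrakk> \<Longrightarrow> val f r c x = 0"
  using assms unfolding B_dual_def by blast+

lemma B_dual_upper: "f \<in> B_dual \<Longrightarrow> \<not> c \<le> r \<Longrightarrow> f r c = (\<lambda>_. 0)"
  by (rule row_zeroI) (auto simp: B_dualD(1) val_component intro!: sum.neutral B_dualD(2)[OF _ component_G] component_num)

lemma B_bar_eq: "B_bar scale I N G = (coset_mat ` mats B_shape) \<times> B_dual"
proof -
  have M: "M \<in> coset_mat ` mats B_shape \<longleftrightarrow> M \<in> carrier (CC I N) \<and>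
      (\<forall>r c. if r \<ge> c then M r c \<in> (\<lambda>x. x +o den r c) ` G (nat (r - c)) else M r c = den r c)" for M
    unfolding B_alg_eq[symmetric] B_alg_def by (auto split: if_splits)
  have f: "f \<in> B_dual \<longleftrightarrow> f \<in> carrier dual \<and>
      (\<forall>r c. if r \<ge> c then \<forall>i. int i \<noteq> int N - 1 - (r - c) \<longrightarrow> (\<forall>x\<in>G i. f r c (x +o den c r) = 0)
        else f r c = (\<lambda>_. 0))" (is "_ \<longleftrightarrow> _ \<and> ?R") for f :: "('a, 'k) dual_mat"
  proof
    assume f: "f \<in> B_dual"
    have "f r c (x +o den c r) = 0" if "c \<le> r" "int i \<noteq> int N - 1 - (r - c)" "x \<in> G i" for r c i x
      using that B_dualD(2)[OF f that(3), of c r] by (simp add: num_eq I_0 val_def)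
    then show "f \<in> carrier dual \<and> ?R" using f by (auto simp: B_dualD(1) B_dual_upper)
  next
    assume "f \<in> carrier dual \<and> ?R"
    then show "f \<in> B_dual"
      unfolding B_dual_def val_def by (auto split: if_splits) (metis linorder_not_le)+
  qed
  have mem: "(M, f) \<in> B_bar scale I N G \<longleftrightarrow> M \<in> coset_mat ` mats B_shape \<and> f \<in> B_dual" for M f
    unfolding M f B_bar_def DD_def by (simp split: if_splits) blast
  show ?thesis by (auto simp: mem)
qed

lemma B_dual_subgroup: "subgroup B_dual dual"
proof -
  interpret D: comm_group dual by (rule dual_comm_group)
  have inv: "val (inv\<^bsub>dual\<^esub> f) r c x = - val f r c x" if "f \<in> carrier dual" for f r c x
  proof -
    have "val (inv\<^bsub>dual\<^esub> f \<otimes>\<^bsub>dual\<^esub> f) r c x = 0"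
      using that by (simp only: D.l_inv) (simp add: val_def dual_one)
    then show ?thesis by (simp only: val_mult eq_neg_iff_add_eq_0)
  qed
  show ?thesis
  proof (rule D.subgroupI)
    show "B_dual \<noteq> {}"
      using D.one_closed by (auto simp: B_dual_def dual_one val_def intro!: exI[of _ "\<one>\<^bsub>dual\<^esub>"])
  qed (auto simp: B_dual_def inv val_mult)
qed

text \<open>
  The entries of the right factor have degree \<open>r - s\<close> in position \<open>(r, s)\<close>, and the degrees of the
  functionals decrease by the same amount: if \<open>x\<close> has degree \<open>i\<close> and \<open>i + (r - s) = N - 1 - (s - c)\<close>, then
  \<open>i = N - 1 - (r - c)\<close>.
\<close>

lemma lact_B_dual:
  assumes a: "a \<in> mats B_shape" and g: "g \<in> B_dual"
  shows "dual_lact I N (coset_mat a) g \<in> B_dual"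
proof -
  obtain T where T: "finite T" "\<And>r c. a r c \<noteq> 0 \<Longrightarrow> r \<in> T \<and> c \<in> T" using mats_support[OF a] by blast
  note an = shape_mats(2)[OF a]
  have "val (dual_lact I N (coset_mat a) g) r c x = 0"
    if x: "x \<in> G i" "x \<in> num c r" and i: "\<not> (c \<le> r \<and> int i = int N - 1 - (r - c))" for r c i x
  proof -
    have "val g s c (x * a r s) = 0" for s
    proof (cases "s \<le> r")
      case True
      then have "a r s \<in> G (nat (r - s))" using mats_mem[OF a, of r s] by (simp add: B_shape_def)
      then have "x * a r s \<in> G (i + nat (r - s))" by (rule G_mult[OF x(1)])
      moreover have "x * a r s \<in> num c s" by (rule num_mult[OF x(2) mats_mem[OF an]])
      ultimately show ?thesis using True i by (intro B_dualD(2)[OF g]) auto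
    next
      case False
      then have "a r s = 0" using mats_mem[OF a, of r s] by (simp add: B_shape_def)
      then show ?thesis by (simp add: val_zero B_dualD(1)[OF g])
    qed
    then show ?thesis
      using T by (subst val_lact[OF an B_dualD(1)[OF g] x(2) T(1)]) auto
  qed
  then show ?thesis
    unfolding B_dual_def using lact_closed[OF an B_dualD(1)[OF g]] by blast
qed

lemma ract_B_dual:
  assumes b: "b \<in> mats B_shape" and f: "f \<in> B_dual"
  shows "dual_ract I N f (coset_mat b) \<in> B_dual"
proof -
  obtain T where T: "finite T" "\<And>r c. b r c \<noteq> 0 \<Longrightarrow> r \<in> T \<and> c \<in> T" using mats_support[OF b] by blast
  note bn = shape_mats(2)[OF b]
  have "val (dual_ract I N f (coset_mat b)) r c x = 0"
    if x: "x \<in> G i" "x \<in> num c r" and i: "\<not> (c \<le> r \<and> int i = int N - 1 - (r - c))" for r c i x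
  proof -
    have "val f r s (b s c * x) = 0" for s
    proof (cases "c \<le> s")
      case True
      then have "b s c \<in> G (nat (s - c))" using mats_mem[OF b, of s c] by (simp add: B_shape_def)
      then have "b s c * x \<in> G (nat (s - c) + i)" by (rule G_mult[OF _ x(1)])
      moreover have "b s c * x \<in> num s r" by (rule num_mult[OF mats_mem[OF bn] x(2)])
      ultimately show ?thesis using True i by (intro B_dualD(2)[OF f]) auto
    next
      case False
      then have "b s c = 0" using mats_mem[OF b, of s c] by (simp add: B_shape_def)
      then show ?thesis by (simp add: val_zero B_dualD(1)[OF f])
    qed
    then show ?thesis
      using T by (subst val_ract[OF bn B_dualD(1)[OF f] x(2) T(1)]) auto
  qed
  then show ?thesis
    unfolding B_dual_def using ract_closed[OF bn B_dualD(1)[OF f]] by blast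
qed

definition row_dual :: "int \<Rightarrow> ('a, 'k) dual_mat set" where
  "row_dual s = {g \<in> B_dual. \<forall>r c. r \<noteq> s \<longrightarrow> g r c = (\<lambda>_. 0)}"

lemma row_dual_subgroup: "subgroup (row_dual s) dual"
proof -
  interpret D: comm_group dual by (rule dual_comm_group)
  have inv: "(inv\<^bsub>dual\<^esub> f) r c = (\<lambda>X. - f r c X)" if "f \<in> carrier dual" for f r c
  proof
    fix X
    have "(inv\<^bsub>dual\<^esub> f \<otimes>\<^bsub>dual\<^esub> f) r c X = 0"
      using that by (simp only: D.l_inv) (simp add: dual_one)
    then show "(inv\<^bsub>dual\<^esub> f) r c X = - f r c X" by (simp only: dual_mult eq_neg_iff_add_eq_0)
  qed
  note B = B_dual_subgroup
  show ?thesis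
  proof (rule D.subgroupI)
    show "row_dual s \<noteq> {}"
      using subgroup.one_closed[OF B] by (auto simp: row_dual_def dual_one)
  qed (use subgroup.m_closed[OF B] subgroup.m_inv_closed[OF B] in
       \<open>auto simp: row_dual_def B_dualD(1) inv dual_mult fun_eq_iff\<close>)
qed

lemma val_lact_single_entry:
  assumes "single_entry r s a \<in> mats num" "g \<in> carrier dual" "x \<in> num c r'"
  shows "val (dual_lact I N (coset_mat (single_entry r s a)) g) r' c x = (if r' = r then val g s c (x * a) else 0)"
  by (subst val_lact[OF assms, of "{s}"])
     (auto simp: single_entry_def val_zero assms(2) split: if_splits)

lemma lact_single_entry_row:
  assumes "a \<in> G 0" "g \<in> B_dual"
  shows "dual_lact I N (coset_mat (single_entry s s a)) g \<in> row_dual s"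
proof -
  note mem = lact_B_dual[OF shape_mats(6)[OF single_entry_diag[OF assms(1)]] assms(2)]
  have "dual_lact I N (coset_mat (single_entry s s a)) g r c = (\<lambda>_. 0)" if "r \<noteq> s" for r c
    using that assms
    by (intro row_zeroI B_dualD(1)[OF mem])
       (simp add: val_lact_single_entry shape_mats(5)[OF single_entry_diag] B_dualD(1))
  then show ?thesis using mem by (simp add: row_dual_def)
qed

lemma unit_at_num: "j \<in> strip \<Longrightarrow> unit_at j \<in> mats num"
  by (rule shape_mats(1)[OF unit_at_T_shape])

lemma val_unit_rows:
  assumes "finite P" "P \<subseteq> strip" "\<And>j. j \<in> P \<Longrightarrow> g j \<in> carrier dual" "x \<in> num c r"
  shows "(\<Sum>j\<in>P. val (dual_lact I N (coset_mat (unit_at j)) (g j)) r c x) = (\<Sum>s | (r, s) \<in> P. val (g (r, s)) s c x)"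
proof -
  have "(\<Sum>j\<in>P. val (dual_lact I N (coset_mat (unit_at j)) (g j)) r c x) =
      (\<Sum>j\<in>P. if r = fst j then val (g j) (snd j) c x else 0)"
  proof (intro sum.cong refl)
    fix j assume "j \<in> P"
    then have "unit_at j \<in> mats num" using assms(2) by (intro unit_at_num) blast
    then show "val (dual_lact I N (coset_mat (unit_at j)) (g j)) r c x = (if r = fst j then val (g j) (snd j) c x else 0)"
      using assms(3)[OF \<open>j \<in> P\<close>] assms(4) by (simp add: val_lact_single_entry)
  qed
  also have "\<dots> = (\<Sum>s | (r, s) \<in> P. val (g (r, s)) s c x)"
    using sum_row[OF assms(1), of r "\<lambda>j. val (g j) (snd j) c x"] by simp
  finally show ?thesis .
qed

text \<open>
  In the degree that matters for position \<open>(s, c)\<close>, the bound \<open>s < r + N\<close> gives \<open>c - r \<le> i\<close>. So the entry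
  in position \<open>(c, r)\<close> has all elements of this degree.
\<close>

lemma strip_degree_num:
  assumes "(r, s) \<in> strip" "x \<in> G i" "int i = int N - 1 - (s - c)"
  shows "x \<in> num c r"
  using assms by (auto simp: num_iff component_homogeneous[OF assms(2)] strip_def)

text \<open>
  As for matrices: on elements of degree \<open>N - 1 - (s - c)\<close> only the summand that comes from \<open>(r, s)\<close>
  can be nonzero.
\<close>

lemma dual_rows_independent:
  assumes P: "finite P" "P \<subseteq> strip" and g: "\<And>j. j \<in> P \<Longrightarrow> g j \<in> row_dual (snd j)"
    and zero: "\<And>r c x. x \<in> num c r \<Longrightarrow> (\<Sum>j\<in>P. val (dual_lact I N (coset_mat (unit_at j)) (g j)) r c x) = 0"
    and j: "j \<in> P"
  shows "g j = (\<lambda>r c X. 0)"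
proof -
  obtain r s where rs: "j = (r, s)" by force
  have gB: "g j \<in> B_dual" if "j \<in> P" for j using g[OF that] by (simp add: row_dual_def)
  have gd: "g j \<in> carrier dual" if "j \<in> P" for j using gB[OF that] by (rule B_dualD(1))
  have "g j s c = (\<lambda>_. 0)" for c
  proof (rule row_zeroI[OF gd[OF j]])
    fix x assume x: "x \<in> num c s"
    have "val (g j) s c (component i x) = 0" for i
    proof (cases "c \<le> s \<and> int i = int N - 1 - (s - c)")
      case True
      then have y: "component i x \<in> num c r" using P(2) j rs by (intro strip_degree_num[OF _ component_G]) auto
      have "0 = (\<Sum>s' | (r, s') \<in> P. val (g (r, s')) s' c (component i x))"
        using zero[OF y] val_unit_rows[OF P gd y] by simp
      also have "\<dots> = (\<Sum>s' | (r, s') \<in> P. if s' = s then val (g (r, s)) s c (component i x) else 0)"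
      proof (intro sum.cong refl)
        fix s' assume s': "s' \<in> {s'. (r, s') \<in> P}"
        then have "component i x \<in> num c s'" using P(2) y by (auto simp: strip_def intro: num_mono)
        then show "val (g (r, s')) s' c (component i x) = (if s' = s then val (g (r, s)) s c (component i x) else 0)"
          using s' True by (auto intro!: B_dualD(2)[OF gB component_G])
      qed
      also have "\<dots> = val (g j) s c (component i x)"
        using finite_row[OF P(1), of r] j by (simp add: rs sum.delta')
      finally show ?thesis by simp
    next
      case False
      then show ?thesis using component_num[OF x] by (intro B_dualD(2)[OF gB[OF j] component_G]) auto
    qed
    then show "val (g j) s c x = 0" by (simp add: val_component[OF gd[OF j] x])
  qed
  then have "g j r' c = (\<lambda>_. 0)" for r' c
    using g[OF j] by (cases "r' = s") (auto simp: row_dual_def rs)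
  then show ?thesis by (simp add: fun_eq_iff)
qed

text \<open>
  The summand with index \<open>j = (r, s)\<close> of \<open>f\<close>: in column \<open>c\<close> of row \<open>s\<close>, the functional that takes the
  component of degree \<open>N - 1 - (s - c)\<close> and applies the functional of \<open>f\<close> in position \<open>(r, c)\<close>. A coset
  is an argument here; the component is the same for all its elements, because the denominator has
  components of higher degree only.
\<close>

definition dual_row_part :: "('a, 'k) dual_mat \<Rightarrow> int \<times> int \<Rightarrow> ('a, 'k) dual_mat" where
  "dual_row_part f j s c X =
     (if s = snd j \<and> c \<le> s \<and> s - c < int N \<and> X \<in> entry I N c s
      then f (fst j) c (component (nat (int N - 1 - (s - c))) ` X + den c (fst j)) else 0)"

lemma val_dual_row_part:
  assumes "x \<in> num c s"
  shows "val (dual_row_part f j) s c x =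
    (if s = snd j \<and> c \<le> s \<and> s - c < int N then val f (fst j) c (component (nat (int N - 1 - (s - c))) x) else 0)"
proof (cases "s = snd j \<and> c \<le> s \<and> s - c < int N")
  case True
  let ?i = "nat (int N - 1 - (s - c))"
  have "component ?i d = 0" if "d \<in> den c s" for d
    using that True by (simp add: den_iff)
  then have "component ?i ` (x +o den c s) = {component ?i x}"
    using add_subgroupD(1)[OF den_closed] by (force simp: elt_set_plus_def component_add)
  then have "component ?i ` (x +o den c s) + den c (fst j) = component ?i x +o den c (fst j)"
    by (auto simp: set_plus_def elt_set_plus_def)
  then show ?thesis using True coset_entry[OF assms] by (simp add: val_def dual_row_part_def)
qed (auto simp: val_def dual_row_part_def)

lemma dual_row_part_mem:
  assumes f: "f \<in> carrier dual" and j: "j \<in> strip"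
  shows "dual_row_part f j \<in> row_dual (snd j)"
proof -
  have num: "component (nat (int N - 1 - (s - c))) x \<in> num c (fst j)"
    if "s = snd j" "s - c < int N" for s c x
    using j that by (intro strip_degree_num[OF _ component_G, of _ s]) auto
  have dual: "dual_row_part f j \<in> carrier dual"
  proof (rule dualI)
    show "finite ({snd j} \<times> snd ` {(r, c). f r c \<noteq> (\<lambda>_. 0)})" using dual_finite[OF f] by simp
    show "(r, c) \<in> {snd j} \<times> snd ` {(r, c). f r c \<noteq> (\<lambda>_. 0)}" if ne: "dual_row_part f j r c \<noteq> (\<lambda>_. 0)" for r c
    proof -
      obtain X where "dual_row_part f j r c X \<noteq> 0" using ne by (auto simp: fun_eq_iff)
      then have "r = snd j" "f (fst j) c \<noteq> (\<lambda>_. 0)" by (auto simp: dual_row_part_def split: if_splits)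
      then show ?thesis by force
    qed
  qed (use f num in \<open>auto simp: val_dual_row_part add_subgroupD num_closed num_scale component_add component_scale val_add val_scale
         dual_row_part_def[of _ _ _ _ X for X]\<close>)
  have "val (dual_row_part f j) s c x = 0"
    if "x \<in> G i" "x \<in> num c s" "\<not> (c \<le> s \<and> int i = int N - 1 - (s - c))" for s c i x
    using that f by (auto simp: val_dual_row_part component_homogeneous[OF that(1)] val_zero)
  then have "dual_row_part f j \<in> B_dual" using dual unfolding B_dual_def by blast
  then show ?thesis by (auto simp: row_dual_def dual_row_part_def fun_eq_iff)
qed

text \<open>
  The functional in position \<open>(r, c)\<close> is the sum of its restrictions to the homogeneous components
  of its entry. Their degrees are \<open>i = N - 1 - (s - c)\<close> for the \<open>s\<close> with \<open>r \<le> s < r + N\<close> and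
  \<open>c \<le> s < c + N\<close>.
\<close>

lemma dual_rows_span:
  assumes f: "f \<in> carrier dual" and T: "finite T" "\<And>r c. f r c \<noteq> (\<lambda>_. 0) \<Longrightarrow> r \<in> T" and x: "x \<in> num c r"
  shows "(\<Sum>j\<in>strip_rows T. val (dual_lact I N (coset_mat (unit_at j)) (dual_row_part f j)) r c x) = val f r c x"
proof -
  have "dual_row_part f j \<in> carrier dual" if "j \<in> strip_rows T" for j
    using dual_row_part_mem[OF f subsetD[OF strip_rows(2) that]] by (simp add: row_dual_def B_dualD(1))
  then have eq: "(\<Sum>j\<in>strip_rows T. val (dual_lact I N (coset_mat (unit_at j)) (dual_row_part f j)) r c x) =
      (\<Sum>s\<in>(if r \<in> T then {r..<r + int N} else {}). val (dual_row_part f (r, s)) s c x)"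
    using val_unit_rows[OF strip_rows(1)[OF T(1)] strip_rows(2) _ x, of "dual_row_part f"]
    by (simp only: strip_rows_row)
  show ?thesis
  proof (cases "r \<in> T")
    case True
    have "(\<Sum>s = r..<r + int N. val (dual_row_part f (r, s)) s c x) =
        (\<Sum>s = r..<r + int N. if c \<le> s \<and> s - c < int N then val f r c (component (nat (int N - 1 - (s - c))) x) else 0)"
      using num_mono[OF _ x] by (intro sum.cong refl) (simp add: val_dual_row_part)
    also have "\<dots> = (\<Sum>s | r \<le> s \<and> s < r + int N \<and> c \<le> s \<and> s - c < int N. val f r c (component (nat (int N - 1 - (s - c))) x))"
      by (subst sum.inter_filter[symmetric]) (auto intro!: sum.cong)
    also have "\<dots> = (\<Sum>i | i < N \<and> c - r \<le> int i \<and> int i < int N + c - r. val f r c (component i x))"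
      \<comment> \<open>\<open>s\<close> and \<open>i\<close> determine each other by \<open>i = N - 1 - (s - c)\<close>.\<close>
      by (rule sum.reindex_bij_witness[where i = "\<lambda>i. int N - 1 - int i + c" and j = "\<lambda>s. nat (int N - 1 - (s - c))"]) auto
    also have "\<dots> = (\<Sum>i<N. val f r c (component i x))"
    proof (rule sum.mono_neutral_left)
      show "\<forall>i\<in>{..<N} - {i. i < N \<and> c - r \<le> int i \<and> int i < int N + c - r}. val f r c (component i x) = 0"
      proof
        fix i assume i: "i \<in> {..<N} - {i. i < N \<and> c - r \<le> int i \<and> int i < int N + c - r}"
        show "val f r c (component i x) = 0"
        proof (cases "c - r \<le> int i")
          case True
          with i have "component i x \<in> den c r"
            by (auto simp: den_iff component_homogeneous[OF component_G])
          then show ?thesis by (rule val_den[OF f])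
        next
          case False
          then have "component i x = 0" using x by (simp add: num_iff)
          then show ?thesis by (simp add: val_zero[OF f])
        qed
      qed
    qed auto
    also have "\<dots> = val f r c x" by (rule val_component[OF f x, symmetric])
    finally show ?thesis using True eq by simp
  next
    case False
    then have "f r c = (\<lambda>_. 0)" using T(2) by blast
    then show ?thesis using False eq by (simp add: val_null)
  qed
qed

lemma carrier_DD: "carrier (DD scale I N) = coset_mat ` mats num \<times> carrier dual"
  by (simp add: DD_def carrier_CC)

lemma DD_add: "(a, f) \<otimes>\<^bsub>DD scale I N\<^esub> (b, g) = (a \<otimes>\<^bsub>CC I N\<^esub> b, f \<otimes>\<^bsub>dual\<^esub> g)"
  by (simp add: DD_def)

lemma DD_one: "\<one>\<^bsub>DD scale I N\<^esub> = (\<one>\<^bsub>CC I N\<^esub>, \<one>\<^bsub>dual\<^esub>)"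
  by (simp add: DD_def)

lemma DD_comm_group: "comm_group (DD scale I N)"
proof -
  interpret C: comm_group "CC I N" by (rule CC_comm_group)
  interpret D: comm_group dual by (rule dual_comm_group)
  show ?thesis
    by (rule group.group_comm_groupI)
       (auto simp: DD_def DirProd_group C.is_group D.is_group C.m_comm D.m_comm)
qed

lemma finprod_DD:
  assumes "finite P" "\<And>j. j \<in> P \<Longrightarrow> a j \<in> carrier (CC I N)" "\<And>j. j \<in> P \<Longrightarrow> f j \<in> carrier dual"
  shows "finprod (DD scale I N) (\<lambda>j. (a j, f j)) P = (finprod (CC I N) a P, finprod dual f P)"
proof -
  interpret C: comm_group "CC I N" by (rule CC_comm_group)
  interpret D: comm_group dual by (rule dual_comm_group)
  interpret DD: comm_group "DD scale I N" by (rule DD_comm_group)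
  show ?thesis
    using assms
    by (induction P rule: finite_induct) (simp_all add: DD_one DD_add Pi_iff carrier_DD carrier_CC)
qed

lemma DD_mult_eq: "DD_mult I N (a, f) (b, g) = (CC_mult I N a b, dual_lact I N a g \<otimes>\<^bsub>dual\<^esub> dual_ract I N f b)"
  by (simp add: DD_mult_def CC_dual_def)

text \<open>Fixes the field of the functionals, which the type of a matrix does not determine.\<close>

abbreviation emb :: "'a cmat \<Rightarrow> 'a cmat \<times> ('a, 'k) dual_mat" where
  "emb \<equiv> in_DD"

lemma in_DD_eq: "emb a = (a, \<one>\<^bsub>dual\<^esub>)"
  by (simp add: in_DD_def dual_one)

lemma ract_one: "dual_ract I N \<one>\<^bsub>dual\<^esub> b = \<one>\<^bsub>dual\<^esub>"
  by (simp add: fun_eq_iff dual_ract_def dual_one)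

lemma lact_one: "dual_lact I N b \<one>\<^bsub>dual\<^esub> = \<one>\<^bsub>dual\<^esub>"
  by (simp add: fun_eq_iff dual_lact_def dual_one)

lemma in_DD_mult:
  assumes "a \<in> mats num" "g \<in> carrier dual"
  shows "DD_mult I N (emb (coset_mat a)) (b, g) = (CC_mult I N (coset_mat a) b, dual_lact I N (coset_mat a) g)"
proof -
  interpret D: comm_group dual by (rule dual_comm_group)
  show ?thesis by (simp add: in_DD_eq DD_mult_eq ract_one lact_closed assms)
qed

lemma in_DD_mult_in_DD:
  "DD_mult I N (emb a) (emb b) = (emb (CC_mult I N a b) :: 'a cmat \<times> ('a, 'k) dual_mat)"
proof -
  interpret D: comm_group dual by (rule dual_comm_group)
  show ?thesis by (simp add: in_DD_eq DD_mult_eq ract_one lact_one)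
qed

lemma in_DD_hom: "emb \<in> hom (CC I N) (DD scale I N)"
proof -
  interpret D: comm_group dual by (rule dual_comm_group)
  show ?thesis by (rule homI) (simp_all add: in_DD_eq DD_add DD_def)
qed

lemma subgroup_DD:
  assumes "subgroup A (CC I N)" "subgroup B dual"
  shows "subgroup (A \<times> B) (DD scale I N)"
  unfolding DD_def
  by (intro DirProd_subgroups assms comm_group.axioms(2) CC_comm_group dual_comm_group)

section \<open>The factorization of the trivial extension\<close>

theorem DD_factorization:
  "mult_induces_iso (DD scale I N) (DD_mult I N)
     (emb ` B_tilde I N G) (emb ` S_alg I N G) (B_bar scale I N G)"
proof -
  interpret C: comm_group "CC I N" by (rule CC_comm_group)
  interpret D: comm_group dual by (rule dual_comm_group)
  interpret DD: comm_group "DD scale I N" by (rule DD_comm_group)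
  have X_eq: "emb ` B_tilde I N G = B_tilde I N G \<times> {\<one>\<^bsub>dual\<^esub>}" by (auto simp: in_DD_eq)
  have one_B: "\<one>\<^bsub>dual\<^esub> \<in> B_dual" by (rule subgroup.one_closed[OF B_dual_subgroup])
  interpret tensor_factorization "DD scale I N" "DD_mult I N" "emb ` B_tilde I N G" "emb ` S_alg I N G" "B_bar scale I N G"
    strip "\<lambda>j. emb (coset_mat (unit_at j))" "\<lambda>j. coset_mat ` mats (row_shape (snd j)) \<times> row_dual (snd j)"
  proof (intro tensor_factorization.intro tensor_factorization_axioms.intro DD_comm_group)
    show "DD_mult I N a b \<in> carrier (DD scale I N)"
      if "a \<in> carrier (DD scale I N)" "b \<in> carrier (DD scale I N)" for a b
      using that by (auto simp: carrier_DD DD_mult_eq CC_mult_coset_mat mat_mult_num lact_closed ract_closed)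
    show "DD_mult I N a (b \<otimes>\<^bsub>DD scale I N\<^esub> c) = DD_mult I N a b \<otimes>\<^bsub>DD scale I N\<^esub> DD_mult I N a c"
      if abc: "a \<in> carrier (DD scale I N)" "b \<in> carrier (DD scale I N)" "c \<in> carrier (DD scale I N)" for a b c
    proof -
      obtain a' f b' g c' h where "a = (coset_mat a', f)" "b = (coset_mat b', g)" "c = (coset_mat c', h)"
        and "a' \<in> mats num" "b' \<in> mats num" "c' \<in> mats num"
        and "f \<in> carrier dual" "g \<in> carrier dual" "h \<in> carrier dual"
        using abc unfolding carrier_DD by blast
      then show ?thesis
        by (simp add: DD_mult_eq DD_add CC_mult_add_right carrier_CC lact_add_right ract_add_right
              lact_closed ract_closed D.m_ac)
    qed
    show "DD_mult I N (a \<otimes>\<^bsub>DD scale I N\<^esub> b) c = DD_mult I N a c \<otimes>\<^bsub>DD scale I N\<^esub> DD_mult I N b c"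
      if abc: "a \<in> carrier (DD scale I N)" "b \<in> carrier (DD scale I N)" "c \<in> carrier (DD scale I N)" for a b c
    proof -
      obtain a' f b' g c' h where "a = (coset_mat a', f)" "b = (coset_mat b', g)" "c = (coset_mat c', h)"
        and "a' \<in> mats num" "b' \<in> mats num" "c' \<in> mats num"
        and "f \<in> carrier dual" "g \<in> carrier dual" "h \<in> carrier dual"
        using abc unfolding carrier_DD by blast
      then show ?thesis
        by (simp add: DD_mult_eq DD_add CC_mult_add_left carrier_CC lact_add_left ract_add_left
              lact_closed ract_closed D.m_ac)
    qed
    show "DD_mult I N (DD_mult I N x b) c = DD_mult I N x (DD_mult I N b c)"
      if xbc: "x \<in> emb ` B_tilde I N G" "b \<in> carrier (DD scale I N)" "c \<in> carrier (DD scale I N)" for x b c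
    proof -
      obtain a' b' g c' h where eq: "x = emb (coset_mat a')" "b = (coset_mat b', g)" "c = (coset_mat c', h)"
        and "a' \<in> mats T_shape" and bc: "b' \<in> mats num" "c' \<in> mats num" "g \<in> carrier dual" "h \<in> carrier dual"
        using xbc unfolding carrier_DD B_tilde_eq by blast
      note a = shape_mats(1)[OF this(4)]
      have "DD_mult I N b c = (coset_mat (mat_mult b' c'), dual_lact I N (coset_mat b') h \<otimes>\<^bsub>dual\<^esub> dual_ract I N g (coset_mat c'))"
        using bc by (simp add: eq DD_mult_eq CC_mult_coset_mat)
      moreover have "dual_lact I N (coset_mat b') h \<otimes>\<^bsub>dual\<^esub> dual_ract I N g (coset_mat c') \<in> carrier dual"
        using bc by (simp add: lact_closed ract_closed)
      ultimately show ?thesis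
        using a bc
        by (simp add: eq in_DD_mult CC_mult_coset_mat mat_mult_num mat_mult_assoc DD_mult_eq lact_add_right lact_closed ract_closed
              lact_assoc lact_ract_assoc)
    qed
    show "subgroup (emb ` B_tilde I N G) (DD scale I N)"
      unfolding X_eq unfolding B_tilde_eq
      by (intro subgroup_DD subgroup_coset_mat_mats D.triv_subgroup) (simp_all add: shape_closed shape_num)
    show "DD_mult I N x x' \<in> emb ` B_tilde I N G"
      if "x \<in> emb ` B_tilde I N G" "x' \<in> emb ` B_tilde I N G" for x x'
      using that by (auto simp: in_DD_mult_in_DD B_tilde_eq CC_mult_coset_mat shape_mats mat_mult_T_shape)
    show "subgroup (B_bar scale I N G) (DD scale I N)"
      unfolding B_bar_eq
      by (intro subgroup_DD subgroup_coset_mat_mats B_dual_subgroup) (simp_all add: shape_closed shape_num)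
    show "DD_mult I N y y' \<in> B_bar scale I N G"
      if "y \<in> B_bar scale I N G" "y' \<in> B_bar scale I N G" for y y'
      using that
      by (auto simp: B_bar_eq DD_mult_eq CC_mult_coset_mat shape_mats mat_mult_B_shape
            intro!: subgroup.m_closed[OF B_dual_subgroup] lact_B_dual ract_B_dual)
    show "emb ` S_alg I N G \<subseteq> emb ` B_tilde I N G"
      by (auto simp: S_alg_eq B_tilde_eq shape_mats)
    show "emb ` S_alg I N G \<subseteq> B_bar scale I N G"
      using one_B by (auto simp: S_alg_eq B_bar_eq in_DD_eq shape_mats)
    show "emb (coset_mat (unit_at j)) \<in> emb ` B_tilde I N G" if "j \<in> strip" for j
      using that unfolding B_tilde_eq by (intro imageI unit_at_T_shape)
    show "subgroup (coset_mat ` mats (row_shape (snd j)) \<times> row_dual (snd j)) (DD scale I N)" for j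
      by (intro subgroup_DD subgroup_coset_mat_mats row_dual_subgroup) (simp_all add: shape_closed shape_num)
    show "coset_mat ` mats (row_shape (snd j)) \<times> row_dual (snd j) \<subseteq> B_bar scale I N G" for j
      by (auto simp: B_bar_eq shape_mats(4) row_dual_def)
    show "\<exists>P \<sigma>. finite P \<and> P \<subseteq> strip \<and>
        (\<forall>j\<in>P. \<sigma> j \<in> emb ` S_alg I N G \<and>
          (\<forall>y\<in>B_bar scale I N G. DD_mult I N (\<sigma> j) y \<in> coset_mat ` mats (row_shape (snd j)) \<times> row_dual (snd j))) \<and>
        x = finprod (DD scale I N) (\<lambda>j. DD_mult I N (emb (coset_mat (unit_at j))) (\<sigma> j)) P"
      if xT: "x \<in> emb ` B_tilde I N G" for x
    proof -
      obtain x0 where x0: "x0 \<in> B_tilde I N G" "x = emb x0" using xT by blast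
      obtain P m where P: "finite P" "P \<subseteq> strip" and m: "\<forall>r s. m r s \<in> G 0"
        and x0_eq: "x0 = finprod (CC I N) (\<lambda>j. CC_mult I N (coset_mat (unit_at j)) (coset_mat (single_entry (snd j) (snd j) (m (fst j) (snd j))))) P"
        using B_tilde_span[OF x0(1)] by blast
      let ?\<sigma> = "\<lambda>j. single_entry (snd j) (snd j) (m (fst j) (snd j))"
      have \<sigma>: "?\<sigma> j \<in> mats diag_shape" for j using m by (intro single_entry_diag) blast
      have "DD_mult I N (emb (coset_mat (?\<sigma> j))) y \<in> coset_mat ` mats (row_shape (snd j)) \<times> row_dual (snd j)"
        if yB: "y \<in> B_bar scale I N G" for j y
      proof -
        obtain b g where y: "y = (coset_mat b, g)" "b \<in> mats B_shape" "g \<in> B_dual"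
          using yB unfolding B_bar_eq by blast
        then show ?thesis
          using mat_mult_single_entry_row[OF m[rule_format] y(2)] lact_single_entry_row[OF m[rule_format] y(3)]
          unfolding y(1) in_DD_mult[OF shape_mats(5)[OF \<sigma>] B_dualD(1)[OF y(3)]]
            CC_mult_coset_mat[OF shape_mats(5)[OF \<sigma>] shape_mats(2)[OF y(2)]]
          by blast
      qed
      moreover have "x = finprod (DD scale I N) (\<lambda>j. emb (CC_mult I N (coset_mat (unit_at j)) (coset_mat (?\<sigma> j)))) P"
      proof -
        have "CC_mult I N (coset_mat (unit_at j)) (coset_mat (?\<sigma> j)) \<in> carrier (CC I N)" if "j \<in> P" for j
          unfolding carrier_CC CC_mult_coset_mat[OF unit_at_num[OF subsetD[OF P(2) that]] shape_mats(5)[OF \<sigma>]]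
          by (intro imageI mat_mult_num unit_at_num shape_mats(5)[OF \<sigma>] subsetD[OF P(2) that])
        then show ?thesis
          unfolding x0(2) x0_eq by (intro C.hom_finprod[OF in_DD_hom DD_comm_group P(1)] Pi_I)
      qed
      ultimately show ?thesis
        using P \<sigma>
        by (intro exI[of _ P] exI[of _ "\<lambda>j. emb (coset_mat (?\<sigma> j))"]) (auto simp: S_alg_eq in_DD_mult_in_DD)
    qed
    show "\<exists>P y. finite P \<and> P \<subseteq> strip \<and> (\<forall>j\<in>P. y j \<in> coset_mat ` mats (row_shape (snd j)) \<times> row_dual (snd j)) \<and>
        z = finprod (DD scale I N) (\<lambda>j. DD_mult I N (emb (coset_mat (unit_at j))) (y j)) P"
      if zC: "z \<in> carrier (DD scale I N)" for z
    proof -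
      obtain m f where m: "m \<in> mats num" and f: "f \<in> carrier dual" and z: "z = (coset_mat m, f)"
        using zC unfolding carrier_DD by blast
      obtain T0 where T0: "finite T0" "\<And>r c. m r c \<noteq> 0 \<Longrightarrow> r \<in> T0 \<and> c \<in> T0" using mats_support[OF m] by blast
      define T where "T = T0 \<union> fst ` {(r, c). f r c \<noteq> (\<lambda>_. 0)}"
      have T: "finite T" and Tm: "\<And>r c. m r c \<noteq> 0 \<Longrightarrow> r \<in> T" and Tf: "\<And>r c. f r c \<noteq> (\<lambda>_. 0) \<Longrightarrow> r \<in> T"
        using T0 dual_finite[OF f] by (force simp: T_def)+
      let ?P = "strip_rows T"
      have P: "finite ?P" "?P \<subseteq> strip" using strip_rows T by auto
      have mats: "unit_at j \<in> mats num" "row_part m j \<in> mats num" if "j \<in> ?P" for j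
        using that P(2) m by (auto intro!: unit_at_num shape_mats(3)[OF row_part_mats])
      have gR: "dual_row_part f j \<in> row_dual (snd j)" if "j \<in> ?P" for j
        using that P(2) f by (intro dual_row_part_mem) auto
      then have g: "dual_row_part f j \<in> carrier dual" if "j \<in> ?P" for j
        using that by (auto simp: row_dual_def B_dualD(1))
      have "finprod (DD scale I N) (\<lambda>j. DD_mult I N (emb (coset_mat (unit_at j))) (coset_mat (row_part m j), dual_row_part f j)) ?P =
          finprod (DD scale I N) (\<lambda>j. (coset_mat (mat_mult (unit_at j) (row_part m j)), dual_lact I N (coset_mat (unit_at j)) (dual_row_part f j))) ?P"
        using mats g
        by (intro DD.finprod_cong') (auto simp: in_DD_mult CC_mult_coset_mat carrier_DD mat_mult_num lact_closed)
      also have "\<dots> = (finprod (CC I N) (\<lambda>j. coset_mat (mat_mult (unit_at j) (row_part m j))) ?P,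
          finprod dual (\<lambda>j. dual_lact I N (coset_mat (unit_at j)) (dual_row_part f j)) ?P)"
        using mats g P by (intro finprod_DD) (auto simp: carrier_CC mat_mult_num lact_closed)
      also have "finprod (CC I N) (\<lambda>j. coset_mat (mat_mult (unit_at j) (row_part m j))) ?P = coset_mat m"
      proof -
        have "finprod (CC I N) (\<lambda>j. coset_mat (mat_mult (unit_at j) (row_part m j))) ?P =
            coset_mat (\<lambda>r c. \<Sum>j\<in>?P. mat_mult (unit_at j) (row_part m j) r c)"
          by (rule finprod_coset_mat) (auto intro: mats mat_mult_num P)
        also have "\<dots> = coset_mat m"
          unfolding eq_commute[of _ "coset_mat m"] coset_mat_eq_iff using rows_span[OF m T] Tm by blast
        finally show ?thesis .
      qed
      also have "finprod dual (\<lambda>j. dual_lact I N (coset_mat (unit_at j)) (dual_row_part f j)) ?P = f"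
      proof (rule dual_ext)
        show "finprod dual (\<lambda>j. dual_lact I N (coset_mat (unit_at j)) (dual_row_part f j)) ?P r c X = 0"
          if "X \<notin> entry I N c r" for r c X
          using that mats g by (intro dual_outside D.finprod_closed) (auto simp: lact_closed)
        show "val (finprod dual (\<lambda>j. dual_lact I N (coset_mat (unit_at j)) (dual_row_part f j)) ?P) r c x = val f r c x"
          if "x \<in> num c r" for r c x
          using that mats g P
          by (subst finprod_dual) (auto simp: lact_closed dual_rows_span[OF f T] Tf)
      qed (use f dual_outside in auto)
      finally show ?thesis
        using P row_part_mats[OF m] gR unfolding z
        by (intro exI[of _ ?P] exI[of _ "\<lambda>j. (coset_mat (row_part m j), dual_row_part f j)"]) auto
    qed
    show "y j = \<one>\<^bsub>DD scale I N\<^esub>"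
      if P: "finite P" "P \<subseteq> strip" and y: "\<forall>j\<in>P. y j \<in> coset_mat ` mats (row_shape (snd j)) \<times> row_dual (snd j)"
        and zero: "finprod (DD scale I N) (\<lambda>j. DD_mult I N (emb (coset_mat (unit_at j))) (y j)) P = \<one>\<^bsub>DD scale I N\<^esub>"
        and j: "j \<in> P"
      for P y j
    proof -
      have "\<forall>j\<in>P. \<exists>m. m \<in> mats (row_shape (snd j)) \<and> fst (y j) = coset_mat m"
        using y by fastforce
      from bchoice[OF this] obtain \<eta> where \<eta>: "\<forall>j\<in>P. \<eta> j \<in> mats (row_shape (snd j)) \<and> fst (y j) = coset_mat (\<eta> j)"
        by blast
      let ?g = "\<lambda>j. snd (y j)"
      have gR: "?g j \<in> row_dual (snd j)" if "j \<in> P" for j using y that by (metis mem_Times_iff)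
      then have g: "?g j \<in> carrier dual" if "j \<in> P" for j using that by (auto simp: row_dual_def B_dualD(1))
      have y_eq: "y j = (coset_mat (\<eta> j), ?g j)" if "j \<in> P" for j using \<eta> that by (simp add: prod_eq_iff)
      have mats: "unit_at j \<in> mats num" "\<eta> j \<in> mats num" if "j \<in> P" for j
        using that P(2) \<eta> by (auto intro!: unit_at_num intro: shape_mats(3))
      have "finprod (DD scale I N) (\<lambda>j. DD_mult I N (emb (coset_mat (unit_at j))) (y j)) P =
          finprod (DD scale I N) (\<lambda>j. (coset_mat (mat_mult (unit_at j) (\<eta> j)), dual_lact I N (coset_mat (unit_at j)) (?g j))) P"
      proof (rule DD.finprod_cong')
        show "DD_mult I N (emb (coset_mat (unit_at j))) (y j) =
            (coset_mat (mat_mult (unit_at j) (\<eta> j)), dual_lact I N (coset_mat (unit_at j)) (?g j))" if "j \<in> P" for j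
          by (subst y_eq[OF that])
             (simp add: in_DD_mult CC_mult_coset_mat mats[OF that] g[OF that])
      qed (auto simp: carrier_DD mat_mult_num lact_closed mats g)
      also have "\<dots> = (finprod (CC I N) (\<lambda>j. coset_mat (mat_mult (unit_at j) (\<eta> j))) P,
          finprod dual (\<lambda>j. dual_lact I N (coset_mat (unit_at j)) (?g j)) P)"
        using mats g P by (intro finprod_DD) (auto simp: carrier_CC mat_mult_num lact_closed)
      also have "finprod (CC I N) (\<lambda>j. coset_mat (mat_mult (unit_at j) (\<eta> j))) P = coset_mat (\<lambda>r c. \<Sum>j\<in>P. mat_mult (unit_at j) (\<eta> j) r c)"
        by (rule finprod_coset_mat) (auto intro: mats mat_mult_num P)
      finally have zeros: "coset_mat (\<lambda>r c. \<Sum>j\<in>P. mat_mult (unit_at j) (\<eta> j) r c) = coset_mat (\<lambda>r c. 0)"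
        "finprod dual (\<lambda>j. dual_lact I N (coset_mat (unit_at j)) (?g j)) P = \<one>\<^bsub>dual\<^esub>"
        using zero by (simp_all add: coset_mat_zero DD_one)
      have "\<eta> j = (\<lambda>r c. 0)"
        using \<eta> P j zeros(1) by (intro rows_independent[of P \<eta>]) (auto simp: coset_mat_eq_iff)
      moreover have "?g j = (\<lambda>r c X. 0)"
      proof (rule dual_rows_independent[of P ?g, OF P gR _ j])
        show "(\<Sum>j\<in>P. val (dual_lact I N (coset_mat (unit_at j)) (?g j)) r c x) = 0" for r c x
          using mats g P zeros(2) finprod_dual[of P "\<lambda>j. dual_lact I N (coset_mat (unit_at j)) (?g j)" r c x]
          by (simp add: lact_closed, simp add: dual_one val_def)
      qed
      ultimately show ?thesis using y_eq[OF j] by (simp add: coset_mat_zero DD_one dual_one)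
    qed
  qed
  show ?thesis by (rule factorization)
qed

end

theorem theorem15:
  shows
    "(\<forall>(scale :: 'k::alg_closed_field \<Rightarrow> 'a::{ring,monoid_mult} \<Rightarrow> 'a) I N G.
        k_algebra scale \<and> finite_dimensional scale \<and> basic_algebra TYPE('a) \<and>
        ideal_filtration I N \<and> semisimple_layers I N \<and>
        positive_grading scale G \<and> (\<forall>j. I j = degree_ge G j)
        \<longrightarrow> mult_induces_iso (CC I N) (CC_mult I N) (B_tilde I N G) (S_alg I N G) (B_alg I N G))
     \<and>
     (\<forall>(Q :: ('v, 'e) pre_digraph) (R :: (('v, 'e) path \<Rightarrow>\<^sub>0 'k) set)
        (scale :: 'k \<Rightarrow> 'b::{ring,monoid_mult} \<Rightarrow> 'b)
        (scale' :: 'k \<Rightarrow> 'c::{ring,monoid_mult} \<Rightarrow> 'c) N G.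
        fin_digraph Q \<and> R \<subseteq> relations Q \<and>
        given_by_quiver scale Q R \<and> finite_dimensional scale \<and>
        given_by_quiver scale' (attach_quiver Q) (attach_element ` R) \<and>
        rad_nilpotency_degree TYPE('c) N \<and>
        positive_grading scale' G \<and> (\<forall>j. rad_pow j = degree_ge G j)
        \<longrightarrow> mult_induces_iso (DD scale' rad_pow N) (DD_mult rad_pow N)
              (in_DD ` B_tilde rad_pow N G) (in_DD ` S_alg rad_pow N G) (B_bar scale' rad_pow N G))"
proof (intro conjI allI impI; elim conjE)
  fix scale :: "'k \<Rightarrow> 'a \<Rightarrow> 'a" and I N G
  assume "k_algebra scale" "positive_grading scale G" "\<forall>j. I j = degree_ge G j" "ideal_filtration I N"
  then interpret graded_filtration scale G I N
    by (simp add: graded_filtration_def graded_filtration_axioms_def ideal_filtration_def)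
  show "mult_induces_iso (CC I N) (CC_mult I N) (B_tilde I N G) (S_alg I N G) (B_alg I N G)"
    by (rule CC_factorization)
next
  fix Q :: "('v, 'e) pre_digraph" and R :: "(('v, 'e) path \<Rightarrow>\<^sub>0 'k) set"
    and scale' :: "'k \<Rightarrow> 'c \<Rightarrow> 'c" and N G
  assume "given_by_quiver scale' (attach_quiver Q) (attach_element ` R)"
    "rad_nilpotency_degree TYPE('c) N" "positive_grading scale' G" "\<forall>j. rad_pow j = degree_ge G j"
  then interpret graded_filtration scale' G rad_pow N
    by (simp add: graded_filtration_def graded_filtration_axioms_def given_by_quiver_def rad_nilpotency_degree_def)
  show "mult_induces_iso (DD scale' rad_pow N) (DD_mult rad_pow N)
      (in_DD ` B_tilde rad_pow N G) (in_DD ` S_alg rad_pow N G) (B_bar scale' rad_pow N G)"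
    by (rule DD_factorization)
qed

end
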